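(* Let $k\ge1$ be an integer, $\rho\in[0,1)$, and let $Y_f^{\rho,k}(t)=\sum_{i=1}^{N_f(t)}X_i$, $t\ge0$, where the iid jumps $X_i$ have the truncated geometric distribution $\mathbb{P}[X_i=j]=\frac{1-\rho}{1-\rho^k}\rho^{j-1}$, $j=1,\dots,k$. Then the probability mass function $P_f^{\rho,k}(n,t)=\mathbb{P}[Y_f^{\rho,k}(t)=n]$ satisfies $$\mathcal{D}^f_tP^{\rho,k}_f(n,t)=-\lambda\left(1-\frac{1-\rho}{1-\rho^k}\sum_{j=1}^{n\wedge k}\rho^{j-1}B^j\right)P^{\rho,k}_f(n,t),\qquad n=1,2,\dots,$$ $$\mathcal{D}^f_tP^{\rho,k}_f(0,t)=-\lambda P^{\rho,k}_f(0,t),$$ with initial condition $P^{\rho,k}_f(n,0)=\delta_{n,0}$.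
   Context: Let $f(s)=bs+\int_0^\infty(1-e^{-sx})\,\nu(dx)$, $s>0$, with $b\ge 0$ and $\nu$ a non-negative L\'evy measure on $(0,\infty)$ with $\int_0^\infty (x\wedge 1)\,\nu(dx)<\infty$ and $\nu((0,\infty))=\infty$. Let $\{D_f(t)\}_{t\ge0}$ be the L\'evy subordinator with $\mathbb{E}[e^{-sD_f(t)}]=e^{-tf(s)}$ and $E_f(t)=\inf\{r\ge0: D_f(r)>t\}$ its inverse. Let $\{N(t)\}_{t\ge0}$ be a Poisson process with rate $\lambda>0$ independent of $\{E_f(t)\}$, and $N_f(t)=N(E_f(t))$. The iid jumps $X_i$ are independent of $N$ and $E_f$, and an empty sum is $0$. The process $Y_f^{\rho,k}$ is called the generalized P\'olya–Aeppli process of order $k$. $B$ is the backward shift in $n$: $B[P(n,t)]=P(n-1,t)$. $\delta_{n,0}$ is the Kronecker delta, $0^0=1$, and $n\wedge k=\min(n,k)$. The generalized Caputo–Djrbashian derivative with respect to $f$ is, for absolutely continuous $u$, $$\mathcal{D}^f_t u(t)=b\frac{d}{dt}u(t)+\int_0^t\frac{\partial}{\partial t}u(t-s)\,\bar\nu(s)\,ds,\qquad \bar\nu(s)=\nu((s,\infty)).$$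
   Formalization: The probability mass functions P(n,·) are assumed absolutely continuous (the domain of the derivative), which can fail for some Lévy measures when b=0; the equations are asserted for t>0, since at t=0 they fail when b=0. *)

theory Defs
  imports "HOL-Probability.Probability"
begin

section \<open>Bernstein functions and the generalized Caputo--Djrbashian derivative\<close>

definition levy_measure :: "real measure \<Rightarrow> bool" where
  "levy_measure \<nu> \<longleftrightarrow>
     sets \<nu> = sets borel \<and> emeasure \<nu> {..0} = 0 \<and>
     (\<integral>\<^sup>+ x\<in>{0<..}. ennreal (min x 1) \<partial>\<nu>) < \<infinity>"

definition bernstein_fun :: "real \<Rightarrow> real measure \<Rightarrow> real \<Rightarrow> real" where
  "bernstein_fun b \<nu> s = b * s + (LINT x:{0<..}|\<nu>. 1 - exp (- s * x))"

(* Finite for s > 0 when levy_measure holds; the value at s = 0 (where the tail may be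
   infinite and "measure" then returns 0) only affects a null set of integration points. *)
definition levy_tail :: "real measure \<Rightarrow> real \<Rightarrow> real" where
  "levy_tail \<nu> s = measure \<nu> {s<..}"

definition abs_continuous_on_Icc :: "(real \<Rightarrow> real) \<Rightarrow> real \<Rightarrow> real \<Rightarrow> bool" where
  "abs_continuous_on_Icc u a c \<longleftrightarrow>
     (\<forall>\<epsilon>>0. \<exists>\<delta>>0. \<forall>(m::nat) (x::nat \<Rightarrow> real) (y::nat \<Rightarrow> real).
        (\<forall>i<m. a \<le> x i \<and> x i \<le> y i \<and> y i \<le> c) \<longrightarrow>
        disjoint_family_on (\<lambda>i. {x i<..<y i}) {..<m} \<longrightarrow>
        (\<Sum>i<m. y i - x i) < \<delta> \<longrightarrow>
        (\<Sum>i<m. \<bar>u (y i) - u (x i)\<bar>) < \<epsilon>)"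

definition abs_continuous_halfline :: "(real \<Rightarrow> real) \<Rightarrow> bool" where
  "abs_continuous_halfline u \<longleftrightarrow> (\<forall>T>0. abs_continuous_on_Icc u 0 T)"

(* "The derivative of u at t exists and equals v", for locally absolutely continuous u.
   It is a relation so that no default value of deriv or of a divergent integral can
   play a role. The integrand is defined for almost every s only, because u is differentiable
   almost everywhere only; for the same reason differentiability at the point t itself is
   required only if the drift term b * u'(t) is present. *)
definition has_gen_CD_derivative ::
    "real \<Rightarrow> real measure \<Rightarrow> (real \<Rightarrow> real) \<Rightarrow> real \<Rightarrow> real \<Rightarrow> bool" where
  "has_gen_CD_derivative b \<nu> u v t \<longleftrightarrow>
     abs_continuous_halfline u \<and>
     (b \<noteq> 0 \<longrightarrow> u differentiable (at t)) \<and>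
     set_integrable lebesgue {0..t} (\<lambda>s. deriv (\<lambda>r. u (r - s)) t * levy_tail \<nu> s) \<and>
     v = b * deriv u t
         + (LINT s:{0..t}|lebesgue. deriv (\<lambda>r. u (r - s)) t * levy_tail \<nu> s)"

section \<open>Processes\<close>

text \<open>Processes are indexed by real numbers, but only times \<open>t \<ge> 0\<close> are ever constrained.\<close>

definition indep_increments :: "'a measure \<Rightarrow> (real \<Rightarrow> 'a \<Rightarrow> real) \<Rightarrow> bool" where
  "indep_increments M Z \<longleftrightarrow>
     (\<forall>(n::nat) (\<tau>::nat \<Rightarrow> real). 0 \<le> \<tau> 0 \<longrightarrow> (\<forall>i<n. \<tau> i \<le> \<tau> (Suc i)) \<longrightarrow>
        prob_space.indep_vars M (\<lambda>_. borel) (\<lambda>i \<omega>. Z (\<tau> (Suc i)) \<omega> - Z (\<tau> i) \<omega>) {..<n})"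

definition levy_subordinator ::
    "'a measure \<Rightarrow> (real \<Rightarrow> real) \<Rightarrow> (real \<Rightarrow> 'a \<Rightarrow> real) \<Rightarrow> bool" where
  "levy_subordinator M f D \<longleftrightarrow>
     (\<forall>t\<ge>0. D t \<in> borel_measurable M) \<and>
     (AE \<omega> in M. D 0 \<omega> = 0) \<and>
     (AE \<omega> in M. mono_on {0..} (\<lambda>t. D t \<omega>) \<and> (\<forall>t\<ge>0. continuous (at_right t) (\<lambda>r. D r \<omega>))) \<and>
     indep_increments M D \<and>
     (\<forall>s t. 0 \<le> s \<longrightarrow> s \<le> t \<longrightarrow>
        distr M borel (\<lambda>\<omega>. D t \<omega> - D s \<omega>) = distr M borel (D (t - s))) \<and>
     (\<forall>t\<ge>0. \<forall>s>0. prob_space.expectation M (\<lambda>\<omega>. exp (- s * D t \<omega>)) = exp (- t * f s))"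

definition inverse_subordinator :: "(real \<Rightarrow> 'a \<Rightarrow> real) \<Rightarrow> real \<Rightarrow> 'a \<Rightarrow> real" where
  "inverse_subordinator D t \<omega> = Inf {r. 0 \<le> r \<and> t < D r \<omega>}"

definition poisson_process :: "'a measure \<Rightarrow> real \<Rightarrow> (real \<Rightarrow> 'a \<Rightarrow> nat) \<Rightarrow> bool" where
  "poisson_process M lam N \<longleftrightarrow>
     (\<forall>t\<ge>0. N t \<in> measurable M (count_space UNIV)) \<and>
     (AE \<omega> in M. N 0 \<omega> = 0) \<and>
     (AE \<omega> in M. mono_on {0..} (\<lambda>t. N t \<omega>) \<and> (\<forall>t\<ge>0. continuous (at_right t) (\<lambda>r. N r \<omega>))) \<and>
     indep_increments M (\<lambda>t \<omega>. real (N t \<omega>)) \<and>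
     (\<forall>s t. 0 \<le> s \<longrightarrow> s < t \<longrightarrow>
        (\<forall>j. measure M {\<omega> \<in> space M. N t \<omega> = N s \<omega> + j} = pmf (poisson_pmf (lam * (t - s))) j))"

(* prob_space.indep_var, but for X and Y with values in different types. *)
definition indep_random_elements ::
    "'a measure \<Rightarrow> 'b measure \<Rightarrow> ('a \<Rightarrow> 'b) \<Rightarrow> 'c measure \<Rightarrow> ('a \<Rightarrow> 'c) \<Rightarrow> bool" where
  "indep_random_elements M S X T Y \<longleftrightarrow>
     X \<in> measurable M S \<and> Y \<in> measurable M T \<and>
     prob_space.indep_set M {X -` A \<inter> space M | A. A \<in> sets S} {Y -` A \<inter> space M | A. A \<in> sets T}"

definition iid_truncated_geometric ::
    "'a measure \<Rightarrow> real \<Rightarrow> nat \<Rightarrow> (nat \<Rightarrow> 'a \<Rightarrow> nat) \<Rightarrow> bool" where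
  "iid_truncated_geometric M \<rho> k X \<longleftrightarrow>
     prob_space.indep_vars M (\<lambda>_. count_space UNIV) X {1..} \<and>
     (\<forall>i\<ge>1. \<forall>j\<in>{1..k}.
        measure M {\<omega> \<in> space M. X i \<omega> = j} = (1 - \<rho>) / (1 - \<rho> ^ k) * \<rho> ^ (j - 1))"

definition compound_process ::
    "(nat \<Rightarrow> 'a \<Rightarrow> nat) \<Rightarrow> (real \<Rightarrow> 'a \<Rightarrow> nat) \<Rightarrow> (real \<Rightarrow> 'a \<Rightarrow> real) \<Rightarrow> real \<Rightarrow> 'a \<Rightarrow> nat" where
  "compound_process X N E t \<omega> = (\<Sum>i=1..N (E t \<omega>) \<omega>. X i \<omega>)"

(* Path properties hold almost surely only, so the event may be measurable only up to
   a null set; the completion agrees with M on the sets of M. *)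
definition process_pmf :: "'a measure \<Rightarrow> (real \<Rightarrow> 'a \<Rightarrow> nat) \<Rightarrow> nat \<Rightarrow> real \<Rightarrow> real" where
  "process_pmf M Y n t = measure (completion M) {\<omega> \<in> space M. Y t \<omega> = n}"

(* Truncated subtraction on nat is harmless as long as the j-th iterate is only
   evaluated at n \<ge> j. *)
definition backward_shift :: "(nat \<Rightarrow> real \<Rightarrow> real) \<Rightarrow> nat \<Rightarrow> real \<Rightarrow> real" where
  "backward_shift P n t = P (n - 1) t"

end

theory Submission
  imports Defs
begin

text \<open>Write \<open>f\<close> for the Bernstein function, \<open>K\<close> for the tail of \<open>\<nu>\<close>, \<open>*\<close> for convolution on the half-line,
  and \<open>g l t\<close> for the probability that \<open>N_f(t) = l\<close>. Evaluating \<open>E_f\<close> at an independent exponential time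
  shows that \<open>g l\<close> has Laplace transform \<open>lam^l f(s) / (s (lam + f(s))^(l+1))\<close>. Absolute continuity of
  \<open>P 0 = g 0\<close> yields a density \<open>v\<close> with Laplace transform \<open>1 / (lam + f(s))\<close>, so that \<open>g (l+1) = lam v * g l\<close>
  and \<open>b v + K * v = g 0\<close> almost everywhere.

  The last identity has to be upgraded to all \<open>t > 0\<close>. If \<open>b > 0\<close>, then \<open>v\<close> is bounded, hence \<open>K * v\<close> is
  continuous and \<open>v\<close> has a continuous version. If \<open>b = 0\<close>, a first passage decomposition (in purely analytic
  form) shows that the subordinator does not creep over any level. Convolving with powers of \<open>v\<close> gives
  \<open>b w l + K * w l = g l\<close> everywhere for \<open>w l = lam^l v * ... * v\<close>, while \<open>g l\<close> is an
  indefinite integral of \<open>lam (w (l-1) - w l)\<close>. Since \<open>P n\<close> is a combination of the \<open>g l\<close> whose coefficients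
  are convolution powers of the jump law, the claim follows by linearity.\<close>

section \<open>Lebesgue differentiation on the line\<close>

text \<open>The claim is wanted at every t > 0, whereas uniqueness of Laplace transforms gives
  equalities almost everywhere only. For b = 0 neither \<open>v\<close> nor the kernel K need be
  bounded, so continuity of K * v is not at hand; this is what forces the detour through first
  passage. Functions with values in \<open>ennreal\<close> make Fubini and the associativity of
  convolution unconditional and postpone questions of finiteness. The integrand of the
  Caputo--Djrbashian derivative contains a genuine \<open>deriv\<close> of an absolutely continuous
  function, so its density has to be recovered from difference quotients at almost every point:
  hence the differentiation theorem on the line. The infinite mass of \<nu> enters through the
  Bernstein function: it is positive, and its unboundedness forces the inverse subordinator to
  vanish at time 0, which yields the initial condition. Behind the recursion for \<open>g\<close>
  stands the fact that N_f is a renewal process whose waiting times have density \<open>lam\<close>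
  v.\<close>

lemma lebesgue_differentiation_aux:
  fixes d :: "real \<Rightarrow> real"
  assumes d: "d integrable_on {a..b}" and e: "e > 0"
  defines "F \<equiv> \<lambda>t. integral {a..t} d"
  shows "negligible {x\<in>{a<..<b}. \<forall>\<delta>>0. \<exists>y. y \<noteq> x \<and> \<bar>y - x\<bar> < \<delta> \<and>
    \<bar>F y - F x - d x * (y - x)\<bar> > e * \<bar>y - x\<bar>}" (is "negligible ?A")
proof (rule negligible_outer_le[THEN iffD2], intro allI impI)
  fix \<eta> :: real assume \<eta>: "\<eta> > 0"
  have dab: "d integrable_on cbox a b" using d by simp
  \<comment> \<open>With tolerance \<open>e * \<eta>\<close> in the Henstock lemma, tagged intervals
    on which the increment of \<open>F\<close> is off by at least \<open>e\<close> times their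
    length have total length at most \<eta>.\<close>
  obtain \<gamma> where \<gamma>: "gauge \<gamma>"
    and hen: "\<And>p. \<lbrakk>p tagged_partial_division_of (cbox a b); \<gamma> fine p\<rbrakk> \<Longrightarrow>
             (\<Sum>(x,k)\<in>p. norm (measure lborel k *\<^sub>R d x - integral k d)) < e * \<eta>"
    using Henstock_lemma[OF dab, of "e * \<eta>"] e \<eta> by auto
  \<comment> \<open>A pair (x, y) encodes a bad interval with tag x at one end and y at the other.
    Centre \<open>c\<close> and radius \<open>r\<close> turn it into a closed ball, the shape
    required by the Vitali covering theorem.\<close>
  define I where "I = {(x, y). x \<in> ?A \<and> y \<noteq> x \<and> a < y \<and> y < b \<and> cbox (min x y) (max x y) \<subseteq> \<gamma> x
    \<and> \<bar>F y - F x - d x * (y - x)\<bar> > e * \<bar>y - x\<bar>}"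
  define c :: "real \<times> real \<Rightarrow> real" where "c = (\<lambda>(x, y). (x + y) / 2)"
  define r :: "real \<times> real \<Rightarrow> real" where "r = (\<lambda>(x, y). \<bar>y - x\<bar> / 2)"
  have ball: "cball (c (x, y)) (r (x, y)) = cbox (min x y) (max x y)" for x y
    unfolding c_def r_def cball_eq_atLeastAtMost
    by (cases "x \<le> y") (auto simp: field_simps min_def max_def)
  have rpos: "0 < r i" if "i \<in> I" for i
    using that by (auto simp: I_def r_def)
  have vit: "\<exists>i. i \<in> I \<and> x \<in> cball (c i) (r i) \<and> r i < \<delta>" if x: "x \<in> ?A" and \<delta>: "0 < \<delta>" for x \<delta>
  proof -
    have "open (\<gamma> x)" "x \<in> \<gamma> x" using \<gamma> by (auto simp: gauge_def)
    then obtain e1 where e1: "e1 > 0" "ball x e1 \<subseteq> \<gamma> x" by (auto simp: open_contains_ball)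
    define \<delta>' where "\<delta>' = Min {\<delta>, e1, x - a, b - x}"
    have "\<delta>' > 0" using \<delta> e1 x by (auto simp: \<delta>'_def)
    then obtain y where y: "y \<noteq> x" "\<bar>y - x\<bar> < \<delta>'" "\<bar>F y - F x - d x * (y - x)\<bar> > e * \<bar>y - x\<bar>"
      using x by blast
    have y': "\<bar>y - x\<bar> < \<delta>" "\<bar>y - x\<bar> < e1" "\<bar>y - x\<bar> < x - a" "\<bar>y - x\<bar> < b - x"
      using y(2) by (auto simp: \<delta>'_def)
    have "cbox (min x y) (max x y) \<subseteq> ball x e1"
      using y' by (auto simp: dist_real_def min_def max_def split: if_splits)
    then have "(x, y) \<in> I"
      using x y y' e1 unfolding I_def by auto
    moreover have "x \<in> cball (c (x, y)) (r (x, y))" unfolding ball by auto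
    moreover have "r (x, y) < \<delta>" using y' by (auto simp: r_def)
    ultimately show ?thesis by blast
  qed
  obtain C where C: "countable C" "C \<subseteq> I"
     "pairwise (\<lambda>i j. disjnt (cball (c i) (r i)) (cball (c j) (r j))) C"
     "negligible (?A - (\<Union>i\<in>C. cball (c i) (r i)))"
  proof (rule Vitali_covering_theorem_cballs[of I r ?A c])
    show "0 < r i" if "i \<in> I" for i by (rule rpos[OF that])
    show "\<exists>i. i \<in> I \<and> x \<in> cball (c i) (r i) \<and> r i < \<delta>" if "x \<in> ?A" "0 < \<delta>" for x \<delta>
      by (rule vit[OF that])
  qed (rule that)
  have bound: "measure lebesgue (\<Union>i\<in>C'. cball (c i) (r i)) \<le> \<eta>"
    if C': "C' \<subseteq> C" "finite C'" for C'
  proof -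
    define q where "q = (\<lambda>i. (fst i, cball (c i) (r i)))"
    have inj: "inj_on q C'"
    proof (rule inj_onI)
      fix i j assume ij: "i \<in> C'" "j \<in> C'" "q i = q j"
      have "r i > 0" using ij C' C(2) rpos by blast
      then have "c i \<in> cball (c i) (r i)" by simp
      moreover have "cball (c i) (r i) = cball (c j) (r j)" using ij by (auto simp: q_def)
      ultimately have "\<not> disjnt (cball (c i) (r i)) (cball (c j) (r j))"
        unfolding disjnt_def by blast
      then show "i = j" using ij C' C(3) unfolding pairwise_def by blast
    qed
    have "(q ` C') tagged_partial_division_of cbox a b"
      unfolding tagged_partial_division_of_def
    proof (intro conjI allI impI)
      show "finite (q ` C')" using C' by simp
    next
      fix x K assume "(x, K) \<in> q ` C'"
      then obtain y where xy: "(x, y) \<in> C'" "K = cbox (min x y) (max x y)"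
        unfolding q_def using ball by force
      then have "(x, y) \<in> I" using C' C(2) by blast
      then show "x \<in> K" "K \<subseteq> cbox a b" "\<exists>a b. K = cbox a b"
        using xy by (auto simp: I_def)
    next
      fix x1 K1 x2 K2
      assume "(x1, K1) \<in> q ` C' \<and> (x2, K2) \<in> q ` C' \<and> (x1, K1) \<noteq> (x2, K2)"
      then obtain i j where ij: "i \<in> C'" "j \<in> C'" "K1 = cball (c i) (r i)" "K2 = cball (c j) (r j)" "i \<noteq> j"
        by (auto simp: q_def)
      then have "K1 \<inter> K2 = {}" using C' C(3) unfolding pairwise_def disjnt_def by blast
      then show "interior K1 \<inter> interior K2 = {}"
        using interior_subset by blast
    qed
    moreover have "\<gamma> fine (q ` C')"
    proof (rule fineI)
      fix x K assume "(x, K) \<in> q ` C'"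
      then obtain y where xy: "(x, y) \<in> C'" "K = cbox (min x y) (max x y)"
        unfolding q_def using ball by force
      then have "(x, y) \<in> I" using C' C(2) by blast
      then show "K \<subseteq> \<gamma> x" using xy by (auto simp: I_def)
    qed
    ultimately have "(\<Sum>(x,k)\<in>q ` C'. norm (measure lborel k *\<^sub>R d x - integral k d)) < e * \<eta>"
      by (rule hen)
    moreover have "(\<Sum>(x,k)\<in>q ` C'. norm (measure lborel k *\<^sub>R d x - integral k d)) \<ge> (\<Sum>i\<in>C'. e * measure lebesgue (cball (c i) (r i)))"
      unfolding sum.reindex[OF inj] o_def
    proof (rule sum_mono)
      fix i assume i: "i \<in> C'"
      obtain x y where xy: "i = (x, y)" by (cases i)
      have I: "(x, y) \<in> I" using i xy C' C(2) by blast
      define m where "m = min x y"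
      define M where "M = max x y"
      have mM: "m \<le> M" "a < m" "M < b" using I by (auto simp: I_def m_def M_def)
      have "integral {a..m} d + integral {m..M} d = integral {a..M} d"
        by (rule Henstock_Kurzweil_Integration.integral_combine)
          (use mM in \<open>auto intro: integrable_on_subinterval[OF d]\<close>)
      then have "integral {m..M} d = F M - F m" by (simp add: F_def)
      then have "\<bar>(M - m) * d x - integral {m..M} d\<bar> = \<bar>F y - F x - d x * (y - x)\<bar>"
        by (cases "x \<le> y") (auto simp: m_def M_def min_def max_def algebra_simps abs_if)
      moreover have "\<bar>F y - F x - d x * (y - x)\<bar> \<ge> e * (M - m)"
        using I by (auto simp: I_def M_def m_def min_def max_def abs_if split: if_splits)
      ultimately show "e * measure lebesgue (cball (c i) (r i)) \<le> (case q i of (x, k) \<Rightarrow> norm (measure lborel k *\<^sub>R d x - integral k d))"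
        using mM by (simp add: q_def xy ball m_def[symmetric] M_def[symmetric])
    qed
    ultimately have "e * (\<Sum>i\<in>C'. measure lebesgue (cball (c i) (r i))) < e * \<eta>"
      by (simp add: sum_distrib_left)
    then have "(\<Sum>i\<in>C'. measure lebesgue (cball (c i) (r i))) \<le> \<eta>"
      using e by simp
    moreover have "measure lebesgue (\<Union>i\<in>C'. cball (c i) (r i)) \<le> (\<Sum>i\<in>C'. measure lebesgue (cball (c i) (r i)))"
      by (rule measure_UNION_le) (use C' in auto)
    ultimately show ?thesis by linarith
  qed
  \<comment> \<open>The bound \<eta> for finite subfamilies passes to the countable union; what the
    Vitali family leaves uncovered is null.\<close>
  define U where "U = (\<Union>i\<in>C. cball (c i) (r i))"
  define Z where "Z = ?A - U"
  have Ul: "U \<in> lmeasurable" "measure lebesgue U \<le> \<eta>"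
    unfolding U_def by (rule fmeasurable_UN_bound measure_UN_bound; use C bound in auto)+
  have Z: "negligible Z" using C by (simp add: Z_def U_def)
  show "\<exists>T. ?A \<subseteq> T \<and> T \<in> lmeasurable \<and> measure lebesgue T \<le> \<eta>"
  proof (intro exI conjI)
    show "?A \<subseteq> U \<union> Z" by (auto simp: Z_def)
    show "U \<union> Z \<in> lmeasurable" using Ul Z by (simp add: fmeasurable.Un negligible_imp_measurable)
    have "measure lebesgue (U \<union> Z) \<le> measure lebesgue U + measure lebesgue Z"
      using Ul Z by (intro measure_Un_le) (auto simp: negligible_imp_sets)
    then show "measure lebesgue (U \<union> Z) \<le> \<eta>" using Ul Z negligible_imp_measure0 by fastforce
  qed
qed

text \<open>Failure of differentiability with slope \<open>d x\<close> means that some error rate 1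
  / (n + 1) is exceeded at arbitrarily small scales, and each rate contributes a null set.\<close>

lemma lebesgue_differentiation:
  fixes d :: "real \<Rightarrow> real"
  assumes d: "d integrable_on {a..b}"
  shows "negligible {x\<in>{a<..<b}. \<not> ((\<lambda>t. integral {a..t} d) has_real_derivative d x) (at x)}"
proof -
  define F where "F = (\<lambda>t. integral {a..t} d)"
  define A where "A = (\<lambda>e. {x\<in>{a<..<b}. \<forall>\<delta>>0. \<exists>y. y \<noteq> x \<and> \<bar>y - x\<bar> < \<delta> \<and>
    \<bar>F y - F x - d x * (y - x)\<bar> > e * \<bar>y - x\<bar>})"
  have "negligible (\<Union>n. A (1 / real (Suc n)))"
    by (rule negligible_Union_nat)
      (unfold A_def F_def, rule lebesgue_differentiation_aux[OF d], simp)
  moreover have "{x\<in>{a<..<b}. \<not> (F has_real_derivative d x) (at x)} \<subseteq> (\<Union>n. A (1 / real (Suc n)))"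
  proof
    fix x assume x: "x \<in> {x\<in>{a<..<b}. \<not> (F has_real_derivative d x) (at x)}"
    then have "\<not> (F has_derivative (*) (d x)) (at x)" by (simp add: has_field_derivative_def)
    then obtain e where e: "e > 0" "\<And>\<delta>. \<delta> > 0 \<Longrightarrow> \<exists>y. \<bar>y - x\<bar> < \<delta> \<and> \<bar>F y - F x - d x * (y - x)\<bar> > e * \<bar>y - x\<bar>"
      by (auto simp: has_derivative_at_alt bounded_linear_mult_right not_le)
    obtain n where n: "1 / real (Suc n) < e" using e(1) nat_approx_posE by blast
    have "x \<in> A (1 / real (Suc n))"
      unfolding A_def
    proof (intro CollectI conjI allI impI)
      show "x \<in> {a<..<b}" using x by simp
      fix \<delta> :: real assume "\<delta> > 0"
      then obtain y where y: "\<bar>y - x\<bar> < \<delta>" "\<bar>F y - F x - d x * (y - x)\<bar> > e * \<bar>y - x\<bar>" using e by blast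
      have "1 / real (Suc n) * \<bar>y - x\<bar> \<le> e * \<bar>y - x\<bar>" using n by (intro mult_right_mono) auto
      then show "\<exists>y. y \<noteq> x \<and> \<bar>y - x\<bar> < \<delta> \<and> \<bar>F y - F x - d x * (y - x)\<bar> > 1 / real (Suc n) * \<bar>y - x\<bar>"
        using y by (intro exI[of _ y]) auto
    qed
    then show "x \<in> (\<Union>n. A (1 / real (Suc n)))" by blast
  qed
  ultimately show ?thesis unfolding F_def by (rule negligible_subset)
qed

section \<open>Convolution and Laplace transform of nonnegative functions\<close>

text \<open>The integral runs over the whole line. Convolution on the half-line results from letting
  the factors vanish at negative arguments, which spares integration bounds in all the
  algebra.\<close>

definition conv :: "(real \<Rightarrow> ennreal) \<Rightarrow> (real \<Rightarrow> ennreal) \<Rightarrow> real \<Rightarrow> ennreal" where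
  "conv f g t = (\<integral>\<^sup>+ x. f x * g (t - x) \<partial>lborel)"

definition laplace :: "(real \<Rightarrow> ennreal) \<Rightarrow> real \<Rightarrow> ennreal" where
  "laplace f s = (\<integral>\<^sup>+ t. f t * ennreal (exp (- s * t)) \<partial>lborel)"

lemma nn_integral_reflect:
  fixes f :: "real \<Rightarrow> ennreal"
  assumes [measurable]: "f \<in> borel_measurable borel"
  shows "(\<integral>\<^sup>+ x. f (t - x) \<partial>lborel) = (\<integral>\<^sup>+ x. f x \<partial>lborel)"
  using nn_integral_real_affine[of f "-1" t] by simp

lemma nn_integral_shift:
  fixes f :: "real \<Rightarrow> ennreal"
  assumes [measurable]: "f \<in> borel_measurable borel"
  shows "(\<integral>\<^sup>+ x. f (x - t) \<partial>lborel) = (\<integral>\<^sup>+ x. f x \<partial>lborel)"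
  using nn_integral_real_affine[of f "1" "-t"] by (simp add: algebra_simps)

lemma conv_measurable [measurable]:
  assumes [measurable]: "f \<in> borel_measurable borel" "g \<in> borel_measurable borel"
  shows "conv f g \<in> borel_measurable borel"
  unfolding conv_def by measurable

lemma conv_commute:
  assumes [measurable]: "f \<in> borel_measurable borel" "g \<in> borel_measurable borel"
  shows "conv f g = conv g f"
proof
  fix t show "conv f g t = conv g f t"
    using nn_integral_reflect[of "\<lambda>x. f x * g (t - x)" t] by (simp add: conv_def mult.commute)
qed

lemma conv_assoc:
  assumes [measurable]: "f \<in> borel_measurable borel" "g \<in> borel_measurable borel"
    "h \<in> borel_measurable borel"
  shows "conv (conv f g) h = conv f (conv g h)"
proof
  fix t
  have "conv (conv f g) h t = (\<integral>\<^sup>+ x. \<integral>\<^sup>+ y. f y * g (x - y) * h (t - x) \<partial>lborel \<partial>lborel)"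
    unfolding conv_def by (simp add: nn_integral_multc)
  also have "\<dots> = (\<integral>\<^sup>+ y. \<integral>\<^sup>+ x. f y * g (x - y) * h (t - x) \<partial>lborel \<partial>lborel)"
    by (rule lborel_pair.Fubini') measurable
  also have "\<dots> = (\<integral>\<^sup>+ y. f y * (\<integral>\<^sup>+ x. g (x - y) * h (t - x) \<partial>lborel) \<partial>lborel)"
    by (simp add: nn_integral_cmult mult.assoc)
  also have "\<dots> = (\<integral>\<^sup>+ y. f y * (\<integral>\<^sup>+ x. g x * h (t - y - x) \<partial>lborel) \<partial>lborel)"
  proof (rule nn_integral_cong, rule arg_cong2[where f="(*)", OF refl])
    fix y
    show "(\<integral>\<^sup>+ x. g (x - y) * h (t - x) \<partial>lborel) = (\<integral>\<^sup>+ x. g x * h (t - y - x) \<partial>lborel)"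
      using nn_integral_shift[of "\<lambda>x. g x * h (t - y - x)" y] by (simp add: algebra_simps)
  qed
  finally show "conv (conv f g) h t = conv f (conv g h) t"
    by (simp add: conv_def)
qed

lemma conv_add_left:
  assumes [measurable]: "f \<in> borel_measurable borel" "g \<in> borel_measurable borel"
    "h \<in> borel_measurable borel"
  shows "conv (\<lambda>x. f x + g x) h t = conv f h t + conv g h t"
  by (simp add: conv_def distrib_right nn_integral_add)

lemma conv_add_right:
  assumes [measurable]: "f \<in> borel_measurable borel" "g \<in> borel_measurable borel"
    "h \<in> borel_measurable borel"
  shows "conv h (\<lambda>x. f x + g x) t = conv h f t + conv h g t"
  by (simp add: conv_def distrib_left nn_integral_add)

lemma conv_cmult_left:
  assumes [measurable]: "f \<in> borel_measurable borel" "g \<in> borel_measurable borel"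
  shows "conv (\<lambda>x. c * f x) g t = c * conv f g t"
  by (simp add: conv_def mult.assoc nn_integral_cmult)

lemma conv_cmult_right:
  assumes [measurable]: "f \<in> borel_measurable borel" "g \<in> borel_measurable borel"
  shows "conv f (\<lambda>x. c * g x) t = c * conv f g t"
  by (simp add: conv_def mult.left_commute nn_integral_cmult)

lemma conv_cong_AE_left:
  assumes "AE x in lborel. f x = g x"
  shows "conv f h t = conv g h t"
  unfolding conv_def by (rule nn_integral_cong_AE) (use assms in auto)

lemma AE_lborel_reflect:
  fixes t :: real
  assumes "AE x in lborel. P x"
  shows "AE x in lborel. P (t - x)"
proof -
  obtain N where N': "{x \<in> space lborel. \<not> P x} \<subseteq> N" "emeasure lborel N = 0" "N \<in> sets lborel"
    using assms by (rule AE_E)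
  then have N: "{x. \<not> P x} \<subseteq> N" "N \<in> null_sets lborel" by auto
  have [measurable]: "N \<in> sets borel" using N' by simp
  have "AE x in lborel. x \<notin> N" using N(2) by (rule AE_not_in)
  then have "AE x in lborel. t - x \<notin> N"
    using AE_borel_affine[of "-1" "\<lambda>x. x \<notin> N" t] by simp
  then show ?thesis by eventually_elim (use N in auto)
qed

lemma conv_cong_AE_right:
  assumes "AE x in lborel. f x = g x"
  shows "conv h f t = conv h g t"
  unfolding conv_def by (rule nn_integral_cong_AE) (use AE_lborel_reflect[OF assms, of t] in auto)

lemma conv_neg_eq_0:
  assumes "\<And>x. x < 0 \<Longrightarrow> f x = 0" "\<And>x. x < 0 \<Longrightarrow> g x = 0" "t < 0"
  shows "conv f g t = 0"
proof -
  have "f x * g (t - x) = 0" for x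
    using assms by (cases "x < 0") auto
  then have "conv f g t = (\<integral>\<^sup>+ x. 0 \<partial>(lborel :: real measure))"
    unfolding conv_def by (intro nn_integral_cong)
  then show ?thesis by simp
qed

lemma laplace_conv:
  assumes [measurable]: "f \<in> borel_measurable borel" "g \<in> borel_measurable borel"
  shows "laplace (conv f g) s = laplace f s * laplace g s"
proof -
  have ee: "ennreal (exp (- s * t)) = ennreal (exp (- s * x)) * ennreal (exp (- s * (t - x)))" for t x
    by (simp add: ennreal_mult[symmetric] exp_add[symmetric] algebra_simps)
  have "laplace (conv f g) s = (\<integral>\<^sup>+ t. \<integral>\<^sup>+ x. f x * g (t - x) * ennreal (exp (- s * t)) \<partial>lborel \<partial>lborel)"
    unfolding laplace_def conv_def by (simp add: nn_integral_multc)
  also have "\<dots> = (\<integral>\<^sup>+ x. \<integral>\<^sup>+ t. f x * g (t - x) * ennreal (exp (- s * t)) \<partial>lborel \<partial>lborel)"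
    by (rule lborel_pair.Fubini') measurable
  also have "\<dots> = (\<integral>\<^sup>+ x. \<integral>\<^sup>+ t. (f x * ennreal (exp (- s * x))) * (g (t - x) * ennreal (exp (- s * (t - x)))) \<partial>lborel \<partial>lborel)"
  proof (intro nn_integral_cong)
    fix x t
    show "f x * g (t - x) * ennreal (exp (- s * t)) =
      (f x * ennreal (exp (- s * x))) * (g (t - x) * ennreal (exp (- s * (t - x))))"
      unfolding ee[of t x] by (simp only: mult_ac)
  qed
  also have "\<dots> = (\<integral>\<^sup>+ x. (f x * ennreal (exp (- s * x))) * laplace g s \<partial>lborel)"
  proof (intro nn_integral_cong)
    fix x
    show "(\<integral>\<^sup>+ t. (f x * ennreal (exp (- s * x))) * (g (t - x) * ennreal (exp (- s * (t - x)))) \<partial>lborel)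
      = (f x * ennreal (exp (- s * x))) * laplace g s"
      using nn_integral_shift[of "\<lambda>t. g t * ennreal (exp (- s * t))" x]
      by (simp add: nn_integral_cmult laplace_def)
  qed
  also have "\<dots> = laplace f s * laplace g s"
    by (simp add: nn_integral_multc laplace_def)
  finally show ?thesis .
qed

lemma laplace_add:
  assumes [measurable]: "f \<in> borel_measurable borel" "g \<in> borel_measurable borel"
  shows "laplace (\<lambda>x. f x + g x) s = laplace f s + laplace g s"
  by (simp add: laplace_def distrib_right nn_integral_add)

lemma laplace_cmult:
  assumes [measurable]: "f \<in> borel_measurable borel"
  shows "laplace (\<lambda>x. c * f x) s = c * laplace f s"
  by (simp add: laplace_def mult.assoc nn_integral_cmult)

lemma laplace_sum:
  assumes [measurable]: "\<And>i. i \<in> I \<Longrightarrow> f i \<in> borel_measurable borel"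
  shows "laplace (\<lambda>x. \<Sum>i\<in>I. f i x) s = (\<Sum>i\<in>I. laplace (f i) s)"
  unfolding laplace_def sum_distrib_right
  by (rule nn_integral_sum) measurable

lemma laplace_cong_AE:
  assumes "AE x in lborel. f x = g x"
  shows "laplace f s = laplace g s"
  unfolding laplace_def by (rule nn_integral_cong_AE) (use assms in auto)

lemma laplace_indicator:
  assumes "s > 0"
  shows "laplace (indicator {0..}) s = ennreal (1 / s)"
proof -
  have "laplace (indicator {0..}) s = (\<integral>\<^sup>+ t. ennreal (exp (- s * t)) * indicator {0..} t \<partial>lborel)"
    by (simp add: laplace_def mult.commute)
  also have "\<dots> = (\<integral>\<^sup>+ t. ennreal (1 / s) * ennreal (exponential_density s t) \<partial>lborel)"
    using assms by (intro nn_integral_cong)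
      (auto simp: exponential_density_def ennreal_mult[symmetric] mult.commute split: split_indicator)
  also have "\<dots> = ennreal (1 / s) * emeasure (density lborel (exponential_density s)) UNIV"
    by (simp add: nn_integral_cmult emeasure_density)
  also have "emeasure (density lborel (exponential_density s)) UNIV = 1"
    using prob_space.emeasure_space_1[OF prob_space_exponential_density[OF assms]] by simp
  finally show ?thesis by simp
qed

text \<open>The values at s = 1, 2, 3, ... are the moments of a finite measure on [0,1], the image
  of f(t) exp(-t) dt under t \<mapsto> exp(-t). Such a measure is determined by its moments through
  polynomial approximation.\<close>

lemma laplace_unique_AE:
  assumes [measurable]: "f \<in> borel_measurable borel" "g \<in> borel_measurable borel"
    and supp: "\<And>x. x < 0 \<Longrightarrow> f x = 0" "\<And>x. x < 0 \<Longrightarrow> g x = 0"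
    and eq: "\<And>s. s > 0 \<Longrightarrow> laplace f s = laplace g s"
    and fin: "\<And>s. s > 0 \<Longrightarrow> laplace f s < \<infinity>"
  shows "AE t in lborel. f t = g t"
proof -
  define \<mu> where "\<mu> = (\<lambda>h. density lborel (\<lambda>t. h t * ennreal (exp (- t))))"
  have sets_\<mu> [simp, measurable_cong]: "sets (\<mu> h) = sets borel" for h by (simp add: \<mu>_def)
  have space_\<mu> [simp]: "space (\<mu> h) = UNIV" for h by (simp add: \<mu>_def)
  \<comment> \<open>Both functions satisfy this predicate, so every auxiliary fact is proved once
    and used twice; all transforms are expressed through that of \<open>f\<close>.\<close>
  define good where "good = (\<lambda>h. h \<in> borel_measurable borel \<and> (\<forall>x<0. h x = 0) \<and> (\<forall>s>0. laplace h s = laplace f s))"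
  have goods: "good f" "good g" using eq supp by (auto simp: good_def)
  have nn: "(\<integral>\<^sup>+ t. ennreal (exp (- t) ^ n) \<partial>\<mu> h) = laplace f (real n + 1)" if "good h" for h n
  proof -
    have [measurable]: "h \<in> borel_measurable borel" using that by (simp add: good_def)
    have "(\<integral>\<^sup>+ t. ennreal (exp (- t) ^ n) \<partial>\<mu> h) = (\<integral>\<^sup>+ t. h t * ennreal (exp (- t)) * ennreal (exp (- t) ^ n) \<partial>lborel)"
      unfolding \<mu>_def by (subst nn_integral_density) auto
    also have "\<dots> = laplace h (real n + 1)"
      unfolding laplace_def
    proof (rule nn_integral_cong)
      fix t :: real
      have "exp (- t) * exp (- t) ^ n = exp (- (real n + 1) * t)"
        by (simp add: exp_of_nat_mult[symmetric] exp_add[symmetric] algebra_simps)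
      then show "h t * ennreal (exp (- t)) * ennreal (exp (- t) ^ n) = h t * ennreal (exp (- (real n + 1) * t))"
        by (simp add: mult.assoc ennreal_mult[symmetric])
    qed
    finally show ?thesis using that by (simp add: good_def)
  qed
  have finm: "finite_measure (\<mu> h)" if "good h" for h
  proof
    show "emeasure (\<mu> h) (space (\<mu> h)) \<noteq> \<infinity>"
      using nn[OF that, of 0] fin[of 1] by simp
  qed
  have AE0: "AE t in \<mu> h. 0 \<le> t" if "good h" for h
  proof -
    have [measurable]: "h \<in> borel_measurable borel" using that by (simp add: good_def)
    show ?thesis unfolding \<mu>_def using that
      by (subst AE_density) (auto simp: good_def not_le[symmetric])
  qed
  have AE01: "AE t in \<mu> h. 0 \<le> exp (- t) \<and> exp (- t) \<le> 1" if "good h" for h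
    using AE0[OF that] by eventually_elim auto
  have int_pow: "integrable (\<mu> h) (\<lambda>t. exp (- t) ^ n)" if "good h" for h n
  proof -
    interpret finite_measure "\<mu> h" by (rule finm[OF that])
    show ?thesis
      by (rule integrable_const_bound[where B=1]) (use AE01[OF that] in \<open>auto simp: power_le_one\<close>)
  qed
  have pow: "(\<integral>t. exp (- t) ^ n \<partial>\<mu> h) = enn2real (laplace f (real n + 1))" if "good h" for h n
    by (subst integral_eq_nn_integral) (use nn[OF that] in auto)
  have int_cont: "integrable (\<mu> h) (\<lambda>t. \<phi> (exp (- t)))"
    if "good h" "continuous_on UNIV \<phi>" for h and \<phi> :: "real \<Rightarrow> real"
  proof -
    interpret finite_measure "\<mu> h" by (rule finm[OF that(1)])
    have [measurable]: "\<phi> \<in> borel_measurable borel" using that(2) by (rule borel_measurable_continuous_onI)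
    have "compact (\<phi> ` {0..1})"
      by (rule compact_continuous_image) (use that(2) continuous_on_subset in auto)
    then obtain B where "\<forall>x\<in>{0..1}. norm (\<phi> x) \<le> B"
      unfolding bounded_iff[of "\<phi> ` {0..1}"] using compact_imp_bounded bounded_iff by (metis imageI)
    then show ?thesis
      by (intro integrable_const_bound[where B=B]) (use AE01[OF that(1)] in auto)
  qed
  have cont_eq: "(\<integral>t. \<phi> (exp (- t)) \<partial>\<mu> f) = (\<integral>t. \<phi> (exp (- t)) \<partial>\<mu> g)"
    if \<phi>: "continuous_on UNIV \<phi>" for \<phi> :: "real \<Rightarrow> real"
  proof -
    define m where "m = measure (\<mu> f) UNIV + measure (\<mu> g) UNIV"
    have "\<bar>(\<integral>t. \<phi> (exp (- t)) \<partial>\<mu> f) - (\<integral>t. \<phi> (exp (- t)) \<partial>\<mu> g)\<bar> \<le> 0 + e" if "e > 0" for e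
    proof -
      \<comment> \<open>The approximation error costs at most \<open>e'\<close> times the total mass
        \<open>m\<close> of both measures; adding 1 avoids a division by zero.\<close>
      define e' where "e' = e / (m + 1)"
      have m0: "m \<ge> 0" by (simp add: m_def)
      then have e': "e' > 0" using \<open>e > 0\<close> by (simp add: e'_def)
      obtain p where p: "real_polynomial_function p" "\<And>x. x \<in> {0..1} \<Longrightarrow> \<bar>\<phi> x - p x\<bar> < e'"
        using Stone_Weierstrass_real_polynomial_function[of "{0..1::real}" \<phi> e'] \<phi> e'
          continuous_on_subset by (metis compact_Icc subset_UNIV)
      obtain a n where a: "p = (\<lambda>x. \<Sum>i\<le>n. a i * x ^ i)"
        using p(1) real_polynomial_function_iff_sum by blast
      have intp: "integrable (\<mu> h) (\<lambda>t. p (exp (- t)))" if "good h" for h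
        unfolding a using int_pow[OF that] by auto
      have peq: "(\<integral>t. p (exp (- t)) \<partial>\<mu> h) = (\<Sum>i\<le>n. a i * enn2real (laplace f (real i + 1)))" if "good h" for h
        unfolding a using int_pow[OF that] by (subst Bochner_Integration.integral_sum) (auto simp: pow[OF that])
      have diff: "\<bar>(\<integral>t. \<phi> (exp (- t)) \<partial>\<mu> h) - (\<integral>t. p (exp (- t)) \<partial>\<mu> h)\<bar> \<le> e' * measure (\<mu> h) UNIV" if h: "good h" for h
      proof -
        interpret finite_measure "\<mu> h" by (rule finm[OF h])
        have "\<bar>(\<integral>t. \<phi> (exp (- t)) \<partial>\<mu> h) - (\<integral>t. p (exp (- t)) \<partial>\<mu> h)\<bar> = \<bar>\<integral>t. \<phi> (exp (- t)) - p (exp (- t)) \<partial>\<mu> h\<bar>"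
          by (subst Bochner_Integration.integral_diff) (use int_cont[OF h \<phi>] intp[OF h] in auto)
        also have "\<dots> \<le> (\<integral>t. \<bar>\<phi> (exp (- t)) - p (exp (- t))\<bar> \<partial>\<mu> h)"
          by (rule integral_abs_bound)
        also have "\<dots> \<le> (\<integral>t. e' \<partial>\<mu> h)"
        proof (rule integral_mono_AE)
          show "integrable (\<mu> h) (\<lambda>t. \<bar>\<phi> (exp (- t)) - p (exp (- t))\<bar>)"
            using int_cont[OF h \<phi>] intp[OF h] by auto
          show "AE t in \<mu> h. \<bar>\<phi> (exp (- t)) - p (exp (- t))\<bar> \<le> e'"
            using AE01[OF h] by eventually_elim (rule less_imp_le, rule p(2), simp)
        qed auto
        finally show ?thesis by (simp add: mult.commute)
      qed
      have "\<bar>(\<integral>t. \<phi> (exp (- t)) \<partial>\<mu> f) - (\<integral>t. \<phi> (exp (- t)) \<partial>\<mu> g)\<bar> \<le> e' * m"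
        using diff[OF goods(1)] diff[OF goods(2)] peq[OF goods(1)] peq[OF goods(2)]
        unfolding m_def distrib_left by linarith
      also have "\<dots> \<le> e' * (m + 1)" using e' by simp
      also have "\<dots> = e" using m0 by (simp add: e'_def)
      finally show ?thesis by simp
    qed
    then have "\<bar>(\<integral>t. \<phi> (exp (- t)) \<partial>\<mu> f) - (\<integral>t. \<phi> (exp (- t)) \<partial>\<mu> g)\<bar> \<le> 0"
      by (rule field_le_epsilon)
    then show ?thesis by simp
  qed
  have "\<mu> f = \<mu> g"
  proof (rule measure_eqI_lessThan)
    fix c :: real
    \<comment> \<open>Continuous ramps in y = exp(-t) that increase to the indicator of y < exp(-c),
      that is, of t > c.\<close>
    define \<phi> where "\<phi> = (\<lambda>m::nat. \<lambda>y. max 0 (min 1 (real m * (exp (- c) - y))))"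
    have \<phi>c: "continuous_on UNIV (\<phi> m)" for m unfolding \<phi>_def by (intro continuous_intros)
    have lim: "(\<lambda>m. \<integral>t. \<phi> m (exp (- t)) \<partial>\<mu> h) \<longlonglongrightarrow> measure (\<mu> h) {c<..}" if h: "good h" for h
    proof -
      interpret finite_measure "\<mu> h" by (rule finm[OF h])
      have "(\<lambda>m. \<integral>t. \<phi> m (exp (- t)) \<partial>\<mu> h) \<longlonglongrightarrow> (\<integral>t. indicator {c<..} t \<partial>\<mu> h)"
      proof (rule integral_dominated_convergence[where w="\<lambda>_. 1"])
        show "(\<lambda>t. \<phi> m (exp (- t))) \<in> borel_measurable (\<mu> h)" for m
          unfolding \<phi>_def by measurable
        show "AE t in \<mu> h. (\<lambda>m. \<phi> m (exp (- t))) \<longlonglongrightarrow> indicator {c<..} t"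
        proof (intro AE_I2)
          fix t :: real
          show "(\<lambda>m. \<phi> m (exp (- t))) \<longlonglongrightarrow> indicator {c<..} t"
          proof (cases "c < t")
            case True
            then have pos: "exp (- c) - exp (- t) > 0" by simp
            obtain m0 :: nat where m0: "1 / (exp (- c) - exp (- t)) \<le> real m0" using real_arch_simple by blast
            have "\<phi> m (exp (- t)) = 1" if "m \<ge> m0" for m
            proof -
              have "1 \<le> real m0 * (exp (- c) - exp (- t))" using m0 pos by (simp add: field_simps)
              also have "\<dots> \<le> real m * (exp (- c) - exp (- t))" using pos that by (intro mult_right_mono) auto
              finally show ?thesis by (simp add: \<phi>_def)
            qed
            then have "eventually (\<lambda>m. \<phi> m (exp (- t)) = 1) sequentially"
              unfolding eventually_sequentially by blast
            then show ?thesis using True by (simp add: tendsto_eventually)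
          next
            case False
            then have "real m * (exp (- c) - exp (- t)) \<le> 0" for m by (intro mult_nonneg_nonpos) auto
            then have "\<phi> m (exp (- t)) = 0" for m
              unfolding \<phi>_def by (intro max_absorb1) (simp add: min_le_iff_disj)
            then show ?thesis using False by simp
          qed
        qed
        show "AE t in \<mu> h. norm (\<phi> m (exp (- t))) \<le> 1" for m by (auto simp: \<phi>_def)
      qed auto
      then show ?thesis by simp
    qed
    have "measure (\<mu> f) {c<..} = measure (\<mu> g) {c<..}"
      using lim[OF goods(1)] lim[OF goods(2)] unfolding cont_eq[OF \<phi>c] by (rule LIMSEQ_unique)
    then show "emeasure (\<mu> f) {c<..} = emeasure (\<mu> g) {c<..}"
      using finm[OF goods(1)] finm[OF goods(2)] by (simp add: finite_measure.emeasure_eq_measure)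
    show "emeasure (\<mu> f) {c<..} < \<infinity>"
      using finm[OF goods(1)] by (simp add: finite_measure.emeasure_eq_measure)
  qed auto
  then have "AE t in lborel. f t * ennreal (exp (- t)) = g t * ennreal (exp (- t))"
    unfolding \<mu>_def by (subst (asm) sigma_finite_measure.density_unique_iff[OF lborel.sigma_finite_measure_axioms]) auto
  then show ?thesis
  proof eventually_elim
    fix t assume "f t * ennreal (exp (- t)) = g t * ennreal (exp (- t))"
    moreover have "f t * ennreal (exp (- t)) * ennreal (exp t) = f t" for f :: "real \<Rightarrow> ennreal"
      by (simp add: mult.assoc ennreal_mult[symmetric] exp_add[symmetric])
    ultimately show "f t = g t" by metis
  qed
qed

section \<open>Densities of absolutely continuous monotone functions\<close>

lemma abs_continuous_on_IccE:
  assumes "abs_continuous_on_Icc u a c" "e > 0"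
  obtains \<delta> where "\<delta> > 0" "\<And>(m::nat) X Y. \<forall>i<m. a \<le> X i \<and> X i \<le> Y i \<and> Y i \<le> c \<Longrightarrow>
        disjoint_family_on (\<lambda>i. {X i<..<Y i}) {..<m} \<Longrightarrow>
        (\<Sum>i<m. Y i - X i) < \<delta> \<Longrightarrow> (\<Sum>i<m. \<bar>u (Y i) - u (X i)\<bar>) < e"
  using assms unfolding abs_continuous_on_Icc_def by meson

lemma abs_continuous_on_Icc_imp_continuous_on:
  assumes "abs_continuous_on_Icc u a c"
  shows "continuous_on {a..c} u"
  unfolding continuous_on_iff
proof (intro ballI allI impI)
  fix x e :: real assume x: "x \<in> {a..c}" and e: "0 < e"
  obtain \<delta> where \<delta>: "\<delta> > 0" and ac: "\<And>(m::nat) X Y. \<forall>i<m. a \<le> X i \<and> X i \<le> Y i \<and> Y i \<le> c \<Longrightarrow>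
        disjoint_family_on (\<lambda>i. {X i<..<Y i}) {..<m} \<Longrightarrow>
        (\<Sum>i<m. Y i - X i) < \<delta> \<Longrightarrow> (\<Sum>i<m. \<bar>u (Y i) - u (X i)\<bar>) < e"
    by (rule abs_continuous_on_IccE[OF assms e]) (rule that)
  show "\<exists>d>0. \<forall>x'\<in>{a..c}. dist x' x < d \<longrightarrow> dist (u x') (u x) < e"
  proof (intro exI conjI ballI impI)
    show "\<delta> > 0" by fact
    fix y assume y: "y \<in> {a..c}" "dist y x < \<delta>"
    have "(\<Sum>i<1::nat. \<bar>u (max x y) - u (min x y)\<bar>) < e"
      by (rule ac) (use x y in \<open>auto simp: dist_real_def min_def max_def disjoint_family_on_def\<close>)
    then show "dist (u y) (u x) < e"
      by (auto simp: dist_real_def min_def max_def split: if_splits)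
  qed
qed

lemma abs_continuous_halfline_imp_continuous_on:
  assumes "abs_continuous_halfline u"
  shows "continuous_on {0..} u"
proof -
  have "isCont (\<lambda>x. u (max 0 x)) x" for x
  proof -
    define T where "T = max 1 (x + 1)"
    have "continuous_on {0..T} u"
      using assms abs_continuous_on_Icc_imp_continuous_on[of u 0 T]
      unfolding abs_continuous_halfline_def T_def by auto
    then have "continuous_on {..<T} (\<lambda>x. u (max 0 x))"
      by (rule continuous_on_compose2) (auto intro!: continuous_intros simp: T_def)
    then show ?thesis
      by (simp add: continuous_on_eq_continuous_at T_def)
  qed
  then have "continuous_on {0..} (\<lambda>x. u (max 0 x))"
    by (simp add: continuous_at_imp_continuous_on)
  then show ?thesis by (rule continuous_on_eq) auto
qed

text \<open>The density is the Radon-Nikodym derivative of the Stieltjes measure of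
  \<open>u\<close>. Absolute continuity of \<open>u\<close> concerns finite families of intervals,
  so a null set has to be caught by finite unions of dyadic cells before the measure of it can be
  estimated.\<close>

lemma abs_continuous_mono_density:
  assumes ac: "abs_continuous_halfline u" and mono: "\<And>x y. 0 \<le> x \<Longrightarrow> x \<le> y \<Longrightarrow> u x \<le> u y"
  obtains v :: "real \<Rightarrow> ennreal" where "v \<in> borel_measurable borel" "\<And>t. t \<le> 0 \<Longrightarrow> v t = 0"
    "\<And>t. 0 \<le> t \<Longrightarrow> conv v (indicator {0..}) t = ennreal (u t - u 0)"
proof -
  \<comment> \<open>Constant to the left of 0, so that the Stieltjes measure has no mass there;
    continuity of \<open>u\<close> at 0 excludes an atom at 0.\<close>
  define F where "F = (\<lambda>x. u (max 0 x))"
  have monoF: "F x \<le> F y" if "x \<le> y" for x y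
    unfolding F_def by (rule mono) (use that in auto)
  have "continuous_on UNIV F"
    unfolding F_def
    by (rule continuous_on_compose2[OF abs_continuous_halfline_imp_continuous_on[OF ac]])
      (auto intro!: continuous_intros)
  then have contF: "continuous (at_right x) F" for x
    by (simp add: continuous_on_eq_continuous_within continuous_at_imp_continuous_within)
  define \<mu> where "\<mu> = interval_measure F"
  have sets_\<mu> [simp, measurable_cong]: "sets \<mu> = sets borel" by (simp add: \<mu>_def)
  have Ioc: "emeasure \<mu> {x<..y} = ennreal (F y - F x)" if "x \<le> y" for x y
    unfolding \<mu>_def by (rule emeasure_interval_measure_Ioc[OF that monoF contF])
  have null_neg: "emeasure \<mu> {..0} = 0"
  proof -
    have "{- real n<..0} \<in> null_sets \<mu>" for n
      by (rule null_setsI) (simp_all add: Ioc F_def)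
    then have "(\<Union>n. {- real n<..0}) \<in> null_sets \<mu>" by (rule null_sets_UN)
    moreover have "(\<Union>n. {- real n<..0}) = {..0}"
    proof (intro set_eqI iffI)
      fix x :: real assume "x \<in> {..0}"
      moreover obtain n :: nat where "- x < real n" using reals_Archimedean2 by blast
      ultimately show "x \<in> (\<Union>n. {- real n<..0})" by (auto intro!: exI[of _ n])
    qed auto
    ultimately show ?thesis by auto
  qed
  have small: "emeasure \<mu> (A \<inter> {0<..real T}) \<le> ennreal e"
    if A: "A \<in> null_sets lborel" and e: "e > 0" for A T e
  proof (cases "T = 0")
    case False
    have [measurable]: "A \<in> sets borel" using A by auto
    have acT: "abs_continuous_on_Icc u 0 (real T)"
      using ac False by (simp add: abs_continuous_halfline_def)
    obtain \<delta> where \<delta>: "\<delta> > 0" and acd: "\<And>(m::nat) X Y. \<forall>i<m. 0 \<le> X i \<and> X i \<le> Y i \<and> Y i \<le> real T \<Longrightarrow>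
        disjoint_family_on (\<lambda>i. {X i<..<Y i}) {..<m} \<Longrightarrow>
        (\<Sum>i<m. Y i - X i) < \<delta> \<Longrightarrow> (\<Sum>i<m. \<bar>u (Y i) - u (X i)\<bar>) < e"
      by (rule abs_continuous_on_IccE[OF acT e]) (rule that)
    obtain U where U: "open U" "A \<subseteq> U" "emeasure lborel (U - A) < ennreal \<delta>"
      using outer_regular_lborel[of A \<delta>] \<delta> by auto
    have "emeasure lborel U \<le> emeasure lborel (U - A) + emeasure lborel A"
      using emeasure_subadditive[of "U - A" lborel A] U(1,2) by (simp add: Un_absorb2)
    then have U\<delta>: "emeasure lborel U < ennreal \<delta>" using U(3) A by (simp add: null_setsD1)
    \<comment> \<open>Dyadic cells of generation m; \<open>I m\<close> selects the cells up to T
      whose closure lies in the open superset U, and \<open>Om m\<close> is their union.\<close>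
    define cl where "cl = (\<lambda>(m::nat) (k::nat). real k / 2 ^ m)"
    define I where "I = (\<lambda>m. {k. k < T * 2 ^ m \<and> {cl m k .. cl m (Suc k)} \<subseteq> U})"
    define Om where "Om = (\<lambda>m. \<Union>k\<in>I m. {cl m k <.. cl m (Suc k)})"
    have clle: "cl m k \<le> cl m (Suc k)" for m k by (simp add: cl_def divide_right_mono)
    have clmono: "cl m j \<le> cl m k" if "j \<le> k" for m j k using that by (simp add: cl_def divide_right_mono)
    have finI: "finite (I m)" for m by (simp add: I_def)
    have disj: "disjoint_family_on (\<lambda>k. {cl m k <.. cl m (Suc k)}) S" for m S
      unfolding disjoint_family_on_def
    proof (intro ballI impI)
      fix j k :: nat assume "j \<noteq> k"
      then have "Suc j \<le> k \<or> Suc k \<le> j" by auto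
      then have "cl m (Suc j) \<le> cl m k \<or> cl m (Suc k) \<le> cl m j" using clmono by blast
      then show "{cl m j <.. cl m (Suc j)} \<inter> {cl m k <.. cl m (Suc k)} = {}" by auto
    qed
    have OmB: "emeasure \<mu> (Om m) \<le> ennreal e" for m
    proof -
      \<comment> \<open>Cells that are not selected are collapsed to a point. They contribute
        nothing, and the family is indexed by an initial segment as the definition of absolute
        continuity demands.\<close>
      define Y where "Y = (\<lambda>k. if k \<in> I m then cl m (Suc k) else cl m k)"
      have sumI: "(\<Sum>k<T * 2 ^ m. h (cl m k) (Y k)) = (\<Sum>k\<in>I m. h (cl m k) (cl m (Suc k)))"
        if "\<And>x. h x x = 0" for h :: "real \<Rightarrow> real \<Rightarrow> real"
        by (rule sum.mono_neutral_cong_right) (auto simp: I_def Y_def that)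
      have "ennreal (\<Sum>k\<in>I m. cl m (Suc k) - cl m k) = (\<Sum>k\<in>I m. emeasure lborel {cl m k <.. cl m (Suc k)})"
        using clle by simp
      also have "\<dots> = emeasure lborel (Om m)"
        unfolding Om_def by (rule sum_emeasure) (use finI disj in auto)
      also have "\<dots> \<le> emeasure lborel U"
        by (rule emeasure_mono) (use U in \<open>auto simp: Om_def I_def intro: borel_open\<close>)
      also note U\<delta>
      finally have len: "(\<Sum>k\<in>I m. cl m (Suc k) - cl m k) < \<delta>"
        using \<delta> by (simp add: ennreal_less_iff sum_nonneg clle)
      have "(\<Sum>k<T * 2 ^ m. \<bar>u (Y k) - u (cl m k)\<bar>) < e"
      proof (rule acd)
        show "\<forall>k<T * 2 ^ m. 0 \<le> cl m k \<and> cl m k \<le> Y k \<and> Y k \<le> real T"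
        proof (intro allI impI)
          fix k assume k: "k < T * 2 ^ m"
          then have "real (Suc k) \<le> real (T * 2 ^ m)" by (intro of_nat_mono) simp
          then have "cl m (Suc k) \<le> real T" by (simp add: cl_def field_simps)
          then show "0 \<le> cl m k \<and> cl m k \<le> Y k \<and> Y k \<le> real T"
            using clle[of m k] by (auto simp: Y_def cl_def)
        qed
        show "disjoint_family_on (\<lambda>k. {cl m k<..<Y k}) {..<T * 2 ^ m}"
          unfolding disjoint_family_on_def
        proof (intro ballI impI)
          fix j k :: nat assume "j \<noteq> k"
          then have "{cl m j<..cl m (Suc j)} \<inter> {cl m k<..cl m (Suc k)} = {}"
            using disj[of m UNIV] unfolding disjoint_family_on_def by blast
          moreover have "{cl m i<..<Y i} \<subseteq> {cl m i<..cl m (Suc i)}" for i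
            by (auto simp: Y_def)
          ultimately show "{cl m j<..<Y j} \<inter> {cl m k<..<Y k} = {}" by blast
        qed
        show "(\<Sum>k<T * 2 ^ m. Y k - cl m k) < \<delta>"
          using sumI[of "\<lambda>x y. y - x"] len by simp
      qed
      then have "(\<Sum>k\<in>I m. \<bar>u (cl m (Suc k)) - u (cl m k)\<bar>) < e"
        using sumI[of "\<lambda>x y. \<bar>u y - u x\<bar>"] by simp
      moreover have "emeasure \<mu> (Om m) = (\<Sum>k\<in>I m. emeasure \<mu> {cl m k <.. cl m (Suc k)})"
        unfolding Om_def by (rule sum_emeasure[symmetric]) (use finI disj in auto)
      moreover have "(\<Sum>k\<in>I m. emeasure \<mu> {cl m k <.. cl m (Suc k)}) = ennreal (\<Sum>k\<in>I m. \<bar>u (cl m (Suc k)) - u (cl m k)\<bar>)"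
      proof -
        have "emeasure \<mu> {cl m k <.. cl m (Suc k)} = ennreal \<bar>u (cl m (Suc k)) - u (cl m k)\<bar>" for k
          unfolding Ioc[OF clle] using mono[of "cl m k" "cl m (Suc k)"] clle[of m k]
          by (simp add: F_def cl_def)
        then show ?thesis by simp
      qed
      ultimately show ?thesis by (simp add: ennreal_leI)
    qed
    \<comment> \<open>The lower limit of the sets \<open>Om m\<close>: a point of U lies in
      \<open>Om m\<close> for all large m, since small cells around it stay inside U. The sets
      \<open>G n\<close> increase, so the bound e survives in the limit.\<close>
    define G where "G = (\<lambda>n. \<Inter>m\<in>{n..}. Om m)"
    have [measurable]: "Om m \<in> sets borel" for m unfolding Om_def using finI by auto
    have Gs [measurable]: "G n \<in> sets borel" for n unfolding G_def by auto
    have "A \<inter> {0<..real T} \<subseteq> (\<Union>n. G n)"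
    proof
      fix x assume x: "x \<in> A \<inter> {0<..real T}"
      then obtain r where r: "r > 0" "ball x r \<subseteq> U" using U(1,2) by (meson IntD1 open_contains_ball subsetD)
      obtain n where n: "(1/2::real) ^ n < r" using real_arch_pow_inv[OF r(1), of "1/2"] by auto
      have "x \<in> Om m" if "m \<ge> n" for m
      proof -
        have pm: "(1::real) / 2 ^ m < r"
        proof -
          have "(1/2::real) ^ m \<le> (1/2) ^ n" using that by (intro power_decreasing) auto
          then show ?thesis using n by (simp add: power_one_over)
        qed
        \<comment> \<open>Ceiling minus one, because the cells are open on the left and closed on
          the right.\<close>
        define k where "k = nat (\<lceil>x * 2 ^ m\<rceil> - 1)"
        have c1: "\<lceil>x * 2 ^ m\<rceil> \<ge> 1" using x by simp
        have kk: "real k < x * 2 ^ m" "x * 2 ^ m \<le> real (Suc k)"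
          using c1 unfolding k_def by linarith+
        have "k < T * 2 ^ m"
        proof -
          have "x * 2 ^ m \<le> real T * 2 ^ m" using x by (intro mult_right_mono) auto
          then have "real k < real T * 2 ^ m" using kk by linarith
          then have "real k < real (T * 2 ^ m)" by simp
          then show ?thesis by (simp only: of_nat_less_iff)
        qed
        moreover have xin: "cl m k < x" "x \<le> cl m (Suc k)" using kk by (auto simp: cl_def field_simps)
        moreover have "{cl m k .. cl m (Suc k)} \<subseteq> ball x r"
        proof
          fix y assume y: "y \<in> {cl m k .. cl m (Suc k)}"
          have "cl m (Suc k) - cl m k = 1 / 2 ^ m" by (simp add: cl_def diff_divide_distrib[symmetric])
          then show "y \<in> ball x r" using xin y pm by (auto simp: dist_real_def)
        qed
        ultimately show ?thesis using r(2) by (auto simp: Om_def I_def)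
      qed
      then show "x \<in> (\<Union>n. G n)" by (auto simp: G_def)
    qed
    then have "emeasure \<mu> (A \<inter> {0<..real T}) \<le> emeasure \<mu> (\<Union>n. G n)"
      by (rule emeasure_mono) simp
    also have "\<dots> = (SUP n. emeasure \<mu> (G n))"
      by (rule SUP_emeasure_incseq[symmetric]) (auto simp: incseq_def G_def)
    also have "\<dots> \<le> ennreal e"
    proof (rule SUP_least)
      fix n
      have "emeasure \<mu> (G n) \<le> emeasure \<mu> (Om n)" by (rule emeasure_mono) (auto simp: G_def)
      also note OmB[of n]
      finally show "emeasure \<mu> (G n) \<le> ennreal e" .
    qed
    finally show ?thesis .
  qed simp
  have "absolutely_continuous lborel \<mu>"
    unfolding absolutely_continuous_def
  proof
    fix A assume A: "A \<in> null_sets (lborel :: real measure)"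
    have [measurable]: "A \<in> sets borel" using A by auto
    have n1: "A \<inter> {0<..real T} \<in> null_sets \<mu>" for T
    proof (rule null_setsI)
      have "emeasure \<mu> (A \<inter> {0<..real T}) \<le> 0"
        by (rule ennreal_le_epsilon) (use small[OF A] in auto)
      then show "emeasure \<mu> (A \<inter> {0<..real T}) = 0" by simp
    qed simp
    have "{..0} \<in> null_sets \<mu>" using null_neg by (intro null_setsI) auto
    then have "{..0} \<union> (\<Union>T. A \<inter> {0<..real T}) \<in> null_sets \<mu>"
      by (rule null_sets.Un) (rule null_sets_UN, rule n1)
    moreover have "A \<subseteq> {..0} \<union> (\<Union>T. A \<inter> {0<..real T})"
      using real_arch_simple by (auto simp: not_le)
    ultimately show "A \<in> null_sets \<mu>"
      using null_sets_subset[of _ \<mu> A] by simp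
  qed
  then obtain f where f [measurable]: "f \<in> borel_measurable borel" and fd: "density lborel f = \<mu>"
    using sigma_finite_measure.Radon_Nikodym[OF lborel.sigma_finite_measure_axioms, of \<mu>] by auto
  show thesis
  proof
    show "(\<lambda>t. f t * indicator {0<..} t) \<in> borel_measurable borel" by simp
    fix t :: real
    show "f t * indicator {0<..} t = 0" if "t \<le> 0" using that by simp
    assume t: "0 \<le> t"
    have "conv (\<lambda>t. f t * indicator {0<..} t) (indicator {0..}) t = (\<integral>\<^sup>+ x. f x * indicator {0<..t} x \<partial>lborel)"
      unfolding conv_def by (intro nn_integral_cong) (auto split: split_indicator)
    also have "\<dots> = emeasure \<mu> {0<..t}"
      unfolding fd[symmetric] by (simp add: emeasure_density)
    also have "\<dots> = ennreal (u t - u 0)" using t by (simp add: Ioc F_def)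
    finally show "conv (\<lambda>t. f t * indicator {0<..} t) (indicator {0..}) t = ennreal (u t - u 0)" .
  qed
qed

section \<open>Levy tails and Bernstein functions\<close>

text \<open>The value 0 for t \<le> 0 turns the tail into a kernel on the half-line and removes the
  infinite value at t = 0.\<close>

definition levy_tail' :: "real measure \<Rightarrow> real \<Rightarrow> ennreal" where
  "levy_tail' \<nu> t = (if 0 < t then emeasure \<nu> {t<..} else 0)"

text \<open>Markov's inequality for the weight min x 1.\<close>

lemma levy_measure_tail_finite:
  assumes "levy_measure \<nu>" "0 < t"
  shows "emeasure \<nu> {t<..} < \<infinity>"
proof -
  have [measurable_cong]: "sets \<nu> = sets borel" using assms by (simp add: levy_measure_def)
  have "ennreal (min t 1) * emeasure \<nu> {t<..} = (\<integral>\<^sup>+ x. ennreal (min t 1) * indicator {t<..} x \<partial>\<nu>)"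
    by (subst nn_integral_cmult_indicator) auto
  also have "\<dots> \<le> (\<integral>\<^sup>+ x\<in>{0<..}. ennreal (min x 1) \<partial>\<nu>)"
    using assms by (intro nn_integral_mono) (auto split: split_indicator intro!: ennreal_leI)
  also have "\<dots> < \<infinity>" using assms by (simp add: levy_measure_def)
  finally have "ennreal (min t 1) * emeasure \<nu> {t<..} < \<infinity>" .
  moreover have "ennreal (min t 1) \<noteq> 0" using assms(2) by simp
  ultimately show ?thesis by (auto simp: ennreal_mult_less_top)
qed

lemma levy_measure_sigma_finite:
  assumes "levy_measure \<nu>"
  shows "sigma_finite_measure \<nu>"
proof
  have [simp]: "sets \<nu> = sets borel" using assms by (simp add: levy_measure_def)
  then have sp: "space \<nu> = UNIV" using sets_eq_imp_space_eq[of \<nu> borel] by simp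
  show "\<exists>A. countable A \<and> A \<subseteq> sets \<nu> \<and> \<Union> A = space \<nu> \<and> (\<forall>a\<in>A. emeasure \<nu> a \<noteq> \<infinity>)"
  proof (intro exI conjI)
    let ?A = "insert {..0} (range (\<lambda>n. {1 / real (Suc n)<..}))"
    show "countable ?A" "?A \<subseteq> sets \<nu>" by auto
    show "\<Union> ?A = space \<nu>"
    proof -
      have "x \<in> \<Union> ?A" for x :: real
      proof (cases "x \<le> 0")
        case False
        then obtain n where "1 / real (Suc n) < x" using nat_approx_posE[of x] by auto
        then show ?thesis by auto
      qed auto
      then show ?thesis using sp by blast
    qed
    have "emeasure \<nu> {1 / real (Suc n)<..} < \<infinity>" for n
      by (rule levy_measure_tail_finite[OF assms]) simp
    then show "\<forall>a\<in>?A. emeasure \<nu> a \<noteq> \<infinity>"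
      using assms by (auto simp: levy_measure_def less_top)
  qed
qed

lemma levy_tail'_eq_levy_tail:
  assumes "levy_measure \<nu>" "0 < t"
  shows "levy_tail' \<nu> t = ennreal (levy_tail \<nu> t)"
  unfolding levy_tail'_def levy_tail_def
  by (subst emeasure_eq_ennreal_measure) (use levy_measure_tail_finite[OF assms] assms(2) in auto)

lemma levy_tail'_measurable [measurable]:
  assumes "levy_measure \<nu>"
  shows "levy_tail' \<nu> \<in> borel_measurable borel"
proof -
  have sets [measurable_cong]: "sets \<nu> = sets borel" using assms by (simp add: levy_measure_def)
  interpret \<nu>: sigma_finite_measure \<nu> by (rule levy_measure_sigma_finite[OF assms])
  have "levy_tail' \<nu> = (\<lambda>t. \<integral>\<^sup>+ z. (if 0 < t \<and> t < z then 1 else 0) \<partial>\<nu>)"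
  proof
    fix t
    have "(\<integral>\<^sup>+ z. (if 0 < t \<and> t < z then 1 else 0) \<partial>\<nu>) = (\<integral>\<^sup>+ z. (if 0 < t then 1 else 0) * indicator {t<..} z \<partial>\<nu>)"
      by (intro nn_integral_cong) (auto split: split_indicator)
    then show "levy_tail' \<nu> t = (\<integral>\<^sup>+ z. (if 0 < t \<and> t < z then 1 else 0) \<partial>\<nu>)"
      by (simp add: levy_tail'_def sets)
  qed
  then show ?thesis by simp
qed

lemma levy_tail'_antimono:
  assumes "levy_measure \<nu>" "0 < x" "x \<le> y"
  shows "levy_tail' \<nu> y \<le> levy_tail' \<nu> x"
proof -
  have "emeasure \<nu> {y<..} \<le> emeasure \<nu> {x<..}"
    using assms by (intro emeasure_mono) (auto simp: levy_measure_def)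
  then show ?thesis using assms by (simp add: levy_tail'_def)
qed

lemma bernstein_fun_nonneg:
  assumes "b \<ge> 0" "levy_measure \<nu>" "s > 0"
  shows "0 \<le> bernstein_fun b \<nu> s"
  unfolding bernstein_fun_def set_lebesgue_integral_def using assms
  by (intro add_nonneg_nonneg Bochner_Integration.integral_nonneg) (auto split: split_indicator)

lemma bernstein_fun_eq_nn_integral:
  assumes "b \<ge> 0" "levy_measure \<nu>" "s > 0"
  shows "ennreal (bernstein_fun b \<nu> s) = ennreal (b * s) + (\<integral>\<^sup>+ x\<in>{0<..}. ennreal (1 - exp (- s * x)) \<partial>\<nu>)"
    "(\<integral>\<^sup>+ x\<in>{0<..}. ennreal (1 - exp (- s * x)) \<partial>\<nu>) < \<infinity>"
proof -
  have sets [measurable_cong]: "sets \<nu> = sets borel" using assms by (simp add: levy_measure_def)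
  have "(\<integral>\<^sup>+ x\<in>{0<..}. ennreal (1 - exp (- s * x)) \<partial>\<nu>) \<le> (\<integral>\<^sup>+ x. ennreal (max s 1) * (ennreal (min x 1) * indicator {0<..} x) \<partial>\<nu>)"
  proof (rule nn_integral_mono)
    fix x
    have "1 - exp (- s * x) \<le> max s 1 * min x 1" if "x > 0"
    proof (cases "x \<le> 1")
      case True
      have "1 - exp (- s * x) \<le> s * x" using exp_ge_add_one_self[of "- s * x"] by simp
      also have "\<dots> \<le> max s 1 * x" using that by (intro mult_right_mono) auto
      finally show ?thesis using True by (simp add: min_def)
    next
      case False
      have "1 - exp (- s * x) \<le> 1" by simp
      then show ?thesis using False by (simp add: min_def le_max_iff_disj)
    qed
    then show "ennreal (1 - exp (- s * x)) * indicator {0<..} x \<le> ennreal (max s 1) * (ennreal (min x 1) * indicator {0<..} x)"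
      using assms by (auto split: split_indicator simp: ennreal_mult[symmetric] intro!: ennreal_leI)
  qed
  also have "\<dots> < \<infinity>"
    using assms by (subst nn_integral_cmult) (auto simp: levy_measure_def ennreal_mult_less_top)
  finally show fin: "(\<integral>\<^sup>+ x\<in>{0<..}. ennreal (1 - exp (- s * x)) \<partial>\<nu>) < \<infinity>" .
  have eq: "(\<integral>\<^sup>+ x\<in>{0<..}. ennreal (1 - exp (- s * x)) \<partial>\<nu>) = (\<integral>\<^sup>+ x. ennreal (indicator {0<..} x * (1 - exp (- s * x))) \<partial>\<nu>)"
    by (intro nn_integral_cong) (auto split: split_indicator)
  have "(LINT x:{0<..}|\<nu>. 1 - exp (- s * x)) = enn2real (\<integral>\<^sup>+ x\<in>{0<..}. ennreal (1 - exp (- s * x)) \<partial>\<nu>)"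
    unfolding set_lebesgue_integral_def eq
    using assms by (subst integral_eq_nn_integral) (auto split: split_indicator)
  then show "ennreal (bernstein_fun b \<nu> s) = ennreal (b * s) + (\<integral>\<^sup>+ x\<in>{0<..}. ennreal (1 - exp (- s * x)) \<partial>\<nu>)"
    using fin assms by (simp add: bernstein_fun_def)
qed

text \<open>At s = n + 1 the integrand 1 - exp(-s x) is at least 1/2 for x > 1/s, so the Bernstein
  function dominates half of the tail at 1/s. These tails increase to the infinite total mass; the
  factor 2 in front of \<bar>C\<bar> pays for the half.\<close>

lemma bernstein_fun_unbounded:
  assumes "b \<ge> 0" "levy_measure \<nu>" "emeasure \<nu> {0<..} = \<infinity>"
  obtains s where "s > 0" "C \<le> bernstein_fun b \<nu> s"
proof -
  have sets [measurable_cong]: "sets \<nu> = sets borel" using assms by (simp add: levy_measure_def)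
  have "(SUP n. emeasure \<nu> {1 / real (Suc n)<..}) = emeasure \<nu> (\<Union>n. {1 / real (Suc n)<..})"
  proof (rule SUP_emeasure_incseq)
    show "range (\<lambda>n. {1 / real (Suc n)<..}) \<subseteq> sets \<nu>" by (auto simp: sets)
    show "incseq (\<lambda>n. {1 / real (Suc n)<..})"
    proof (rule incseq_SucI)
      fix n show "{1 / real (Suc n)<..} \<subseteq> {1 / real (Suc (Suc n))<..}"
        using frac_le[of 1 1 "real (Suc n)" "real (Suc (Suc n))"] by auto
    qed
  qed
  also have "(\<Union>n. {1 / real (Suc n)<..}) = {0<..}"
  proof (intro set_eqI iffI)
    fix x :: real assume "x \<in> {0<..}"
    then obtain n where "1 / real (Suc n) < x" using nat_approx_posE[of x] by auto
    then show "x \<in> (\<Union>n. {1 / real (Suc n)<..})" by blast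
  next
    fix x :: real assume "x \<in> (\<Union>n. {1 / real (Suc n)<..})"
    then obtain n where "1 / real (Suc n) < x" by auto
    moreover have "0 < 1 / real (Suc n)" by simp
    ultimately show "x \<in> {0<..}" by (simp only: greaterThan_iff)
  qed
  also note assms(3)
  finally have S: "(SUP n. emeasure \<nu> {1 / real (Suc n)<..}) = \<infinity>" .
  have "ennreal (2 * \<bar>C\<bar>) < (SUP n. emeasure \<nu> {1 / real (Suc n)<..})"
    unfolding S by simp
  then obtain n where n: "ennreal (2 * \<bar>C\<bar>) < emeasure \<nu> {1 / real (Suc n)<..}"
    unfolding less_SUP_iff by blast
  define s where "s = real (Suc n)"
  have s: "s > 0" by (simp add: s_def)
  have "ennreal \<bar>C\<bar> = ennreal (1/2) * ennreal (2 * \<bar>C\<bar>)" by (subst ennreal_mult[symmetric]) auto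
  also have "\<dots> \<le> ennreal (1/2) * emeasure \<nu> {1 / s<..}"
    using n by (intro mult_left_mono) (auto simp: s_def)
  also have "\<dots> = (\<integral>\<^sup>+ x. ennreal (1/2) * indicator {1 / s<..} x \<partial>\<nu>)"
    by (subst nn_integral_cmult_indicator) (auto simp: sets)
  also have "\<dots> \<le> (\<integral>\<^sup>+ x\<in>{0<..}. ennreal (1 - exp (- s * x)) \<partial>\<nu>)"
  proof (rule nn_integral_mono)
    fix x
    show "ennreal (1/2) * indicator {1 / s<..} x \<le> ennreal (1 - exp (- s * x)) * indicator {0<..} x"
    proof (cases "1 / s < x")
      case True
      then have "1 < s * x" using s by (simp add: field_simps)
      then have "2 \<le> exp (s * x)" using exp_ge_add_one_self[of "s * x"] by linarith
      then have "exp (- (s * x)) \<le> 1 / 2" by (simp add: exp_minus field_simps)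
      then have "ennreal (1/2) \<le> ennreal (1 - exp (- s * x))" by (intro ennreal_leI) simp
      moreover have "0 < x" using True s by (meson less_trans zero_less_divide_1_iff)
      ultimately show ?thesis using True by simp
    qed simp
  qed
  also have "\<dots> \<le> ennreal (bernstein_fun b \<nu> s)"
    using bernstein_fun_eq_nn_integral[OF assms(1,2) s] by simp
  finally have "\<bar>C\<bar> \<le> bernstein_fun b \<nu> s"
    using bernstein_fun_nonneg[OF assms(1,2) s] by (simp add: ennreal_le_iff)
  then show ?thesis using s that by auto
qed

lemma nn_integral_exp_Ioo:
  assumes "s > 0" "z > 0"
  shows "(\<integral>\<^sup>+ t. indicator {0<..<z} t * ennreal (exp (- s * t)) \<partial>lborel) = ennreal ((1 - exp (- s * z)) / s)"
proof -
  have "(\<integral>\<^sup>+ t. indicator {0<..<z} t * ennreal (exp (- s * t)) \<partial>lborel) = (\<integral>\<^sup>+ t. ennreal (exp (- s * t)) * indicator {0..z} t \<partial>lborel)"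
  proof (rule nn_integral_cong_AE)
    have "AE t in lborel. t \<noteq> 0" "AE t in lborel. t \<noteq> z" by (rule AE_lborel_singleton)+
    then show "AE t in lborel. indicator {0<..<z} t * ennreal (exp (- s * t)) = ennreal (exp (- s * t)) * indicator {0..z} t"
      by eventually_elim (auto split: split_indicator)
  qed
  also have "\<dots> = ennreal (- exp (- s * z) / s - (- exp (- s * 0) / s))"
    by (rule nn_integral_FTC_Icc) (use assms in \<open>auto intro!: derivative_eq_intros\<close>)
  finally show ?thesis by (simp add: diff_divide_distrib)
qed

text \<open>Fubini over 0 < t < z. The measure with an atom b at 0 and density
  \<open>levy_tail' \<nu>\<close> therefore has transform f(s)/s, which is why it is the natural
  memory kernel.\<close>

lemma laplace_levy_tail':
  assumes "b \<ge> 0" "levy_measure \<nu>" "s > 0"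
  shows "ennreal s * (ennreal b + laplace (levy_tail' \<nu>) s) = ennreal (bernstein_fun b \<nu> s)"
proof -
  have sets [measurable_cong]: "sets \<nu> = sets borel" using assms by (simp add: levy_measure_def)
  interpret \<nu>: sigma_finite_measure \<nu> by (rule levy_measure_sigma_finite[OF assms(2)])
  interpret P: pair_sigma_finite lborel \<nu> ..
  have "laplace (levy_tail' \<nu>) s = (\<integral>\<^sup>+ t. \<integral>\<^sup>+ z. (if 0 < t \<and> t < z then ennreal (exp (- s * t)) else 0) \<partial>\<nu> \<partial>lborel)"
    unfolding laplace_def
  proof (rule nn_integral_cong)
    fix t
    have "(\<integral>\<^sup>+ z. (if 0 < t \<and> t < z then ennreal (exp (- s * t)) else 0) \<partial>\<nu>) = (\<integral>\<^sup>+ z. (if 0 < t then ennreal (exp (- s * t)) else 0) * indicator {t<..} z \<partial>\<nu>)"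
      by (intro nn_integral_cong) (auto split: split_indicator)
    also have "\<dots> = (if 0 < t then ennreal (exp (- s * t)) else 0) * emeasure \<nu> {t<..}"
      by (rule nn_integral_cmult_indicator) (simp add: sets)
    finally show "levy_tail' \<nu> t * ennreal (exp (- s * t)) = (\<integral>\<^sup>+ z. (if 0 < t \<and> t < z then ennreal (exp (- s * t)) else 0) \<partial>\<nu>)"
      by (simp add: levy_tail'_def mult.commute)
  qed
  also have "\<dots> = (\<integral>\<^sup>+ z. \<integral>\<^sup>+ t. (if 0 < t \<and> t < z then ennreal (exp (- s * t)) else 0) \<partial>lborel \<partial>\<nu>)"
    by (rule P.Fubini'[symmetric]) measurable
  also have "\<dots> = (\<integral>\<^sup>+ z. ennreal (1 / s) * (ennreal (1 - exp (- s * z)) * indicator {0<..} z) \<partial>\<nu>)"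
  proof (rule nn_integral_cong)
    fix z :: real
    have "(\<integral>\<^sup>+ t. (if 0 < t \<and> t < z then ennreal (exp (- s * t)) else 0) \<partial>lborel) = (\<integral>\<^sup>+ t. indicator {0<..<z} t * ennreal (exp (- s * t)) \<partial>lborel)"
      by (intro nn_integral_cong) (auto split: split_indicator)
    also have "\<dots> = ennreal (1 / s) * (ennreal (1 - exp (- s * z)) * indicator {0<..} z)"
    proof (cases "0 < z")
      case True
      then have "exp (- s * z) \<le> 1" using assms by simp
      then show ?thesis using True assms unfolding nn_integral_exp_Ioo[OF assms(3) True]
        by (simp add: ennreal_mult[symmetric])
    qed simp
    finally show "(\<integral>\<^sup>+ t. (if 0 < t \<and> t < z then ennreal (exp (- s * t)) else 0) \<partial>lborel) = ennreal (1 / s) * (ennreal (1 - exp (- s * z)) * indicator {0<..} z)" .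
  qed
  also have "\<dots> = ennreal (1 / s) * (\<integral>\<^sup>+ x\<in>{0<..}. ennreal (1 - exp (- s * x)) \<partial>\<nu>)"
    by (rule nn_integral_cmult) measurable
  finally have "ennreal s * laplace (levy_tail' \<nu>) s = ennreal s * ennreal (1 / s) * (\<integral>\<^sup>+ x\<in>{0<..}. ennreal (1 - exp (- s * x)) \<partial>\<nu>)"
    by (simp add: mult.assoc)
  also have "ennreal s * ennreal (1 / s) = 1" using assms by (simp add: ennreal_mult[symmetric])
  finally show ?thesis
    using bernstein_fun_eq_nn_integral[OF assms] assms
    by (simp add: distrib_left ennreal_mult[symmetric] mult.commute)
qed

lemma laplace_levy_tail'_finite:
  assumes "levy_measure \<nu>" "s > 0"
  shows "laplace (levy_tail' \<nu>) s < \<infinity>"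
proof (rule ccontr)
  assume "\<not> laplace (levy_tail' \<nu>) s < \<infinity>"
  then have "laplace (levy_tail' \<nu>) s = top" by (simp flip: top.not_eq_extremum)
  then show False
    using laplace_levy_tail'[of 0 \<nu> s] assms by (simp add: ennreal_mult_top)
qed

lemma levy_tail'_locally_integrable:
  assumes "levy_measure \<nu>"
  shows "(\<integral>\<^sup>+ x. levy_tail' \<nu> x * indicator {..T} x \<partial>lborel) < \<infinity>"
proof -
  note [measurable] = levy_tail'_measurable[OF assms]
  have "(\<integral>\<^sup>+ x. levy_tail' \<nu> x * indicator {..T} x \<partial>lborel) \<le> (\<integral>\<^sup>+ x. ennreal (exp T) * (levy_tail' \<nu> x * ennreal (exp (- 1 * x))) \<partial>lborel)"
  proof (rule nn_integral_mono)
    fix x :: real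
    have "1 \<le> ennreal (exp T) * ennreal (exp (- 1 * x))" if "x \<le> T"
      using that by (simp add: ennreal_mult[symmetric] exp_add[symmetric])
    then have "levy_tail' \<nu> x * 1 \<le> levy_tail' \<nu> x * (ennreal (exp T) * ennreal (exp (- 1 * x)))" if "x \<le> T"
      using that by (intro mult_left_mono) auto
    then show "levy_tail' \<nu> x * indicator {..T} x \<le> ennreal (exp T) * (levy_tail' \<nu> x * ennreal (exp (- 1 * x)))"
      by (auto split: split_indicator simp: mult_ac)
  qed
  also have "\<dots> = ennreal (exp T) * laplace (levy_tail' \<nu>) 1"
    unfolding laplace_def by (rule nn_integral_cmult) measurable
  also have "\<dots> < \<infinity>"
    using laplace_levy_tail'_finite[OF assms, of 1] by (simp add: ennreal_mult_less_top)
  finally show ?thesis .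
qed

section \<open>Densities of potential measures\<close>

text \<open>Convolution of a measure with a function. For an absolutely continuous measure the
  result does not depend on the version of the function, at any single t.\<close>

definition mconv :: "real measure \<Rightarrow> (real \<Rightarrow> ennreal) \<Rightarrow> real \<Rightarrow> ennreal" where
  "mconv m f t = (\<integral>\<^sup>+ p. f (t - p) \<partial>m)"

lemma AE_lborel_ex_Ioo:
  fixes a b :: real
  assumes "AE x in lborel. P x" "a < b"
  obtains x where "a < x" "x < b" "P x"
proof -
  have "\<exists>x\<in>{a<..<b}. P x"
  proof (rule ccontr)
    assume "\<not> ?thesis"
    then have "AE x in lborel. x \<notin> {a<..<b}" using assms(1) by (auto elim!: eventually_mono)
    then have "emeasure lborel {a<..<b} = 0"
      by (subst (asm) AE_iff_measurable[OF _ refl]) (auto simp: greaterThanLessThan_def greaterThan_def lessThan_def Int_def)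
    then show False using assms(2) by simp
  qed
  then show thesis using that by auto
qed

lemma mconv_measurable:
  assumes "finite_measure m" and [measurable_cong]: "sets m = sets borel"
    and [measurable]: "f \<in> borel_measurable borel"
  shows "mconv m f \<in> borel_measurable borel"
proof -
  interpret finite_measure m by fact
  show ?thesis unfolding mconv_def by measurable
qed

lemma mconv_conv:
  assumes "finite_measure m" and [measurable_cong]: "sets m = sets borel"
    and [measurable]: "f \<in> borel_measurable borel" "g \<in> borel_measurable borel"
  shows "mconv m (conv f g) t = conv (mconv m f) g t"
proof -
  interpret finite_measure m by fact
  interpret P: pair_sigma_finite m lborel ..
  have "mconv m (conv f g) t = (\<integral>\<^sup>+ p. \<integral>\<^sup>+ y. f (y - p) * g (t - y) \<partial>lborel \<partial>m)"
    unfolding mconv_def conv_def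
  proof (rule nn_integral_cong)
    fix p
    show "(\<integral>\<^sup>+ x. f x * g (t - p - x) \<partial>lborel) = (\<integral>\<^sup>+ y. f (y - p) * g (t - y) \<partial>lborel)"
      using nn_integral_shift[of "\<lambda>x. f x * g (t - p - x)" p] by (simp add: algebra_simps)
  qed
  also have "\<dots> = (\<integral>\<^sup>+ y. \<integral>\<^sup>+ p. f (y - p) * g (t - y) \<partial>m \<partial>lborel)"
    by (rule P.Fubini'[symmetric]) measurable
  also have "\<dots> = conv (mconv m f) g t"
    unfolding conv_def mconv_def by (intro nn_integral_cong nn_integral_multc) measurable
  finally show ?thesis .
qed

lemma mconv_cong_AE:
  assumes "absolutely_continuous lborel m" "sets m = sets borel" "AE x in lborel. f x = g x"
  shows "mconv m f t = mconv m g t"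
proof -
  have "AE p in m. f (t - p) = g (t - p)"
    using absolutely_continuous_AE[OF _ assms(1) AE_lborel_reflect[OF assms(3)]] assms(2) by simp
  then show ?thesis unfolding mconv_def by (rule nn_integral_cong_AE)
qed

text \<open>For a fixed jump z the position x is integrated against Lebesgue measure, and a
  translate of a null set is null. Fubini then covers all jumps, whatever the measure \<nu> looks
  like.\<close>

lemma absolutely_continuous_distr_add:
  fixes w :: "real \<Rightarrow> real \<Rightarrow> ennreal"
  assumes "sigma_finite_measure \<nu>" and [measurable_cong]: "sets \<nu> = sets borel"
    and w [measurable]: "case_prod w \<in> borel_measurable (borel \<Otimes>\<^sub>M borel)"
  shows "absolutely_continuous lborel
    (distr (density (lborel \<Otimes>\<^sub>M \<nu>) (case_prod w)) borel (\<lambda>(x, z). x + z))" (is "absolutely_continuous _ ?m")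
  unfolding absolutely_continuous_def
proof
  interpret sigma_finite_measure \<nu> by fact
  interpret P: pair_sigma_finite lborel \<nu> ..
  fix A assume A: "A \<in> null_sets (lborel :: real measure)"
  have [measurable]: "A \<in> sets borel" using A by auto
  have "emeasure ?m A = (\<integral>\<^sup>+ p. case_prod w p * indicator A (fst p + snd p) \<partial>(lborel \<Otimes>\<^sub>M \<nu>))"
    by (subst nn_integral_indicator[symmetric], simp, subst nn_integral_distr, simp, simp, subst nn_integral_density)
      (auto simp: case_prod_beta)
  also have "\<dots> = (\<integral>\<^sup>+ z. \<integral>\<^sup>+ x. w x z * indicator A (x + z) \<partial>lborel \<partial>\<nu>)"
    by (subst P.nn_integral_snd[symmetric]) (auto simp: case_prod_beta)
  also have "\<dots> = (\<integral>\<^sup>+ z. 0 \<partial>\<nu>)"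
  proof (rule nn_integral_cong)
    fix z
    have "AE x in lborel. x \<notin> A" using A by (rule AE_not_in)
    then have "AE x in lborel. z + 1 * x \<notin> A" by (intro AE_borel_affine) auto
    then have "AE x in lborel. w x z * indicator A (x + z) = 0"
      by eventually_elim (simp add: add.commute)
    then have "(\<integral>\<^sup>+ x. w x z * indicator A (x + z) \<partial>lborel) = (\<integral>\<^sup>+ x. 0 \<partial>(lborel :: real measure))"
      by (rule nn_integral_cong_AE)
    then show "(\<integral>\<^sup>+ x. w x z * indicator A (x + z) \<partial>lborel) = 0" by simp
  qed
  finally show "A \<in> null_sets ?m" by (intro null_setsI) auto
qed

text \<open>If \<open>v\<close> solves \<open>v * (c + \<nu>-tail) = 1\<close> almost everywhere, then it does so everywhere.
  In probabilistic terms \<open>v\<close> is a potential density and \<open>m\<close> below is the law of the subordinator at its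
  first passage over a level \<open>a\<close> that it does not creep over; \<open>m\<close> is absolutely continuous,
  and the strong Markov property \<open>v = v 1\<^bsub>..a\<^esub> + m * v\<close> carries the equation over to every later point.\<close>

lemma conv_levy_tail'_eq_1:
  fixes v :: "real \<Rightarrow> ennreal"
  assumes \<nu>: "levy_measure \<nu>" and v [measurable]: "v \<in> borel_measurable borel"
    and v0: "\<And>t. t \<le> 0 \<Longrightarrow> v t = 0" and c: "c > 0"
    and K_def: "K = (\<lambda>t. ennreal c * indicator {0..} t + levy_tail' \<nu> t)"
    and AE: "AE t in lborel. 0 < t \<longrightarrow> conv v K t = 1"
    and t: "t > 0"
  shows "conv v K t = 1"
proof -
  note [measurable] = levy_tail'_measurable[OF \<nu>]
  have sets\<nu> [measurable_cong]: "sets \<nu> = sets borel" using \<nu> by (simp add: levy_measure_def)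
  interpret \<nu>: sigma_finite_measure \<nu> by (rule levy_measure_sigma_finite[OF \<nu>])
  interpret P: pair_sigma_finite lborel \<nu> ..
  have [measurable]: "K \<in> borel_measurable borel" unfolding K_def by measurable
  have Kneg: "K t = 0" if "t < 0" for t using that by (simp add: K_def levy_tail'_def)
  \<comment> \<open>The level is put below t at a point where the equation is known; almost every
    point qualifies.\<close>
  obtain a where a: "0 < a" "a < t" "conv v K a = 1"
    using AE_lborel_ex_Ioo[OF AE t] by auto
  define v1 where "v1 = (\<lambda>x. v x * indicator {..a} x)"
  \<comment> \<open>Rate of leaving x \<le> a by a jump z that lands beyond a; \<open>m\<close>
    collects the landing points. With c read as a killing rate, the total mass of \<open>m\<close>
    is at most 1.\<close>
  define w where "w = (\<lambda>x z. v1 x * indicator {a<..} (x + z))"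
  define m where "m = distr (density (lborel \<Otimes>\<^sub>M \<nu>) (case_prod w)) borel (\<lambda>(x, z). x + z)"
  have [measurable]: "v1 \<in> borel_measurable borel" unfolding v1_def by measurable
  have [measurable]: "case_prod w \<in> borel_measurable (borel \<Otimes>\<^sub>M borel)" unfolding w_def by measurable
  have setsm [simp, measurable_cong]: "sets m = sets borel" by (simp add: m_def)
  have acm: "absolutely_continuous lborel m"
    unfolding m_def by (rule absolutely_continuous_distr_add) (use \<nu>.sigma_finite_measure_axioms sets\<nu> in auto)
  have em: "emeasure m A = (\<integral>\<^sup>+ x. v1 x * emeasure \<nu> {z. a < x + z \<and> x + z \<in> A} \<partial>lborel)"
    if [measurable]: "A \<in> sets borel" for A
  proof -
    have "emeasure m A = (\<integral>\<^sup>+ p. case_prod w p * indicator A (fst p + snd p) \<partial>(lborel \<Otimes>\<^sub>M \<nu>))"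
      unfolding m_def
      by (subst nn_integral_indicator[symmetric], simp, subst nn_integral_distr, simp, simp, subst nn_integral_density)
        (auto simp: case_prod_beta)
    also have "\<dots> = (\<integral>\<^sup>+ x. \<integral>\<^sup>+ z. w x z * indicator A (x + z) \<partial>\<nu> \<partial>lborel)"
      by (subst \<nu>.nn_integral_fst[symmetric]) (auto simp: case_prod_beta)
    also have "\<dots> = (\<integral>\<^sup>+ x. v1 x * emeasure \<nu> {z. a < x + z \<and> x + z \<in> A} \<partial>lborel)"
    proof (rule nn_integral_cong)
      fix x :: real
      have "(\<integral>\<^sup>+ z. w x z * indicator A (x + z) \<partial>\<nu>) = (\<integral>\<^sup>+ z. v1 x * indicator {z. a < x + z \<and> x + z \<in> A} z \<partial>\<nu>)"
        unfolding w_def by (intro nn_integral_cong) (auto split: split_indicator)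
      also have "\<dots> = v1 x * emeasure \<nu> {z. a < x + z \<and> x + z \<in> A}"
        by (rule nn_integral_cmult_indicator) measurable
      finally show "(\<integral>\<^sup>+ z. w x z * indicator A (x + z) \<partial>\<nu>) = v1 x * emeasure \<nu> {z. a < x + z \<and> x + z \<in> A}" .
    qed
    finally show ?thesis .
  qed
  have conv_v1_a: "conv v1 K a = 1"
  proof -
    have "conv v1 K a = conv v K a"
      unfolding conv_def by (rule nn_integral_cong) (use Kneg in \<open>auto simp: v1_def split: split_indicator\<close>)
    then show ?thesis using a by simp
  qed
  have one_a: "conv v1 (indicator {0..}) s = conv v1 (indicator {0..}) a" if "s \<ge> a" for s
    unfolding conv_def by (rule nn_integral_cong) (use that in \<open>auto simp: v1_def split: split_indicator\<close>)
  have split: "conv v1 K s = ennreal c * conv v1 (indicator {0..}) s + conv v1 (levy_tail' \<nu>) s" for s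
    unfolding K_def by (subst conv_add_right) (auto simp: conv_cmult_right)
  \<comment> \<open>A jump across a lands either in (a, s] or beyond s. Splitting the tail at a - x
    accordingly gives the balance between the levels a and s.\<close>
  have m3: "emeasure m {..s} + conv v1 (levy_tail' \<nu>) s = conv v1 (levy_tail' \<nu>) a" if s: "s > a" for s
  proof -
    have "emeasure \<nu> {z. a < x + z \<and> x + z \<le> s} = (\<integral>\<^sup>+ z. (if a < x + z \<and> x + z \<le> s then 1 else 0) \<partial>\<nu>)" for x
    proof -
      have "emeasure \<nu> {z. a < x + z \<and> x + z \<le> s} = (\<integral>\<^sup>+ z. indicator {z. a < x + z \<and> x + z \<le> s} z \<partial>\<nu>)"
        by (rule nn_integral_indicator[symmetric]) measurable
      also have "\<dots> = (\<integral>\<^sup>+ z. (if a < x + z \<and> x + z \<le> s then 1 else 0) \<partial>\<nu>)"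
        by (intro nn_integral_cong) (auto split: split_indicator)
      finally show ?thesis .
    qed
    then have [measurable]: "(\<lambda>x. emeasure \<nu> {z. a < x + z \<and> x + z \<le> s}) \<in> borel_measurable borel"
      by simp
    have "emeasure m {..s} + conv v1 (levy_tail' \<nu>) s
      = (\<integral>\<^sup>+ x. v1 x * emeasure \<nu> {z. a < x + z \<and> x + z \<le> s} + v1 x * levy_tail' \<nu> (s - x) \<partial>lborel)"
      unfolding conv_def by (subst em, simp, subst nn_integral_add) auto
    also have "\<dots> = (\<integral>\<^sup>+ x. v1 x * levy_tail' \<nu> (a - x) \<partial>lborel)"
    proof (rule nn_integral_cong_AE)
      have "AE x in lborel. x \<noteq> a" by (rule AE_lborel_singleton)
      then show "AE x in lborel. v1 x * emeasure \<nu> {z. a < x + z \<and> x + z \<le> s} + v1 x * levy_tail' \<nu> (s - x)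
        = v1 x * levy_tail' \<nu> (a - x)"
      proof eventually_elim
        fix x :: real assume "x \<noteq> a"
        show "v1 x * emeasure \<nu> {z. a < x + z \<and> x + z \<le> s} + v1 x * levy_tail' \<nu> (s - x) = v1 x * levy_tail' \<nu> (a - x)"
        proof (cases "x < a")
          case True
          have "emeasure \<nu> {z. a < x + z \<and> x + z \<le> s} + emeasure \<nu> {s - x<..}
            = emeasure \<nu> ({z. a < x + z \<and> x + z \<le> s} \<union> {s - x<..})"
            by (rule plus_emeasure) (auto simp: sets\<nu>)
          also have "{z. a < x + z \<and> x + z \<le> s} \<union> {s - x<..} = {a - x<..}" using s by auto
          finally show ?thesis using True s by (simp add: levy_tail'_def distrib_left[symmetric])
        qed (use \<open>x \<noteq> a\<close> in \<open>auto simp: v1_def\<close>)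
      qed
    qed
    finally show ?thesis by (simp add: conv_def)
  qed
  have m_le: "emeasure m {..s} \<le> 1" for s
  proof -
    have "emeasure m {..s} \<le> emeasure m {..max s (a + 1)}" by (rule emeasure_mono) auto
    also have "\<dots> \<le> conv v1 (levy_tail' \<nu>) a"
      using m3[of "max s (a + 1)"] by (metis le_iff_add less_add_one max.strict_coboundedI2)
    also have "\<dots> \<le> 1" using conv_v1_a split[of a] by (metis add.commute le_iff_add)
    finally show ?thesis .
  qed
  have finm: "finite_measure m"
  proof
    have "emeasure m (\<Union>n. {..real n}) = (SUP n. emeasure m {..real n})"
      by (rule SUP_emeasure_incseq[symmetric]) (auto simp: incseq_def)
    also have "\<dots> \<le> 1" by (rule SUP_least) (rule m_le)
    also have "(\<Union>n. {..real n}) = space m"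
      using real_arch_simple sets_eq_imp_space_eq[OF setsm] by auto
    finally show "emeasure m (space m) \<noteq> \<infinity>" by (auto simp: top_unique)
  qed
  have m0: "emeasure m {..a} = 0"
  proof -
    have e: "{z. a < x + z \<and> x + z \<in> {..a}} = {}" for x by auto
    show ?thesis by (subst em, simp, unfold e) simp
  qed
  have AEm: "AE p in m. a < p"
    using m0 by (intro AE_I[of _ _ "{..a}"]) auto
  have mz: "mconv m f s = 0" if "s \<le> a" "\<And>x. x < 0 \<Longrightarrow> f x = 0" for f s
  proof -
    have "AE p in m. f (s - p) = 0" using AEm by eventually_elim (use that in auto)
    then show ?thesis unfolding mconv_def by (rule nn_integral_zero')
  qed
  have vK: "AE x in lborel. conv v K x = indicator {0..} x"
  proof -
    have "AE x in lborel. x \<noteq> (0::real)" by (rule AE_lborel_singleton)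
    then show ?thesis using AE
    proof eventually_elim
      fix x :: real assume "x \<noteq> 0" "0 < x \<longrightarrow> conv v K x = 1"
      moreover have "conv v K x = 0" if "x < 0"
        by (rule conv_neg_eq_0) (use v0 Kneg that in auto)
      ultimately show "conv v K x = indicator {0..} x" by (cases "x < 0") auto
    qed
  qed
  have m_one: "mconv m (indicator {0..}) s = emeasure m {..s}" for s
  proof -
    have "indicator {0..} (s - p) = (indicator {..s} p :: ennreal)" for p by (auto split: split_indicator)
    then show ?thesis by (simp add: mconv_def)
  qed
  \<comment> \<open>The right-hand side of the strong Markov decomposition. It satisfies the
    equation everywhere beyond a, and only afterwards is it identified with
    \<open>v\<close>.\<close>
  define h where "h = (\<lambda>x. mconv m v x + v1 x)"
  have [measurable]: "mconv m v \<in> borel_measurable borel"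
    by (rule mconv_measurable[OF finm setsm v])
  have [measurable]: "h \<in> borel_measurable borel" unfolding h_def by measurable
  have hK: "conv h K s = mconv m (indicator {0..}) s + conv v1 K s" for s
  proof -
    have "conv h K s = conv (mconv m v) K s + conv v1 K s"
      unfolding h_def by (rule conv_add_left) measurable
    also have "conv (mconv m v) K s = mconv m (conv v K) s"
      by (rule mconv_conv[OF finm setsm, symmetric]) measurable
    \<comment> \<open>Here almost everywhere turns into everywhere: \<open>m\<close> charges no
      Lebesgue null set, so the exceptional set of the equation for \<open>v\<close> is invisible at
      each s.\<close>
    also have "\<dots> = mconv m (indicator {0..}) s"
      by (rule mconv_cong_AE[OF acm setsm vK])
    finally show ?thesis .
  qed
  have hK1: "conv h K s = 1" if "s > a" for s
  proof -
    have "conv h K s = (emeasure m {..s} + conv v1 (levy_tail' \<nu>) s) + ennreal c * conv v1 (indicator {0..}) a"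
      unfolding hK m_one split[of s] one_a[OF less_imp_le[OF that]] by (simp only: ac_simps)
    also have "\<dots> = conv v1 K a"
      unfolding m3[OF that] split[of a] by (rule add.commute)
    finally show ?thesis using conv_v1_a by simp
  qed
  have hKv: "AE x in lborel. conv h K x = conv v K x"
    using vK
  proof eventually_elim
    fix x assume x: "conv v K x = indicator {0..} x"
    show "conv h K x = conv v K x"
    proof (cases "x > a")
      case True
      then show ?thesis using hK1[OF True] x a by simp
    next
      case False
      have "conv v1 K x = conv v K x"
        unfolding conv_def by (rule nn_integral_cong) (use Kneg False in \<open>auto simp: v1_def split: split_indicator\<close>)
      then show ?thesis using False by (simp add: hK mz)
    qed
  qed
  have lapK: "laplace K s \<noteq> 0" "laplace K s \<noteq> \<infinity>" if "s > 0" for s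
  proof -
    have "laplace K s = ennreal c * ennreal (1 / s) + laplace (levy_tail' \<nu>) s"
      unfolding K_def by (subst laplace_add) (auto simp: laplace_cmult laplace_indicator[OF that])
    moreover have "ennreal c * ennreal (1 / s) \<noteq> 0" using c that by simp
    moreover have "ennreal c * ennreal (1 / s) \<noteq> \<infinity>" by (simp add: ennreal_mult_eq_top_iff)
    ultimately show "laplace K s \<noteq> 0" "laplace K s \<noteq> \<infinity>"
      using laplace_levy_tail'_finite[OF \<nu> that] by (auto simp: less_top)
  qed
  have lapv: "laplace v s * laplace K s = ennreal (1 / s)" if "s > 0" for s
    unfolding laplace_conv[OF v \<open>K \<in> _\<close>, symmetric] laplace_cong_AE[OF vK] by (rule laplace_indicator[OF that])
  have laph: "laplace h s * laplace K s = ennreal (1 / s)" if "s > 0" for s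
    using lapv[OF that] laplace_cong_AE[OF hKv, of s]
    by (simp add: laplace_conv)
  \<comment> \<open>The common factor \<open>laplace K s\<close> is positive and finite, so it
    cancels. Convolution with \<open>K\<close> does not see the null set on which \<open>h\<close>
    and \<open>v\<close> may differ.\<close>
  have "AE x in lborel. h x = v x"
  proof (rule laplace_unique_AE)
    fix s :: real assume s: "s > 0"
    show "laplace h s = laplace v s"
    proof -
      have "laplace K s * laplace h s = laplace K s * laplace v s"
        using lapv[OF s] laph[OF s] by (simp add: mult.commute)
      then show ?thesis using lapK[OF s] by (auto simp: ennreal_mult_cancel_left)
    qed
    show "laplace h s < \<infinity>"
      using laph[OF s] lapK[OF s] by (auto simp: less_top[symmetric] ennreal_top_mult)
  next
    fix x :: real assume x: "x < 0"
    then show "h x = 0" using v0 a by (simp add: h_def mz v1_def)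
    show "v x = 0" using v0 x by simp
  qed measurable
  then have "conv h K t = conv v K t" by (rule conv_cong_AE_left)
  then show ?thesis using hK1[OF a(2)] by simp
qed

section \<open>Continuity of tail convolutions and the pointwise density equation\<close>

lemma AE_lborel_le_imp_le:
  fixes f g :: "real \<Rightarrow> real"
  assumes "continuous_on {a..} f" "continuous_on {a..} g"
    and AE: "AE t in lborel. a < t \<longrightarrow> f t \<le> g t" and t: "a \<le> t"
  shows "f t \<le> g t"
proof (rule ccontr)
  assume "\<not> f t \<le> g t"
  then have pos: "f t - g t > 0" by simp
  have "continuous_on {a..} (\<lambda>t. f t - g t)" by (intro continuous_intros assms)
  then obtain d where d: "d > 0" "\<And>x. x \<in> {a..} \<Longrightarrow> dist x t < d \<Longrightarrow> dist (f x - g x) (f t - g t) < f t - g t"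
    unfolding continuous_on_iff using pos t by (metis atLeast_iff)
  obtain x where x: "t < x" "x < t + d" "a < x \<longrightarrow> f x \<le> g x"
    using AE_lborel_ex_Ioo[OF AE, of t "t + d"] d(1) by auto
  then have "f x \<le> g x" using t by auto
  moreover have "dist (f x - g x) (f t - g t) < f t - g t"
    using d(2)[of x] x t by (auto simp: dist_real_def)
  ultimately show False by (auto simp: dist_real_def)
qed

text \<open>The kernel may be unbounded near 0, but it is integrable there and decreasing. Hence
  both one-sided increments over a step \<delta> are at most C times the integral of the kernel over
  (0, \<delta>], which tends to 0.\<close>

lemma conv_levy_tail'_continuous:
  assumes \<nu>: "levy_measure \<nu>" and w [measurable]: "w \<in> borel_measurable borel"
    and w0: "\<And>x. x < 0 \<Longrightarrow> w x = 0" and wC: "\<And>x. w x \<le> ennreal C"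
  shows "continuous_on {0..} (\<lambda>t. enn2real (conv w (levy_tail' \<nu>) t))" (is ?cont)
    and "conv w (levy_tail' \<nu>) t < \<infinity>"
proof -
  note [measurable] = levy_tail'_measurable[OF \<nu>]
  define K where "K = levy_tail' \<nu>"
  have [measurable]: "K \<in> borel_measurable borel" unfolding K_def by measurable
  have K0: "K x = 0" if "x \<le> 0" for x using that by (simp add: K_def levy_tail'_def)
  have Kmono: "K y \<le> K x" if "0 < x" "x \<le> y" for x y
    unfolding K_def by (rule levy_tail'_antimono[OF \<nu> that])
  define J where "J = (\<lambda>\<delta>. \<integral>\<^sup>+ x. K x * indicator {..\<delta>} x \<partial>lborel)"
  have Jfin: "J \<delta> < \<infinity>" for \<delta>
    unfolding J_def K_def by (rule levy_tail'_locally_integrable[OF \<nu>])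
  define k where "k = conv w K"
  have kfin: "k t < \<infinity>" for t
  proof -
    have "k t \<le> (\<integral>\<^sup>+ x. ennreal C * (K (t - x) * indicator {..t} (t - x)) \<partial>lborel)"
      unfolding k_def conv_def
    proof (rule nn_integral_mono)
      fix x
      have "w x * K (t - x) \<le> ennreal C * K (t - x)" by (intro mult_right_mono wC) simp
      then show "w x * K (t - x) \<le> ennreal C * (K (t - x) * indicator {..t} (t - x))"
        using w0[of x] by (cases "x < 0") auto
    qed
    also have "\<dots> = ennreal C * J t"
      unfolding J_def using nn_integral_reflect[of "\<lambda>x. K x * indicator {..t} x" t]
      by (simp add: nn_integral_cmult)
    also have "\<dots> < \<infinity>" using Jfin[of t] by (simp add: ennreal_mult_less_top)
    finally show ?thesis .
  qed
  then show "conv w (levy_tail' \<nu>) t < \<infinity>" by (simp add: k_def K_def)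
  have up: "k t' \<le> k t + ennreal C * J (t' - t)" if "0 \<le> t" "t \<le> t'" for t t'
  proof -
    have "k t' \<le> (\<integral>\<^sup>+ x. w x * K (t - x) + ennreal C * (K (t' - x) * indicator {..t' - t} (t' - x)) \<partial>lborel)"
      unfolding k_def conv_def
    proof (rule nn_integral_mono)
      fix x
      show "w x * K (t' - x) \<le> w x * K (t - x) + ennreal C * (K (t' - x) * indicator {..t' - t} (t' - x))"
      proof (cases "x < t")
        case True
        then have "w x * K (t' - x) \<le> w x * K (t - x)" using that by (intro mult_left_mono Kmono) auto
        then show ?thesis by (rule order_trans) simp
      next
        case False
        have "w x * K (t' - x) \<le> ennreal C * K (t' - x)" by (intro mult_right_mono wC) simp
        then show ?thesis using False by (auto intro: order_trans)
      qed
    qed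
    also have "\<dots> = k t + ennreal C * J (t' - t)"
      unfolding J_def k_def conv_def
      using nn_integral_reflect[of "\<lambda>x. K x * indicator {..t' - t} x" t']
      by (simp add: nn_integral_cmult nn_integral_add)
    finally show ?thesis .
  qed
  \<comment> \<open>Telescoping: the integral of K over (0, t] minus that over (\<delta>, t +
    \<delta>] is at most the integral over (0, \<delta>]. The second integral is finite, so it may
    be cancelled in \<open>ennreal\<close>.\<close>
  have incr: "(\<integral>\<^sup>+ y. (K y - K (y + \<delta>)) * indicator {0<..t} y \<partial>lborel) \<le> J \<delta>"
    if "0 \<le> t" "0 \<le> \<delta>" for t \<delta>
  proof -
    define A where "A = (\<integral>\<^sup>+ y. (K y - K (y + \<delta>)) * indicator {0<..t} y \<partial>lborel)"
    define B where "B = (\<integral>\<^sup>+ y. K (y + \<delta>) * indicator {0<..t} y \<partial>lborel)"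
    have "A + B = (\<integral>\<^sup>+ y. (K y - K (y + \<delta>)) * indicator {0<..t} y + K (y + \<delta>) * indicator {0<..t} y \<partial>lborel)"
      unfolding A_def B_def by (rule nn_integral_add[symmetric]) measurable
    also have "\<dots> \<le> (\<integral>\<^sup>+ y. K y * indicator {..t + \<delta>} y \<partial>lborel)"
    proof (rule nn_integral_mono)
      fix y
      have "K y - K (y + \<delta>) + K (y + \<delta>) = K y" if "0 < y"
        using Kmono[of y "y + \<delta>"] that \<open>0 \<le> \<delta>\<close> by (simp add: diff_add_cancel_ennreal)
      then show "(K y - K (y + \<delta>)) * indicator {0<..t} y + K (y + \<delta>) * indicator {0<..t} y \<le> K y * indicator {..t + \<delta>} y"
        using that by (auto split: split_indicator)
    qed
    also have "\<dots> = (\<integral>\<^sup>+ y. K y * indicator {..\<delta>} y + K y * indicator {\<delta><..t + \<delta>} y \<partial>lborel)"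
      by (rule nn_integral_cong) (use that in \<open>auto split: split_indicator\<close>)
    also have "\<dots> = J \<delta> + (\<integral>\<^sup>+ y. K y * indicator {\<delta><..t + \<delta>} y \<partial>lborel)"
      unfolding J_def by (rule nn_integral_add) measurable
    also have "(\<integral>\<^sup>+ y. K y * indicator {\<delta><..t + \<delta>} y \<partial>lborel) = B"
    proof -
      have "B = (\<integral>\<^sup>+ y. K (y + \<delta>) * indicator {\<delta><..t + \<delta>} (y + \<delta>) \<partial>lborel)"
        unfolding B_def by (rule nn_integral_cong) (auto split: split_indicator)
      then show ?thesis
        using nn_integral_shift[of "\<lambda>y. K y * indicator {\<delta><..t + \<delta>} y" "- \<delta>"] by simp
    qed
    finally have "A + B \<le> J \<delta> + B" .
    moreover have "B \<le> J (t + \<delta>)"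
    proof -
      have "B = (\<integral>\<^sup>+ y. K (y + \<delta>) * indicator {\<delta><..t + \<delta>} (y + \<delta>) \<partial>lborel)"
        unfolding B_def by (rule nn_integral_cong) (auto split: split_indicator)
      also have "\<dots> = (\<integral>\<^sup>+ y. K y * indicator {\<delta><..t + \<delta>} y \<partial>lborel)"
        using nn_integral_shift[of "\<lambda>y. K y * indicator {\<delta><..t + \<delta>} y" "- \<delta>"] by simp
      also have "\<dots> \<le> J (t + \<delta>)"
        unfolding J_def by (rule nn_integral_mono) (auto split: split_indicator)
      finally show ?thesis .
    qed
    then have "B < \<infinity>" using Jfin by (rule le_less_trans)
    ultimately show ?thesis
      unfolding A_def[symmetric] using ennreal_add_left_cancel_le[of B A "J \<delta>"]
      by (auto simp: add.commute)
  qed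
  have down: "k t \<le> k t' + ennreal C * J (t' - t)" if "0 \<le> t" "t \<le> t'" for t t'
  proof -
    define \<delta> where "\<delta> = t' - t"
    have "k t \<le> (\<integral>\<^sup>+ x. w x * K (t' - x) + ennreal C * ((K (t - x) - K (t - x + \<delta>)) * indicator {0<..t} (t - x)) \<partial>lborel)"
      unfolding k_def conv_def
    proof (rule nn_integral_mono)
      fix x
      show "w x * K (t - x) \<le> w x * K (t' - x) + ennreal C * ((K (t - x) - K (t - x + \<delta>)) * indicator {0<..t} (t - x))"
      proof (cases "0 \<le> x \<and> x < t")
        case True
        have t': "t' - x = t - x + \<delta>" by (simp add: \<delta>_def)
        have "K (t - x + \<delta>) \<le> K (t - x)" using True that by (intro Kmono) (auto simp: \<delta>_def)
        then have "K (t - x) = K (t - x + \<delta>) + (K (t - x) - K (t - x + \<delta>))"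
          by (simp add: add_diff_inverse_ennreal)
        then have "w x * K (t - x) = w x * (K (t - x + \<delta>) + (K (t - x) - K (t - x + \<delta>)))"
          by (rule arg_cong)
        also have "\<dots> = w x * K (t - x + \<delta>) + w x * (K (t - x) - K (t - x + \<delta>))"
          by (rule distrib_left)
        also have "\<dots> \<le> w x * K (t - x + \<delta>) + ennreal C * (K (t - x) - K (t - x + \<delta>))"
          by (intro add_left_mono mult_right_mono wC) simp
        finally show ?thesis using True by (simp add: t')
      qed (use w0[of x] K0[of "t - x"] in auto)
    qed
    also have "\<dots> = k t' + ennreal C * (\<integral>\<^sup>+ x. (K (t - x) - K (t - x + \<delta>)) * indicator {0<..t} (t - x) \<partial>lborel)"
      unfolding k_def conv_def by (simp add: nn_integral_cmult nn_integral_add)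
    also have "\<dots> \<le> k t' + ennreal C * J \<delta>"
    proof (intro add_left_mono mult_left_mono)
      have "(\<integral>\<^sup>+ x. (K (t - x) - K (t - x + \<delta>)) * indicator {0<..t} (t - x) \<partial>lborel)
        = (\<integral>\<^sup>+ x. (K x - K (x + \<delta>)) * indicator {0<..t} x \<partial>lborel)"
        using nn_integral_reflect[of "\<lambda>x. (K x - K (x + \<delta>)) * indicator {0<..t} x" t] by simp
      also have "\<dots> \<le> J \<delta>" by (rule incr) (use that in \<open>auto simp: \<delta>_def\<close>)
      finally show "(\<integral>\<^sup>+ x. (K (t - x) - K (t - x + \<delta>)) * indicator {0<..t} (t - x) \<partial>lborel) \<le> J \<delta>" .
    qed simp
    finally show ?thesis unfolding \<delta>_def .
  qed
  \<comment> \<open>Continuity from above of the measure with density K, which does not charge the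
    nonpositive half-line.\<close>
  have Jlim: "\<exists>\<delta>>0. ennreal C * J \<delta> < ennreal e" if e: "e > 0" for e
  proof -
    define \<mu> where "\<mu> = density lborel K"
    have JK: "J \<delta> = emeasure \<mu> {..\<delta>}" for \<delta> unfolding J_def \<mu>_def by (simp add: emeasure_density)
    have "(\<lambda>n. emeasure \<mu> {..1 / real (Suc n)}) \<longlonglongrightarrow> emeasure \<mu> (\<Inter>n. {..1 / real (Suc n)})"
    proof (rule Lim_emeasure_decseq)
      show "range (\<lambda>n. {..1 / real (Suc n)}) \<subseteq> sets \<mu>" by (auto simp: \<mu>_def)
      show "decseq (\<lambda>n. {..1 / real (Suc n)})"
      proof (rule decseq_SucI)
        fix n show "{..1 / real (Suc (Suc n))} \<subseteq> {..1 / real (Suc n)}"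
          using frac_le[of 1 1 "real (Suc n)" "real (Suc (Suc n))"] by auto
      qed
      show "emeasure \<mu> {..1 / real (Suc n)} \<noteq> \<infinity>" for n
        unfolding JK[symmetric] using Jfin[of "1 / real (Suc n)"] by simp
    qed
    also have "(\<Inter>n. {..1 / real (Suc n)}) = {..0}"
    proof (intro set_eqI iffI)
      fix x :: real assume x: "x \<in> (\<Inter>n. {..1 / real (Suc n)})"
      show "x \<in> {..0}"
      proof (rule ccontr)
        assume "x \<notin> {..0}"
        then obtain n where "1 / real (Suc n) < x" using nat_approx_posE[of x] by auto
        moreover have "x \<le> 1 / real (Suc n)" using x by blast
        ultimately show False by simp
      qed
    next
      fix x :: real assume "x \<in> {..0}"
      moreover have "0 \<le> 1 / real (Suc n)" for n by simp
      ultimately show "x \<in> (\<Inter>n. {..1 / real (Suc n)})"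
        by (auto intro: order_trans)
    qed
    also have "emeasure \<mu> {..0} = 0"
      unfolding JK[symmetric] J_def by (rule nn_integral_zero', rule AE_I2) (auto simp: K0 split: split_indicator)
    finally have "(\<lambda>n. ennreal C * emeasure \<mu> {..1 / real (Suc n)}) \<longlonglongrightarrow> ennreal C * 0"
      by (intro ennreal_tendsto_cmult) auto
    then have "\<forall>\<^sub>F n in sequentially. ennreal C * emeasure \<mu> {..1 / real (Suc n)} < ennreal e"
      using e by (intro order_tendstoD) auto
    then obtain n where "ennreal C * emeasure \<mu> {..1 / real (Suc n)} < ennreal e"
      using eventually_happens'[OF sequentially_bot] by blast
    moreover have "0 < 1 / real (Suc n)" by simp
    ultimately show ?thesis unfolding JK by blast
  qed
  have Jmono: "J x \<le> J y" if "x \<le> y" for x y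
    unfolding J_def using that by (intro nn_integral_mono) (auto split: split_indicator)
  have "continuous_on {0..} (\<lambda>t. enn2real (k t))"
    unfolding continuous_on_iff
  proof (intro ballI allI impI)
    fix t e :: real assume t: "t \<in> {0..}" and e: "0 < e"
    obtain \<delta> where \<delta>: "\<delta> > 0" "ennreal C * J \<delta> < ennreal e" using Jlim[OF e] by blast
    show "\<exists>d>0. \<forall>x'\<in>{0..}. dist x' t < d \<longrightarrow> dist (enn2real (k x')) (enn2real (k t)) < e"
    proof (intro exI conjI ballI impI)
      show "\<delta> > 0" by fact
      fix x' assume x': "x' \<in> {0..}" "dist x' t < \<delta>"
      define m M where "m = min x' t" and "M = max x' t"
      have mM: "0 \<le> m" "m \<le> M" "M - m \<le> \<delta>" using t x' by (auto simp: m_def M_def dist_real_def min_def max_def)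
      have CJ: "ennreal C * J (M - m) < ennreal e"
        by (rule le_less_trans[OF mult_left_mono[OF Jmono[OF mM(3)]] \<delta>(2)]) simp
      define j where "j = enn2real (ennreal C * J (M - m))"
      have jj: "ennreal C * J (M - m) = ennreal j" "0 \<le> j"
        unfolding j_def using order.strict_trans[OF CJ ennreal_less_top] by (simp_all add: ennreal_enn2real)
      have j: "j < e" using CJ e unfolding jj(1) by (simp add: ennreal_less_iff jj(2))
      have kk: "k t = ennreal (enn2real (k t))" for t using kfin[of t] by simp
      have "ennreal (enn2real (k M)) \<le> ennreal (enn2real (k m)) + ennreal j"
        using up[OF mM(1,2)] unfolding jj(1) kk[symmetric] .
      also have "\<dots> = ennreal (enn2real (k m) + j)" using jj(2) by simp
      finally have 1: "enn2real (k M) \<le> enn2real (k m) + j"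
        by (rule ennreal_le_iff[THEN iffD1, rotated]) (use jj(2) in simp)
      have "ennreal (enn2real (k m)) \<le> ennreal (enn2real (k M)) + ennreal j"
        using down[OF mM(1,2)] unfolding jj(1) kk[symmetric] .
      also have "\<dots> = ennreal (enn2real (k M) + j)" using jj(2) by simp
      finally have 2: "enn2real (k m) \<le> enn2real (k M) + j"
        by (rule ennreal_le_iff[THEN iffD1, rotated]) (use jj(2) in simp)
      have "\<bar>enn2real (k x') - enn2real (k t)\<bar> = \<bar>enn2real (k M) - enn2real (k m)\<bar>"
        by (auto simp: m_def M_def min_def max_def)
      then show "dist (enn2real (k x')) (enn2real (k t)) < e"
        using 1 2 j by (auto simp: dist_real_def)
    qed
  qed
  then show ?cont by (simp add: k_def K_def)
qed

text \<open>The function v is -u' / \<open>lam\<close>, the potential density of the subordinator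
  killed at rate \<open>lam\<close>. Comparing transforms gives the equation with b and K almost
  everywhere; the version of v is then chosen, or shown to be good, separately for b = 0 and b >
  0.\<close>

lemma potential_density_exists:
  fixes u :: "real \<Rightarrow> real" and \<nu> :: "real measure"
  defines "K \<equiv> levy_tail' \<nu>"
  assumes b: "b \<ge> 0" and \<nu>: "levy_measure \<nu>" and lam: "lam > 0"
    and ac: "abs_continuous_halfline u" and anti: "\<And>x y. 0 \<le> x \<Longrightarrow> x \<le> y \<Longrightarrow> u y \<le> u x"
    and u0: "u 0 = 1" and unn: "\<And>x. 0 \<le> x \<Longrightarrow> 0 \<le> u x"
    and lap: "\<And>s. s > 0 \<Longrightarrow> laplace (\<lambda>t. ennreal (u t) * indicator {0..} t) s =
      ennreal (bernstein_fun b \<nu> s / (s * (lam + bernstein_fun b \<nu> s)))"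
  obtains v :: "real \<Rightarrow> ennreal" where "v \<in> borel_measurable borel" "\<And>t. t \<le> 0 \<Longrightarrow> v t = 0"
    "\<And>t. 0 \<le> t \<Longrightarrow> ennreal (u t) + ennreal lam * conv v (indicator {0..}) t = 1"
    "\<And>t. 0 < t \<Longrightarrow> ennreal b * v t + conv v K t = ennreal (u t)"
    "\<And>s. s > 0 \<Longrightarrow> laplace v s = ennreal (1 / (lam + bernstein_fun b \<nu> s))"
proof -
  define f where "f = bernstein_fun b \<nu>"
  have fnn: "0 \<le> f s" if "s > 0" for s unfolding f_def by (rule bernstein_fun_nonneg[OF b \<nu> that])
  have Km [measurable]: "K \<in> borel_measurable borel" unfolding K_def by (rule levy_tail'_measurable[OF \<nu>])
  have u1: "u t \<le> 1" if "0 \<le> t" for t using anti[of 0 t] that u0 by simp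
  have ucont: "continuous_on {0..} u" by (rule abs_continuous_halfline_imp_continuous_on[OF ac])
  have um [measurable]: "(\<lambda>t. ennreal (u t) * indicator {0..} t) \<in> borel_measurable borel"
  proof -
    have "(\<lambda>t. indicator {0..} t *\<^sub>R u t) \<in> borel_measurable borel"
      by (rule borel_measurable_continuous_on_indicator) (use ucont in auto)
    then have "(\<lambda>t. ennreal (indicator {0..} t *\<^sub>R u t)) \<in> borel_measurable borel" by measurable
    also have "(\<lambda>t. ennreal (indicator {0..} t *\<^sub>R u t)) = (\<lambda>t. ennreal (u t) * indicator {0..} t)"
      by (auto split: split_indicator)
    finally show ?thesis .
  qed
  have "abs_continuous_halfline (\<lambda>t. 1 - u t)"
    using ac unfolding abs_continuous_halfline_def abs_continuous_on_Icc_def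
    by (simp add: abs_minus_commute)
  then obtain v' :: "real \<Rightarrow> ennreal" where v': "v' \<in> borel_measurable borel" "\<And>t. t \<le> 0 \<Longrightarrow> v' t = 0"
    "\<And>t. 0 \<le> t \<Longrightarrow> conv v' (indicator {0..}) t = ennreal ((1 - u t) - (1 - u 0))"
    using abs_continuous_mono_density[of "\<lambda>t. 1 - u t"] anti by auto
  note [measurable] = v'(1)
  define v0 where "v0 = (\<lambda>t. ennreal (1 / lam) * v' t)"
  have v0m [measurable]: "v0 \<in> borel_measurable borel" unfolding v0_def by measurable
  have v0z: "v0 t = 0" if "t \<le> 0" for t using v'(2)[OF that] by (simp add: v0_def)
  have ll: "ennreal lam * ennreal (1 / lam) = 1" using lam by (simp add: ennreal_mult[symmetric])
  have i0: "ennreal (u t) + ennreal lam * conv v0 (indicator {0..}) t = 1" if "0 \<le> t" for t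
  proof -
    have "ennreal lam * conv v0 (indicator {0..}) t = (ennreal lam * ennreal (1 / lam)) * conv v' (indicator {0..}) t"
      unfolding v0_def by (subst conv_cmult_left) (auto simp: mult.assoc)
    also have "\<dots> = ennreal (1 - u t)" using v'(3)[OF that] u0 by (simp add: ll)
    finally show ?thesis using unn[OF that] u1[OF that] by (simp add: ennreal_plus[symmetric] del: ennreal_plus)
  qed
  \<comment> \<open>The transform of u + \<open>lam\<close> v0 * 1 = 1 is solved for that of
    \<open>v0\<close>; finiteness must come first, as nothing can be subtracted from
    infinity.\<close>
  have lv0: "laplace v0 s = ennreal (1 / (lam + f s))" if s: "s > 0" for s
  proof -
    have "laplace (\<lambda>t. ennreal (u t) * indicator {0..} t + ennreal lam * conv v0 (indicator {0..}) t) s = laplace (indicator {0..}) s"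
    proof (rule arg_cong[where f="\<lambda>h. laplace h s"], rule ext)
      fix t :: real
      show "ennreal (u t) * indicator {0..} t + ennreal lam * conv v0 (indicator {0..}) t = indicator {0..} t"
      proof (cases "0 \<le> t")
        case False
        then have "conv v0 (indicator {0..}) t = 0" by (intro conv_neg_eq_0) (auto simp: v0z)
        then show ?thesis using False by simp
      qed (use i0 in auto)
    qed
    then have *: "ennreal (f s / (s * (lam + f s))) + ennreal lam * (laplace v0 s * ennreal (1 / s)) = ennreal (1 / s)"
      by (subst (asm) laplace_add) (auto simp: laplace_cmult laplace_conv lap[OF s] laplace_indicator[OF s] f_def)
    then have fin: "laplace v0 s \<noteq> top"
      using lam s by (auto simp: ennreal_top_mult ennreal_mult_top)
    then obtain r where r: "laplace v0 s = ennreal r" "r \<ge> 0" by (cases "laplace v0 s") auto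
    have "ennreal (lam * (r * (1 / s))) = ennreal lam * ennreal (r * (1 / s))"
      by (rule ennreal_mult) (use lam r s in auto)
    also have "ennreal (r * (1 / s)) = ennreal r * ennreal (1 / s)"
      by (rule ennreal_mult) (use r s in auto)
    finally have p: "ennreal (lam * (r * (1 / s))) = ennreal lam * (ennreal r * ennreal (1 / s))" .
    have "ennreal (f s / (s * (lam + f s)) + lam * (r * (1 / s)))
      = ennreal (f s / (s * (lam + f s))) + ennreal (lam * (r * (1 / s)))"
      by (rule ennreal_plus) (use s lam fnn[OF s] r in auto)
    with * have "ennreal (f s / (s * (lam + f s)) + lam * (r * (1 / s))) = ennreal (1 / s)"
      unfolding p r by simp
    then have "f s / (s * (lam + f s)) + lam * (r * (1 / s)) = 1 / s"
      using s lam fnn[OF s] r(2) by (subst (asm) ennreal_inj) auto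
    moreover define q where "q = lam + f s"
    moreover have q: "q > 0" using lam fnn[OF s] by (simp add: q_def)
    ultimately have "(q - lam) / (s * q) + lam * (r * (1 / s)) = 1 / s" by simp
    then have "lam * (r * q) = lam * 1" using s q by (simp add: field_simps)
    then have "r * q = 1" unfolding mult_cancel_left using lam by simp
    then have "r = 1 / (lam + f s)" using q by (simp add: q_def field_simps)
    then show ?thesis using r by simp
  qed
  have ii0: "AE t in lborel. ennreal b * v0 t + conv v0 K t = ennreal (u t) * indicator {0..} t"
  proof (rule laplace_unique_AE)
    show "(\<lambda>t. ennreal b * v0 t + conv v0 K t) \<in> borel_measurable borel" by measurable
    fix t :: real assume t: "t < 0"
    have "conv v0 K t = 0" by (rule conv_neg_eq_0) (use t in \<open>auto simp: v0z K_def levy_tail'_def\<close>)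
    then show "ennreal b * v0 t + conv v0 K t = 0" using t by (simp add: v0z)
  next
    fix s :: real assume s: "s > 0"
    have A: "laplace (\<lambda>t. ennreal b * v0 t + conv v0 K t) s = laplace v0 s * (ennreal b + laplace K s)"
      by (subst laplace_add) (auto simp: laplace_cmult laplace_conv distrib_left mult.commute)
    have B: "ennreal b + laplace K s = ennreal (f s / s)"
    proof -
      have "ennreal s * (ennreal b + laplace K s) = ennreal s * ennreal (f s / s)"
        using laplace_levy_tail'[OF b \<nu> s] s fnn[OF s] by (simp add: K_def f_def ennreal_mult[symmetric])
      then show ?thesis using s by (auto simp: ennreal_mult_cancel_left)
    qed
    have C: "laplace (\<lambda>t. ennreal b * v0 t + conv v0 K t) s = ennreal (1 / (lam + f s) * (f s / s))"
      unfolding A B lv0[OF s] using s lam fnn[OF s] by (intro ennreal_mult[symmetric]) auto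
    show "laplace (\<lambda>t. ennreal b * v0 t + conv v0 K t) s = laplace (\<lambda>t. ennreal (u t) * indicator {0..} t) s"
      unfolding C lap[OF s] f_def by (simp add: mult.commute)
    show "laplace (\<lambda>t. ennreal b * v0 t + conv v0 K t) s < \<infinity>" unfolding C by simp
  qed (use um in auto)
  show thesis
  proof (cases "b = 0")
    case True
    \<comment> \<open>Adding \<open>lam\<close> times the step function replaces the right-hand side
      u by the constant 1, since u + \<open>lam\<close> v0 * 1 = 1. This is the form required by the
      first passage lemma, with killing rate \<open>lam\<close>.\<close>
    define K' where "K' = (\<lambda>t. ennreal lam * indicator {0..} t + levy_tail' \<nu> t)"
    have K': "conv v0 K' t = ennreal lam * conv v0 (indicator {0..}) t + conv v0 K t" for t
      unfolding K'_def K_def[symmetric] by (subst conv_add_right) (auto simp: conv_cmult_right)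
    have AEK: "AE t in lborel. 0 < t \<longrightarrow> conv v0 K' t = 1"
      using ii0
    proof eventually_elim
      fix t assume t: "ennreal b * v0 t + conv v0 K t = ennreal (u t) * indicator {0..} t"
      show "0 < t \<longrightarrow> conv v0 K' t = 1"
        using t i0[of t] True by (auto simp: K' add.commute)
    qed
    have all: "conv v0 K' t = 1" if "t > 0" for t
      by (rule conv_levy_tail'_eq_1[OF \<nu> v0m v0z lam K'_def AEK that])
    show thesis
    proof (rule that[OF v0m v0z i0])
      fix t :: real assume t: "0 < t"
      have "ennreal lam * conv v0 (indicator {0..}) t + conv v0 K t = ennreal lam * conv v0 (indicator {0..}) t + ennreal (u t)"
        using all[OF t] i0[of t] t by (simp add: K' add.commute)
      moreover have "ennreal lam * conv v0 (indicator {0..}) t \<noteq> top"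
        using i0[of t] t by auto
      ultimately show "ennreal b * v0 t + conv v0 K t = ennreal (u t)"
        using True by (auto simp: ennreal_add_left_cancel)
    qed (use lv0 in \<open>auto simp: f_def\<close>)
  next
    case False
    then have b0: "b > 0" using b by simp
    \<comment> \<open>The equation and u \<le> 1 give b v0 \<le> 1 almost everywhere, so the
      truncation at 1/b changes a null set only and makes the convolution with K continuous.\<close>
    define v1 where "v1 = (\<lambda>t. min (v0 t) (ennreal (1 / b)))"
    have v1m [measurable]: "v1 \<in> borel_measurable borel" unfolding v1_def by measurable
    have v1z: "v1 t = 0" if "t \<le> 0" for t using v0z[OF that] by (simp add: v1_def)
    have bb: "ennreal (1 / b) * ennreal b = 1" using b0 by (simp add: ennreal_mult[symmetric])
    have bdiv: "x = ennreal (1 / b) * y" if "ennreal b * x = y" for x y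
      unfolding that[symmetric] mult.assoc[symmetric] bb by simp
    have AE1: "AE t in lborel. v0 t = v1 t"
      using ii0
    proof eventually_elim
      fix t assume t: "ennreal b * v0 t + conv v0 K t = ennreal (u t) * indicator {0..} t"
      show "v0 t = v1 t"
      proof (cases "t \<le> 0")
        case False
        have "ennreal b * v0 t \<le> ennreal b * v0 t + conv v0 K t" by simp
        also have "\<dots> \<le> 1" unfolding t using False u1[of t] by simp
        finally have "ennreal (1 / b) * (ennreal b * v0 t) \<le> ennreal (1 / b) * 1" by (rule mult_left_mono) simp
        then have "v0 t \<le> ennreal (1 / b)" unfolding mult.assoc[symmetric] bb by simp
        then show ?thesis by (simp add: v1_def min_def)
      qed (simp add: v0z v1z)
    qed
    have cv: "conv v0 K t = conv v1 K t" for t by (rule conv_cong_AE_left[OF AE1])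
    note c1 = conv_levy_tail'_continuous[OF \<nu> v1m, of "1 / b", folded K_def]
    have c1c: "continuous_on {0..} (\<lambda>t. enn2real (conv v1 K t))" by (rule c1) (simp_all add: v0z v1_def)
    have c1f: "conv v1 K t < \<infinity>" for t by (rule c1) (simp_all add: v0z v1_def)
    \<comment> \<open>An inequality between continuous functions, hence valid everywhere; it makes
      the subtraction in the definition of v below reversible.\<close>
    have le: "conv v1 K t \<le> ennreal (u t)" if "0 \<le> t" for t
    proof -
      have "enn2real (conv v1 K t) \<le> u t"
      proof (rule AE_lborel_le_imp_le[OF c1c ucont _ that])
        show "AE t in lborel. 0 < t \<longrightarrow> enn2real (conv v1 K t) \<le> u t"
          using ii0
        proof eventually_elim
          fix t assume t: "ennreal b * v0 t + conv v0 K t = ennreal (u t) * indicator {0..} t"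
          show "0 < t \<longrightarrow> enn2real (conv v1 K t) \<le> u t"
          proof
            assume "0 < t"
            then have "conv v1 K t \<le> ennreal (u t)"
              using t unfolding cv by (metis add.commute atLeast_iff indicator_simps(1) le_iff_add less_imp_le mult.right_neutral)
            then show "enn2real (conv v1 K t) \<le> u t"
              using \<open>0 < t\<close> unn[of t] by (intro enn2real_leI) auto
          qed
        qed
      qed
      then have "ennreal (enn2real (conv v1 K t)) \<le> ennreal (u t)" by (rule ennreal_leI)
      then show ?thesis using c1f[of t] by simp
    qed
    \<comment> \<open>The equation solved for v at each t > 0. This changes \<open>v0\<close> on a
      null set only, so no convolution is affected.\<close>
    define v where "v = (\<lambda>t. ennreal (1 / b) * ((ennreal (u t) * indicator {0..} t - conv v1 K t) * indicator {0<..} t))"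
    have vm [measurable]: "v \<in> borel_measurable borel" unfolding v_def by measurable
    have AEv: "AE t in lborel. v0 t = v t"
      using ii0
    proof eventually_elim
      fix t assume t: "ennreal b * v0 t + conv v0 K t = ennreal (u t) * indicator {0..} t"
      show "v0 t = v t"
      proof (cases "t \<le> 0")
        case False
        have "ennreal b * v0 t = ennreal (u t) * indicator {0..} t - conv v1 K t"
          unfolding t[symmetric] cv using c1f[of t] by (intro ennreal_add_diff_cancel_right[symmetric]) auto
        from bdiv[OF this] show ?thesis using False by (simp add: v_def)
      qed (simp add: v0z v_def)
    qed
    have cvv: "conv v h t = conv v0 h t" for h t by (rule conv_cong_AE_left[OF AEv, symmetric])
    show thesis
    proof (rule that[OF vm])
      show "v t = 0" if "t \<le> 0" for t using that by (simp add: v_def)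
      show "ennreal (u t) + ennreal lam * conv v (indicator {0..}) t = 1" if "0 \<le> t" for t
        unfolding cvv by (rule i0[OF that])
      show "laplace v s = ennreal (1 / (lam + bernstein_fun b \<nu> s))" if "s > 0" for s
        using lv0[OF that] laplace_cong_AE[OF AEv, of s] by (simp add: f_def)
      fix t :: real assume t: "0 < t"
      have "ennreal b * v t = (ennreal (1 / b) * ennreal b) * (ennreal (u t) - conv v1 K t)"
        using t by (simp only: v_def mult_ac) (simp add: mult_ac)
      then have "ennreal b * v t = ennreal (u t) - conv v1 K t" unfolding bb by simp
      then show "ennreal b * v t + conv v K t = ennreal (u t)"
        unfolding cvv cv using le[of t] t by (simp add: diff_add_cancel_ennreal)
    qed
  qed
qed

section \<open>Caputo--Djrbashian derivatives of convolution powers\<close>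

text \<open>Lebesgue differentiation identifies the inner derivative with d(t - s) for almost every
  s, and the integral ignores the rest. The drift term needs the derivative at the point t itself,
  which continuity of d supplies.\<close>

lemma has_gen_CD_derivativeI:
  fixes u d :: "real \<Rightarrow> real"
  assumes \<nu>: "levy_measure \<nu>" and ac: "abs_continuous_halfline u"
    and dm [measurable]: "d \<in> borel_measurable borel"
    and dint: "\<And>T. set_integrable lborel {0..T} d"
    and u: "\<And>t. 0 \<le> t \<Longrightarrow> u t = u 0 + (LINT s:{0..t}|lborel. d s)"
    and cont: "b \<noteq> 0 \<Longrightarrow> isCont d t" and t: "0 < t"
    and kint: "set_integrable lborel {0..t} (\<lambda>s. d (t - s) * enn2real (levy_tail' \<nu> s))"
    and val: "val = b * d t + (LINT s:{0..t}|lborel. d (t - s) * enn2real (levy_tail' \<nu> s))"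
  shows "has_gen_CD_derivative b \<nu> u val t"
proof -
  note [measurable] = levy_tail'_measurable[OF \<nu>]
  have hk: "d integrable_on {0..T}" "integral {0..T} d = (LINT s:{0..T}|lborel. d s)" for T
    using set_borel_integral_eq_integral[OF dint[of T]] by auto
  have u_eq: "u x = u 0 + integral {0..x} d" if "0 \<le> x" for x
    using u[OF that] hk(2) by simp
  have deriv_u: "(u has_real_derivative D) (at x)"
    if D: "((\<lambda>t. integral {0..t} d) has_real_derivative D) (at x)" and x: "0 < x" for D x
  proof -
    have D': "((\<lambda>t. u 0 + integral {0..t} d) has_real_derivative D) (at x)"
      using DERIV_add[OF DERIV_const[of "u 0"] D] by simp
    show ?thesis
    proof (rule has_field_derivative_transform_within_open[OF D', of "{0<..}"])
      fix y :: real assume "y \<in> {0<..}"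
      then show "u 0 + integral {0..y} d = u y" by (intro u_eq[symmetric]) simp
    qed (use x in simp_all)
  qed
  have "negligible {x\<in>{0<..<t}. \<not> ((\<lambda>t. integral {0..t} d) has_real_derivative d x) (at x)}"
    by (rule lebesgue_differentiation[OF hk(1)])
  then have "AE x in lebesgue. x \<notin> {x\<in>{0<..<t}. \<not> ((\<lambda>t. integral {0..t} d) has_real_derivative d x) (at x)}"
    unfolding negligible_iff_null_sets by (rule AE_not_in)
  then have "AE x in lborel. x \<notin> {x\<in>{0<..<t}. \<not> ((\<lambda>t. integral {0..t} d) has_real_derivative d x) (at x)}"
    by (simp only: AE_completion_iff)
  then have "AE x in lborel. 0 < x \<and> x < t \<longrightarrow> (u has_real_derivative d x) (at x)"
  proof eventually_elim
    fix x assume x: "x \<notin> {x\<in>{0<..<t}. \<not> ((\<lambda>t. integral {0..t} d) has_real_derivative d x) (at x)}"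
    show "0 < x \<and> x < t \<longrightarrow> (u has_real_derivative d x) (at x)"
    proof
      assume x': "0 < x \<and> x < t"
      then have "((\<lambda>t. integral {0..t} d) has_real_derivative d x) (at x)" using x by simp
      then show "(u has_real_derivative d x) (at x)" using x' by (intro deriv_u) auto
    qed
  qed
  from AE_lborel_reflect[OF this, of t]
  have AE1: "AE s in lborel. 0 < s \<and> s < t \<longrightarrow> (u has_real_derivative d (t - s)) (at (t - s))"
    by eventually_elim auto
  \<comment> \<open>The endpoints are excluded on purpose: at s = 0 the two versions of the tail may
    differ, and at s = t the derivative would involve u at negative times, where nothing is
    known.\<close>
  have AE2: "AE s in lborel. s \<in> {0..t} \<longrightarrow>
    deriv (\<lambda>r. u (r - s)) t * levy_tail \<nu> s = d (t - s) * enn2real (levy_tail' \<nu> s)"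
    using AE1 AE_lborel_singleton[of 0] AE_lborel_singleton[of t]
  proof eventually_elim
    fix s :: real
    assume s: "0 < s \<and> s < t \<longrightarrow> (u has_real_derivative d (t - s)) (at (t - s))" "s \<noteq> 0" "s \<noteq> t"
    show "s \<in> {0..t} \<longrightarrow> deriv (\<lambda>r. u (r - s)) t * levy_tail \<nu> s = d (t - s) * enn2real (levy_tail' \<nu> s)"
    proof
      assume "s \<in> {0..t}"
      then have s': "0 < s" "s < t" using s by auto
      then have "(u has_real_derivative d (t - s)) (at (t + (- s)))" using s by simp
      then have "((\<lambda>r. u (r + (- s))) has_real_derivative d (t - s)) (at t)"
        unfolding DERIV_shift .
      then have "deriv (\<lambda>r. u (r - s)) t = d (t - s)" by (simp add: DERIV_imp_deriv)
      moreover have "enn2real (levy_tail' \<nu> s) = levy_tail \<nu> s"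
        unfolding levy_tail'_eq_levy_tail[OF \<nu> s'(1)] by (simp add: levy_tail_def)
      ultimately show "deriv (\<lambda>r. u (r - s)) t * levy_tail \<nu> s = d (t - s) * enn2real (levy_tail' \<nu> s)" by simp
    qed
  qed
  then obtain Z where Z: "Z \<in> null_sets lborel" "{s \<in> space lborel. \<not> (s \<in> {0..t} \<longrightarrow>
    deriv (\<lambda>r. u (r - s)) t * levy_tail \<nu> s = d (t - s) * enn2real (levy_tail' \<nu> s))} \<subseteq> Z"
    unfolding eventually_ae_filter by blast
  have negZ: "negligible Z"
    using Z(1) unfolding negligible_iff_null_sets by (rule null_sets_completionI)
  have eq: "deriv (\<lambda>r. u (r - s)) t * levy_tail \<nu> s = d (t - s) * enn2real (levy_tail' \<nu> s)" if "s \<in> {0..t} - Z" for s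
    using Z(2) that by auto
  have kint': "set_integrable lebesgue {0..t} (\<lambda>s. d (t - s) * enn2real (levy_tail' \<nu> s))"
    using kint unfolding set_integrable_def by (subst integrable_completion) auto
  have i1: "set_integrable lebesgue {0..t} (\<lambda>s. deriv (\<lambda>r. u (r - s)) t * levy_tail \<nu> s)"
    by (rule absolutely_integrable_spike[OF kint' negZ eq])
  have "(LINT s:{0..t}|lebesgue. deriv (\<lambda>r. u (r - s)) t * levy_tail \<nu> s) = integral {0..t} (\<lambda>s. deriv (\<lambda>r. u (r - s)) t * levy_tail \<nu> s)"
    by (rule set_lebesgue_integral_eq_integral(2)[OF i1])
  also have "\<dots> = integral {0..t} (\<lambda>s. d (t - s) * enn2real (levy_tail' \<nu> s))"
    by (rule integral_spike[OF negZ]) (use eq in auto)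
  also have "\<dots> = (LINT s:{0..t}|lborel. d (t - s) * enn2real (levy_tail' \<nu> s))"
    by (rule set_borel_integral_eq_integral(2)[OF kint, symmetric])
  finally have i2: "(LINT s:{0..t}|lebesgue. deriv (\<lambda>r. u (r - s)) t * levy_tail \<nu> s)
    = (LINT s:{0..t}|lborel. d (t - s) * enn2real (levy_tail' \<nu> s))" .
  have du: "(u has_real_derivative d t) (at t)" if "b \<noteq> 0"
  proof (rule deriv_u[OF _ t])
    have "((\<lambda>x. integral {0..x} d) has_vector_derivative d t) (at t within {0..t + 1} - {})"
      by (rule integral_has_vector_derivative_continuous_at)
        (use hk(1) t continuous_at_imp_continuous_within[OF cont[OF that]] in simp_all)
    then have "((\<lambda>x. integral {0..x} d) has_vector_derivative d t) (at t)"
      using t by (simp add: at_within_Icc_at)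
    then show "((\<lambda>x. integral {0..x} d) has_real_derivative d t) (at t)"
      by (simp add: has_real_derivative_iff_has_vector_derivative)
  qed
  have "b * deriv u t = b * d t"
    using du by (cases "b = 0") (auto simp: DERIV_imp_deriv)
  then show ?thesis
    unfolding has_gen_CD_derivative_def i2 val
  proof (intro conjI impI)
    show "u differentiable (at t)" if "b \<noteq> 0"
      using du[OF that] real_differentiable_def by blast
  qed (use ac i1 in auto)
qed

lemma set_integral_lborel_singleton: "(LINT s:{x}|lborel. h s) = (0::real)" for x :: real
proof -
  have "AE s in lborel. indicator {x} s *\<^sub>R h s = 0"
    using AE_lborel_singleton[of x] by eventually_elim auto
  then show ?thesis unfolding set_lebesgue_integral_def by (rule integral_eq_zero_AE)
qed

section \<open>Convolution powers of the potential density\<close>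

locale potential_density =
  fixes b lam :: real and \<nu> :: "real measure" and u :: "real \<Rightarrow> real" and v :: "real \<Rightarrow> ennreal"
  assumes b: "b \<ge> 0" and \<nu>: "levy_measure \<nu>" and lam: "lam > 0"
    and u_meas: "(\<lambda>t. ennreal (u t) * indicator {0..} t) \<in> borel_measurable borel"
    and v [measurable]: "v \<in> borel_measurable borel" and v0: "\<And>t. t \<le> 0 \<Longrightarrow> v t = 0"
    and u_v: "\<And>t. 0 \<le> t \<Longrightarrow> ennreal (u t) + ennreal lam * conv v (indicator {0..}) t = 1"
    and v_eq: "\<And>t. 0 < t \<Longrightarrow> ennreal b * v t + conv v (levy_tail' \<nu>) t = ennreal (u t)"
    and lap_u: "\<And>s. s > 0 \<Longrightarrow> laplace (\<lambda>t. ennreal (u t) * indicator {0..} t) s =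
      ennreal (bernstein_fun b \<nu> s / (s * (lam + bernstein_fun b \<nu> s)))"
    and lap_v: "\<And>s. s > 0 \<Longrightarrow> laplace v s = ennreal (1 / (lam + bernstein_fun b \<nu> s))"
begin

text \<open>There are l + 1 factors v, so the transform is \<open>lam\<close>^l /
  (\<open>lam\<close> + f(s))^(l + 1). In the renewal picture, \<open>lam\<close> times
  \<open>w l\<close> is the density of the time of the (l + 1)-st event of N_f.\<close>

primrec w :: "nat \<Rightarrow> real \<Rightarrow> ennreal" where
  "w 0 = v"
| "w (Suc l) = (\<lambda>t. ennreal lam * conv v (w l) t)"

text \<open>Defined by the renewal recursion alone; the link with the probabilities of N_f is made
  later by comparing transforms.\<close>

primrec g :: "nat \<Rightarrow> real \<Rightarrow> ennreal" where
  "g 0 = (\<lambda>t. ennreal (u t) * indicator {0..} t)"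
| "g (Suc l) = (\<lambda>t. ennreal lam * conv v (g l) t)"

abbreviation K :: "real \<Rightarrow> ennreal" where "K \<equiv> levy_tail' \<nu>"

abbreviation step :: "real \<Rightarrow> ennreal" where "step \<equiv> indicator {0..}"

lemma K_measurable [measurable]: "K \<in> borel_measurable borel"
  by (rule levy_tail'_measurable[OF \<nu>])

lemma w_measurable [measurable]: "w l \<in> borel_measurable borel"
  by (induction l) (auto intro!: borel_measurable_times conv_measurable)

lemma g_measurable [measurable]: "g l \<in> borel_measurable borel"
proof (induction l)
  case 0
  show ?case using u_meas by simp
qed (auto intro!: borel_measurable_times conv_measurable)

lemma w_nonpos: "t \<le> 0 \<Longrightarrow> w l t = 0"
proof (induction l arbitrary: t)
  case (Suc l)
  have "v x * w l (t - x) = 0" for x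
    using Suc v0[of x] by (cases "x \<le> 0") auto
  then have "conv v (w l) t = (\<integral>\<^sup>+ x. 0 \<partial>(lborel :: real measure))"
    unfolding conv_def by (intro nn_integral_cong)
  then show ?case by simp
qed (simp add: v0)

lemma g_neg: "t < 0 \<Longrightarrow> g l t = 0"
proof (induction l arbitrary: t)
  case (Suc l)
  have "conv v (g l) t = 0"
    by (rule conv_neg_eq_0) (use Suc v0 in auto)
  then show ?case by simp
qed simp

text \<open>For each l the equation can fail on the half-line only at time 0. Convolution with
  \<open>v\<close> ignores that single point, so validity at every positive time propagates from l
  to l + 1.\<close>

lemma w_eq: "0 < t \<Longrightarrow> ennreal b * w l t + conv (w l) K t = g l t"
proof (induction l arbitrary: t)
  case 0
  then show ?case using v_eq by simp
next
  case (Suc l)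
  have "AE y in lborel. y \<noteq> (0::real)" by (rule AE_lborel_singleton)
  then have AE: "AE y in lborel. ennreal b * w l y + conv (w l) K y = g l y"
  proof eventually_elim
    fix y :: real assume "y \<noteq> 0"
    show "ennreal b * w l y + conv (w l) K y = g l y"
    proof (cases "0 < y")
      case False
      then have "y < 0" using \<open>y \<noteq> 0\<close> by simp
      moreover from this have "conv (w l) K y = 0"
        by (intro conv_neg_eq_0) (auto simp: w_nonpos levy_tail'_def)
      ultimately show ?thesis by (simp add: w_nonpos g_neg)
    qed (rule Suc.IH)
  qed
  have "g (Suc l) t = ennreal lam * conv v (\<lambda>y. ennreal b * w l y + conv (w l) K y) t"
    using conv_cong_AE_right[OF AE, of v t] by simp
  also have "conv v (\<lambda>y. ennreal b * w l y + conv (w l) K y) t = ennreal b * conv v (w l) t + conv (conv v (w l)) K t"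
    by (subst conv_add_right) (auto simp: conv_cmult_right conv_assoc)
  finally show ?case
    by (simp add: distrib_left conv_cmult_left mult.left_commute)
qed

lemma g_step_0: "g 0 t + ennreal lam * conv (w 0) step t = step t"
proof (cases "0 \<le> t")
  case False
  then have "conv v step t = 0" by (intro conv_neg_eq_0) (auto simp: v0)
  then show ?thesis using False by simp
qed (use u_v in auto)

lemma conv_v_w_step:
  "conv v (\<lambda>t. ennreal lam * conv (w l) step t) t = conv (w (Suc l)) step t"
proof -
  have "conv v (\<lambda>t. ennreal lam * conv (w l) step t) t = ennreal lam * conv v (conv (w l) step) t"
    by (rule conv_cmult_right) measurable
  also have "conv v (conv (w l) step) = conv (conv v (w l)) step"
    by (rule conv_assoc[symmetric]) measurable
  also have "ennreal lam * conv (conv v (w l)) step t = conv (w (Suc l)) step t"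
    unfolding w.simps by (rule conv_cmult_left[symmetric]) measurable
  finally show ?thesis .
qed

text \<open>The integrated forward equation of the renewal process, written additively to avoid
  subtraction in \<open>ennreal\<close>. It is \<open>g_step_0\<close> convolved repeatedly with
  \<open>v\<close>.\<close>

lemma g_step_Suc: "g (Suc l) t + ennreal lam * conv (w (Suc l)) step t = ennreal lam * conv (w l) step t"
proof (induction l arbitrary: t)
  case 0
  have "conv v (g 0) t + conv (w (Suc 0)) step t = conv v (\<lambda>t. g 0 t + ennreal lam * conv (w 0) step t) t"
    unfolding conv_v_w_step[symmetric] by (rule conv_add_right[symmetric]) measurable
  also have "\<dots> = conv v step t" unfolding g_step_0 ..
  finally have "ennreal lam * (conv v (g 0) t + conv (w (Suc 0)) step t) = ennreal lam * conv (w 0) step t"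
    by (simp only: w.simps(1))
  then show ?case unfolding distrib_left g.simps(2)[of 0] .
next
  case (Suc l)
  have "conv v (g (Suc l)) t + conv (w (Suc (Suc l))) step t
      = conv v (\<lambda>t. g (Suc l) t + ennreal lam * conv (w (Suc l)) step t) t"
    unfolding conv_v_w_step[symmetric] by (rule conv_add_right[symmetric]) measurable
  also have "\<dots> = conv (w (Suc l)) step t" unfolding Suc.IH by (rule conv_v_w_step)
  finally have "ennreal lam * (conv v (g (Suc l)) t + conv (w (Suc (Suc l))) step t) = ennreal lam * conv (w (Suc l)) step t"
    by (rule arg_cong)
  then show ?case unfolding distrib_left g.simps(2)[of "Suc l"] .
qed

text \<open>The left-hand side plays the role of the probability that N_f(t) > l: it decreases in l
  because consecutive values differ by \<open>g (Suc l) t\<close>.\<close>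

lemma w_step_le_1: "ennreal lam * conv (w l) step t \<le> 1"
proof (induction l)
  case 0
  have "ennreal lam * conv (w 0) step t \<le> g 0 t + ennreal lam * conv (w 0) step t" by simp
  also have "\<dots> \<le> 1" unfolding g_step_0 by (simp split: split_indicator)
  finally show ?case .
next
  case (Suc l)
  have "ennreal lam * conv (w (Suc l)) step t \<le> g (Suc l) t + ennreal lam * conv (w (Suc l)) step t"
    by (simp del: g.simps w.simps)
  also have "\<dots> \<le> 1" unfolding g_step_Suc by (rule Suc)
  finally show ?case .
qed

lemma w_step_finite: "conv (w l) step t < \<infinity>"
  using w_step_le_1[of l t] lam by (cases "conv (w l) step t") (auto simp: ennreal_mult_top top_unique)

lemma g_le_1: "g l t \<le> 1"
proof (cases l)
  case 0
  have "g 0 t \<le> g 0 t + ennreal lam * conv (w 0) step t" by simp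
  also have "\<dots> \<le> 1" unfolding g_step_0 by (simp split: split_indicator)
  finally show ?thesis unfolding 0 .
next
  case (Suc m)
  have "g (Suc m) t \<le> g (Suc m) t + ennreal lam * conv (w (Suc m)) step t"
    by (simp del: g.simps w.simps)
  also have "\<dots> \<le> 1" unfolding g_step_Suc by (rule w_step_le_1)
  finally show ?thesis unfolding Suc .
qed

lemma g_finite: "g l t \<noteq> top"
  using g_le_1[of l t] by (auto simp: top_unique)

lemma laplace_g:
  assumes s: "s > 0"
  defines "f \<equiv> bernstein_fun b \<nu> s"
  shows "laplace (g l) s = ennreal (lam ^ l * (f / (s * (lam + f) ^ Suc l)))"
proof (induction l)
  case 0
  then show ?case using lap_u[OF s] by (simp add: f_def)
next
  case (Suc l)
  have f0: "0 \<le> f" unfolding f_def by (rule bernstein_fun_nonneg[OF b \<nu> s])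
  have "laplace (g (Suc l)) s = ennreal lam * (laplace v s * laplace (g l) s)"
    unfolding g.simps by (subst laplace_cmult) (auto simp: laplace_conv)
  also have "\<dots> = ennreal lam * ennreal (1 / (lam + f) * (lam ^ l * (f / (s * (lam + f) ^ Suc l))))"
    unfolding Suc lap_v[OF s] f_def[symmetric] using f0 lam s by (subst ennreal_mult) auto
  also have "\<dots> = ennreal (lam * (1 / (lam + f) * (lam ^ l * (f / (s * (lam + f) ^ Suc l)))))"
    by (rule ennreal_mult[symmetric]) (use f0 lam s in auto)
  also have "lam * (1 / (lam + f) * (lam ^ l * (f / (s * (lam + f) ^ Suc l)))) = lam ^ Suc l * (f / (s * (lam + f) ^ Suc (Suc l)))"
    by (simp add: mult_ac)
  finally show ?case .
qed

text \<open>Real versions. For \<open>wr\<close> the default value of \<open>enn2real\<close> at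
  infinity matters on a null set only, for \<open>hr\<close> at positive times and for
  \<open>gr\<close> it never occurs.\<close>

definition gr :: "nat \<Rightarrow> real \<Rightarrow> real" where "gr l t = enn2real (g l t)"
definition wr :: "nat \<Rightarrow> real \<Rightarrow> real" where "wr l t = enn2real (w l t)"
definition hr :: "nat \<Rightarrow> real \<Rightarrow> real" where "hr l t = enn2real (conv (w l) K t)"

lemma wr_measurable [measurable]: "wr l \<in> borel_measurable borel"
  unfolding wr_def by measurable

lemma g_eq_gr: "g l t = ennreal (gr l t)"
  unfolding gr_def using g_finite[of l t] by (simp add: less_top)

lemma AE_w_finite: "AE x in lborel. w l x \<noteq> top"
proof -
  have "AE x in lborel. w l x * indicator {..real n} x \<noteq> \<infinity>" for n
  proof (rule nn_integral_PInf_AE)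
    have "(\<integral>\<^sup>+ x. w l x * indicator {..real n} x \<partial>lborel) = conv (w l) step (real n)"
      unfolding conv_def by (intro nn_integral_cong) (auto split: split_indicator)
    then show "(\<integral>\<^sup>+ x. w l x * indicator {..real n} x \<partial>lborel) \<noteq> \<infinity>"
      using w_step_finite[of l "real n"] by simp
  qed measurable
  then have "AE x in lborel. \<forall>n. w l x * indicator {..real n} x \<noteq> \<infinity>"
    by (simp add: AE_all_countable)
  then show ?thesis
  proof eventually_elim
    fix x assume x: "\<forall>n. w l x * indicator {..real n} x \<noteq> \<infinity>"
    obtain n :: nat where "x \<le> real n" using real_arch_simple by blast
    then show "w l x \<noteq> top" using x[rule_format, of n] by simp
  qed
qed

lemma wr_integral:
  shows "set_integrable lborel {0..t} (wr l)"
    and "(LINT s:{0..t}|lborel. wr l s) = enn2real (conv (w l) step t)"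
proof -
  have eq: "(\<integral>\<^sup>+ x. ennreal (indicator {0..t} x * wr l x) \<partial>lborel) = conv (w l) step t"
    unfolding conv_def
  proof (rule nn_integral_cong_AE)
    show "AE x in lborel. ennreal (indicator {0..t} x * wr l x) = w l x * step (t - x)"
      using AE_w_finite[of l]
      by eventually_elim (auto simp: wr_def less_top w_nonpos split: split_indicator)
  qed
  show "set_integrable lborel {0..t} (wr l)"
    unfolding set_integrable_def
  proof (rule integrableI_bounded)
    have "(\<integral>\<^sup>+ x. ennreal (norm (indicator {0..t} x *\<^sub>R wr l x)) \<partial>lborel) = conv (w l) step t"
      unfolding eq[symmetric] by (intro nn_integral_cong) (auto simp: wr_def split: split_indicator)
    then show "(\<integral>\<^sup>+ x. ennreal (norm (indicator {0..t} x *\<^sub>R wr l x)) \<partial>lborel) < \<infinity>"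
      using w_step_finite[of l t] by simp
  qed measurable
  show "(LINT s:{0..t}|lborel. wr l s) = enn2real (conv (w l) step t)"
    unfolding set_lebesgue_integral_def eq[symmetric]
    by (subst integral_eq_nn_integral) (auto simp: wr_def)
qed

text \<open>Index shift with the value 0 before the first index, so that l = 0 needs no separate
  treatment in sums.\<close>

definition prev :: "(nat \<Rightarrow> real \<Rightarrow> real) \<Rightarrow> nat \<Rightarrow> real \<Rightarrow> real" where
  "prev h l t = (case l of 0 \<Rightarrow> 0 | Suc m \<Rightarrow> h m t)"

lemma prev_simps [simp]: "prev h 0 = (\<lambda>_. 0)" "prev h (Suc m) = h m"
  by (auto simp: prev_def)

lemma gr_eq_integral:
  assumes t: "0 \<le> t"
  shows "gr l t = (if l = 0 then 1 else 0) + lam * ((LINT s:{0..t}|lborel. prev wr l s) - (LINT s:{0..t}|lborel. wr l s))"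
proof (cases l)
  case 0
  define c where "c = enn2real (conv (w 0) step t)"
  have c: "conv (w 0) step t = ennreal c" "c \<ge> 0"
    unfolding c_def using w_step_finite[of 0 t] by (auto simp del: w.simps)
  have "ennreal (gr 0 t) + ennreal lam * ennreal c = 1"
    using g_step_0[of t] t unfolding g_eq_gr c by simp
  then have "ennreal (gr 0 t + lam * c) = ennreal 1"
    using lam c(2) by (simp add: ennreal_mult gr_def)
  then have "gr 0 t + lam * c = 1"
    using lam c(2) by (subst (asm) ennreal_inj) (auto simp: gr_def)
  then show ?thesis unfolding 0 wr_integral c_def[symmetric] by (simp add: set_lebesgue_integral_def)
next
  case (Suc m)
  define c where "c = (\<lambda>l. enn2real (conv (w l) step t))"
  have c: "conv (w l) step t = ennreal (c l)" "c l \<ge> 0" for l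
    unfolding c_def using w_step_finite[of l t] by (auto simp del: w.simps)
  have "ennreal (gr (Suc m) t) + ennreal lam * ennreal (c (Suc m)) = ennreal lam * ennreal (c m)"
    using g_step_Suc[of m t] unfolding g_eq_gr c .
  then have "ennreal (gr (Suc m) t + lam * c (Suc m)) = ennreal (lam * c m)"
    using lam c(2) by (simp add: ennreal_mult gr_def)
  then have "gr (Suc m) t + lam * c (Suc m) = lam * c m"
    using lam c(2) by (subst (asm) ennreal_inj) (auto simp: gr_def)
  moreover have "(LINT s:{0..t}|lborel. prev wr (Suc m) s) = c m" "(LINT s:{0..t}|lborel. wr (Suc m) s) = c (Suc m)"
    by (simp_all only: prev_simps wr_integral c_def)
  ultimately show ?thesis unfolding Suc by (simp add: right_diff_distrib)
qed

lemma prev_wr_integrable: "set_integrable lborel {0..t} (prev wr l)"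
  by (cases l) (simp_all add: wr_integral set_integrable_def[of _ _ "\<lambda>_. 0"])

lemma prev_wr_measurable [measurable]: "prev wr l \<in> borel_measurable borel"
  by (cases l) simp_all

lemma gr_continuous: "continuous_on {0..} (gr l)"
proof -
  have "continuous_on {0..T} (\<lambda>t. LINT s:{0..t}|lborel. h s)"
    if "\<And>t. set_integrable lborel {0..t} h" for h :: "real \<Rightarrow> real" and T
  proof -
    have "h integrable_on {0..T}" using set_borel_integral_eq_integral[OF that] by simp
    then have "continuous_on {0..T} (\<lambda>t. integral {0..t} h)" by (rule indefinite_integral_continuous_1)
    then show ?thesis using set_borel_integral_eq_integral(2)[OF that] by simp
  qed
  then have c: "continuous_on {0..T} (\<lambda>t. (if l = 0 then 1 else 0) + lam * ((LINT s:{0..t}|lborel. prev wr l s) - (LINT s:{0..t}|lborel. wr l s)))" for T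
    by (intro continuous_intros) (auto intro: wr_integral prev_wr_integrable)
  have c': "continuous_on {0..T} (gr l)" for T
    by (rule continuous_on_eq[OF c]) (simp add: gr_eq_integral)
  show ?thesis
    unfolding continuous_on_eq_continuous_within
  proof
    fix x :: real assume x: "x \<in> {0..}"
    have "continuous (at x within {0..x + 1}) (gr l)"
      using c'[of "x + 1"] x by (auto simp: continuous_on_eq_continuous_within)
    moreover have "at x within {0..x + 1} = at x within {0..}"
      by (rule at_within_nhd[of _ "{..<x + 1}"]) (use x in auto)
    ultimately show "continuous (at x within {0..}) (gr l)" by simp
  qed
qed

lemma conv_w_K_finite: "0 < t \<Longrightarrow> conv (w l) K t < \<infinity>"
proof -
  assume t: "0 < t"
  have "conv (w l) K t \<le> g l t" using w_eq[OF t, of l] by (metis add.commute le_iff_add)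
  also have "\<dots> \<le> 1" by (rule g_le_1)
  finally show ?thesis by (auto simp: less_top[symmetric] top_unique)
qed

text \<open>If b > 0, the equation bounds \<open>w l t\<close> by 1/b, so it is finite at each t >
  0. If b = 0, a possible default value of \<open>wr\<close> is multiplied by 0.\<close>

lemma wr_eq: "0 < t \<Longrightarrow> b * wr l t + hr l t = gr l t"
proof -
  assume t: "0 < t"
  have h: "conv (w l) K t = ennreal (hr l t)" unfolding hr_def using conv_w_K_finite[OF t] by simp
  have bw: "ennreal b * w l t = ennreal (b * wr l t)"
  proof (cases "b = 0")
    case False
    have "ennreal b * w l t \<le> g l t" using w_eq[OF t, of l] by (metis le_iff_add)
    then have "w l t \<noteq> top" using False b g_finite[of l t] by (auto simp: ennreal_mult_top top_unique)
    then show ?thesis using b by (simp add: wr_def ennreal_mult less_top)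
  qed simp
  have "ennreal (b * wr l t + hr l t) = ennreal (gr l t)"
    using w_eq[OF t, of l] b unfolding h bw g_eq_gr by (simp add: wr_def hr_def)
  then show ?thesis using b by (subst (asm) ennreal_inj) (auto simp: wr_def hr_def gr_def)
qed

text \<open>A positive drift bounds \<open>w l\<close> by 1/b, which makes its convolution with the
  tail continuous; the equation can then be solved for \<open>wr\<close>.\<close>

lemma wr_isCont:
  assumes "b \<noteq> 0" "0 < t"
  shows "isCont (wr l) t"
proof -
  have b0: "b > 0" using assms b by simp
  have "w l x \<le> ennreal (1 / b)" for x
  proof (cases "0 < x")
    case True
    have "ennreal b * w l x \<le> 1"
      using w_eq[OF True, of l] g_le_1[of l x] by (metis le_iff_add order_trans)
    then have "ennreal (1 / b) * (ennreal b * w l x) \<le> ennreal (1 / b) * 1" by (rule mult_left_mono) simp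
    moreover have "ennreal (1 / b) * ennreal b = 1" using b0 by (simp add: ennreal_mult[symmetric])
    ultimately show ?thesis by (simp add: mult.assoc[symmetric])
  qed (simp add: w_nonpos)
  then have hc: "continuous_on {0..} (hr l)"
    unfolding hr_def by (intro conv_levy_tail'_continuous[OF \<nu>]) (auto simp: w_nonpos)
  have "continuous_on {0<..} (\<lambda>t. (gr l t - hr l t) / b)"
    using b0 by (intro continuous_intros continuous_on_subset[OF hc] continuous_on_subset[OF gr_continuous]) auto
  then have "continuous_on {0<..} (wr l)"
    by (rule continuous_on_eq) (use wr_eq b0 in \<open>auto simp: field_simps\<close>)
  then show ?thesis using assms by (simp add: continuous_on_eq_continuous_at)
qed

lemma wr_tail_integral:
  assumes t: "0 < t"
  shows "set_integrable lborel {0..t} (\<lambda>s. wr l (t - s) * enn2real (K s))"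
    and "(LINT s:{0..t}|lborel. wr l (t - s) * enn2real (K s)) = hr l t"
proof -
  have Kf: "K s \<noteq> top" for s
    unfolding levy_tail'_def using levy_measure_tail_finite[OF \<nu>, of s] by auto
  have eq: "(\<integral>\<^sup>+ s. ennreal (indicator {0..t} s * (wr l (t - s) * enn2real (K s))) \<partial>lborel) = conv (w l) K t"
  proof -
    have "conv (w l) K t = conv K (w l) t" by (rule fun_cong[OF conv_commute]) measurable
    also have "\<dots> = (\<integral>\<^sup>+ s. ennreal (indicator {0..t} s * (wr l (t - s) * enn2real (K s))) \<partial>lborel)"
      unfolding conv_def
    proof (rule nn_integral_cong_AE)
      show "AE s in lborel. K s * w l (t - s) = ennreal (indicator {0..t} s * (wr l (t - s) * enn2real (K s)))"
        using AE_lborel_reflect[OF AE_w_finite[of l], of t]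
      proof eventually_elim
        fix s assume fin: "w l (t - s) \<noteq> top"
        show "K s * w l (t - s) = ennreal (indicator {0..t} s * (wr l (t - s) * enn2real (K s)))"
        proof (cases "s \<in> {0..t}")
          case True
          have "ennreal (wr l (t - s) * enn2real (K s)) = ennreal (wr l (t - s)) * ennreal (enn2real (K s))"
            by (rule ennreal_mult) (simp_all add: wr_def)
          also have "\<dots> = w l (t - s) * K s" using fin Kf[of s] by (simp add: wr_def less_top)
          finally show ?thesis using True by (simp add: mult.commute)
        next
          case False
          then have "K s * w l (t - s) = 0" by (auto simp: levy_tail'_def w_nonpos)
          then show ?thesis using False by simp
        qed
      qed
    qed
    finally show ?thesis by simp
  qed
  have nn: "0 \<le> wr l (t - s) * enn2real (K s)" for s by (simp add: wr_def)
  show "set_integrable lborel {0..t} (\<lambda>s. wr l (t - s) * enn2real (K s))"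
    unfolding set_integrable_def
  proof (rule integrableI_bounded)
    have "(\<integral>\<^sup>+ s. ennreal (norm (indicator {0..t} s *\<^sub>R (wr l (t - s) * enn2real (K s)))) \<partial>lborel) = conv (w l) K t"
      unfolding eq[symmetric] using nn by (intro nn_integral_cong) (auto split: split_indicator simp: wr_def)
    then show "(\<integral>\<^sup>+ s. ennreal (norm (indicator {0..t} s *\<^sub>R (wr l (t - s) * enn2real (K s)))) \<partial>lborel) < \<infinity>"
      using conv_w_K_finite[OF t, of l] by simp
  qed measurable
  show "(LINT s:{0..t}|lborel. wr l (t - s) * enn2real (K s)) = hr l t"
    unfolding set_lebesgue_integral_def hr_def eq[symmetric]
    by (subst integral_eq_nn_integral) (use nn in \<open>auto split: split_indicator\<close>)
qed

lemma prev_wr_tail_integral: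
  assumes t: "0 < t"
  shows "set_integrable lborel {0..t} (\<lambda>s. prev wr l (t - s) * enn2real (K s))"
    and "(LINT s:{0..t}|lborel. prev wr l (t - s) * enn2real (K s)) = prev hr l t"
  using wr_tail_integral[OF t]
  by (cases l; simp add: set_integrable_def set_lebesgue_integral_def)+

lemma prev_wr_eq: "0 < t \<Longrightarrow> b * prev wr l t + prev hr l t = prev gr l t"
  by (cases l) (auto simp: wr_eq)

lemma prev_wr_isCont: "b \<noteq> 0 \<Longrightarrow> 0 < t \<Longrightarrow> isCont (prev wr l) t"
  using wr_isCont by (cases l) simp_all

text \<open>The density of P is a combination of differences of the \<open>wr l\<close>. The
  operator that multiplies by b and adds the convolution with K sends each \<open>wr l\<close> to
  \<open>gr l\<close> at every positive time, so differences of the \<open>gr l\<close>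
  remain.\<close>

lemma has_gen_CD_derivative_sum:
  fixes P :: "real \<Rightarrow> real" and c :: "nat \<Rightarrow> real"
  assumes P: "\<And>t. 0 \<le> t \<Longrightarrow> P t = (\<Sum>l\<in>L. c l * gr l t)" and ac: "abs_continuous_halfline P" and t: "0 < t"
  shows "has_gen_CD_derivative b \<nu> P (lam * (\<Sum>l\<in>L. c l * (prev gr l t - gr l t))) t"
proof -
  define d where "d = (\<lambda>t. \<Sum>l\<in>L. c l * (lam * (prev wr l t - wr l t)))"
  have [measurable]: "d \<in> borel_measurable borel" unfolding d_def by measurable
  have sum_int: "set_integrable lborel A (\<lambda>s. \<Sum>l\<in>L. h l s)"
      "(LINT s:A|lborel. (\<Sum>l\<in>L. h l s)) = (\<Sum>l\<in>L. LINT s:A|lborel. h l s)"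
    if "\<And>l. set_integrable lborel A (h l)" for A and h :: "nat \<Rightarrow> real \<Rightarrow> real"
    using that unfolding set_integrable_def set_lebesgue_integral_def scaleR_sum_right
    by (auto intro!: Bochner_Integration.integrable_sum Bochner_Integration.integral_sum)
  have diff_int: "set_integrable lborel A (\<lambda>s. c l * (lam * (h1 s - h2 s)))"
      "(LINT s:A|lborel. c l * (lam * (h1 s - h2 s))) = c l * (lam * ((LINT s:A|lborel. h1 s) - (LINT s:A|lborel. h2 s)))"
    if "set_integrable lborel A h1" "set_integrable lborel A h2" for A l and h1 h2 :: "real \<Rightarrow> real"
    using that by (auto simp: set_integral_diff intro!: set_integrable_mult_right set_integral_diff)
  have dint: "set_integrable lborel {0..T} d" for T
    unfolding d_def by (intro sum_int(1) diff_int(1) prev_wr_integrable wr_integral(1))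
  have dval: "(LINT s:{0..T}|lborel. d s) = P T - P 0" if "0 \<le> T" for T
  proof -
    have "(LINT s:{0..T}|lborel. d s) = (\<Sum>l\<in>L. c l * (lam * ((LINT s:{0..T}|lborel. prev wr l s) - (LINT s:{0..T}|lborel. wr l s))))"
      unfolding d_def by (simp add: sum_int(2) diff_int prev_wr_integrable wr_integral(1))
    also have "\<dots> = (\<Sum>l\<in>L. c l * (gr l T - gr l 0))"
      using gr_eq_integral[OF that] gr_eq_integral[of 0]
      by (intro sum.cong) (simp_all add: set_integral_lborel_singleton)
    also have "\<dots> = P T - P 0"
      by (simp add: P that right_diff_distrib sum_subtractf)
    finally show ?thesis .
  qed
  have kd: "d (t - s) * enn2real (K s) = (\<Sum>l\<in>L. c l * (lam * (prev wr l (t - s) * enn2real (K s) - wr l (t - s) * enn2real (K s))))" for s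
    unfolding d_def sum_distrib_right by (intro sum.cong) (auto simp: algebra_simps)
  show ?thesis
  proof (rule has_gen_CD_derivativeI[OF \<nu> ac _ dint _ _ t])
    show "d \<in> borel_measurable borel" by measurable
    show "P T = P 0 + (LINT s:{0..T}|lborel. d s)" if "0 \<le> T" for T using dval[OF that] by simp
    show "isCont d t" if "b \<noteq> 0"
      unfolding d_def by (intro continuous_intros prev_wr_isCont wr_isCont that t)
    show "set_integrable lborel {0..t} (\<lambda>s. d (t - s) * enn2real (levy_tail' \<nu> s))"
      unfolding kd by (intro sum_int(1) diff_int(1) prev_wr_tail_integral wr_tail_integral t)
    have "(LINT s:{0..t}|lborel. d (t - s) * enn2real (K s)) = (\<Sum>l\<in>L. c l * (lam * (prev hr l t - hr l t)))"
      unfolding kd by (simp add: sum_int(2) diff_int prev_wr_tail_integral[OF t] wr_tail_integral[OF t])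
    moreover have "b * d t + (\<Sum>l\<in>L. c l * (lam * (prev hr l t - hr l t))) = (\<Sum>l\<in>L. c l * (lam * ((b * prev wr l t + prev hr l t) - (b * wr l t + hr l t))))"
      unfolding d_def sum_distrib_left sum.distrib[symmetric] by (intro sum.cong) (auto simp: algebra_simps)
    ultimately show "lam * (\<Sum>l\<in>L. c l * (prev gr l t - gr l t)) = b * d t + (LINT s:{0..t}|lborel. d (t - s) * enn2real (levy_tail' \<nu> s))"
      by (simp add: prev_wr_eq[OF t] wr_eq[OF t] sum_distrib_left mult.left_commute)
  qed
qed

end

section \<open>The inverse subordinator\<close>

lemma bernstein_fun_pos:
  assumes "b \<ge> 0" "levy_measure \<nu>" "emeasure \<nu> {0<..} = \<infinity>" "s > 0"
  shows "0 < bernstein_fun b \<nu> s"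
proof (rule ccontr)
  have sets [measurable_cong]: "sets \<nu> = sets borel" using assms by (simp add: levy_measure_def)
  assume "\<not> 0 < bernstein_fun b \<nu> s"
  then have "ennreal (bernstein_fun b \<nu> s) = 0" by (simp add: ennreal_eq_0_iff)
  then have "(\<integral>\<^sup>+ x\<in>{0<..}. ennreal (1 - exp (- s * x)) \<partial>\<nu>) = 0"
    unfolding bernstein_fun_eq_nn_integral(1)[OF assms(1,2,4)] by simp
  then have "AE x in \<nu>. ennreal (1 - exp (- s * x)) * indicator {0<..} x = 0"
    by (subst (asm) nn_integral_0_iff_AE) auto
  then have "AE x in \<nu>. x \<notin> {0<..}"
  proof eventually_elim
    fix x assume x: "ennreal (1 - exp (- s * x)) * indicator {0<..} x = 0"
    have "0 < 1 - exp (- s * x)" if "0 < x" using that assms(4) by simp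
    then show "x \<notin> {0<..}" using x by (auto simp: ennreal_eq_0_iff)
  qed
  then have "{0<..} \<in> null_sets \<nu>"
    by (simp add: AE_iff_null_sets sets)
  then show False using assms(3) by auto
qed

lemma nn_integral_exponential_atLeast:
  assumes "s > 0" "0 \<le> a"
  shows "(\<integral>\<^sup>+ t. ennreal (exponential_density s t) * indicator {a..} t \<partial>lborel) = ennreal (exp (- s * a))"
proof -
  have "(\<integral>\<^sup>+ t. ennreal (exponential_density s t) * indicator {a..} t \<partial>lborel) = (\<integral>\<^sup>+ t. ennreal (s * exp (- s * t)) * indicator {a..} t \<partial>lborel)"
    using assms by (intro nn_integral_cong) (auto simp: exponential_density_def mult.commute split: split_indicator)
  also have "\<dots> = ennreal (0 - (- exp (- s * a)))"
  proof (rule nn_integral_FTC_atLeast)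
    have "filterlim (\<lambda>t. - s * t) at_bot at_top"
      by (rule filterlim_tendsto_neg_mult_at_bot[OF tendsto_const _ filterlim_ident]) (use assms in simp)
    from tendsto_minus[OF filterlim_compose[OF exp_at_bot this]]
    show "((\<lambda>t. - exp (- s * t)) \<longlongrightarrow> 0) at_top" by simp
    show "((\<lambda>t. - exp (- s * t)) has_real_derivative s * exp (- s * x)) (at x)" for x
      by (auto intro!: derivative_eq_intros)
  qed (use assms in auto)
  finally show ?thesis by simp
qed

text \<open>Path properties of D hold almost surely only and M is not assumed complete, so
  measurability of the inverse is a separate assumption; the independence hypotheses will supply
  it.\<close>

locale subordinator = prob_space M for M :: "'a measure" +
  fixes b :: real and \<nu> :: "real measure" and D :: "real \<Rightarrow> 'a \<Rightarrow> real"
  assumes b: "b \<ge> 0" and \<nu>: "levy_measure \<nu>" and \<nu>_inf: "emeasure \<nu> {0<..} = \<infinity>"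
    and D: "levy_subordinator M (bernstein_fun b \<nu>) D"
    and E_meas: "\<And>t. 0 \<le> t \<Longrightarrow> inverse_subordinator D t \<in> borel_measurable M"
begin

abbreviation f :: "real \<Rightarrow> real" where "f \<equiv> bernstein_fun b \<nu>"
abbreviation E :: "real \<Rightarrow> 'a \<Rightarrow> real" where "E \<equiv> inverse_subordinator D"

lemma f_pos: "0 < s \<Longrightarrow> 0 < f s"
  by (rule bernstein_fun_pos[OF b \<nu> \<nu>_inf])

lemma D_meas: "0 \<le> t \<Longrightarrow> D t \<in> borel_measurable M"
  using D by (simp add: levy_subordinator_def)

lemma D_laplace: "0 \<le> t \<Longrightarrow> 0 < s \<Longrightarrow> expectation (\<lambda>\<omega>. exp (- s * D t \<omega>)) = exp (- t * f s)"
  using D by (simp add: levy_subordinator_def)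

lemma AE_D_mono: "AE \<omega> in M. \<forall>x y. 0 \<le> x \<longrightarrow> x \<le> y \<longrightarrow> D x \<omega> \<le> D y \<omega>"
proof -
  have "AE \<omega> in M. mono_on {0..} (\<lambda>t. D t \<omega>) \<and> (\<forall>t\<ge>0. continuous (at_right t) (\<lambda>r. D r \<omega>))"
    using D by (simp add: levy_subordinator_def)
  then show ?thesis by eventually_elim (auto simp: mono_on_def)
qed

lemma AE_D_nonneg: "AE \<omega> in M. \<forall>x. 0 \<le> x \<longrightarrow> 0 \<le> D x \<omega>"
proof -
  have "AE \<omega> in M. D 0 \<omega> = 0" using D by (simp add: levy_subordinator_def)
  then show ?thesis using AE_D_mono by eventually_elim (metis order_refl)
qed

lemma nn_D_laplace:
  assumes "0 \<le> t" "0 < s"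
  shows "(\<integral>\<^sup>+ \<omega>. ennreal (exp (- s * D t \<omega>)) \<partial>M) = ennreal (exp (- t * f s))"
proof -
  note [measurable] = D_meas[OF assms(1)]
  have int: "integrable M (\<lambda>\<omega>. exp (- s * D t \<omega>))"
  proof (rule integrable_const_bound[where B=1])
    show "AE \<omega> in M. norm (exp (- s * D t \<omega>)) \<le> 1"
      using AE_D_nonneg
    proof eventually_elim
      fix \<omega> assume "\<forall>x. 0 \<le> x \<longrightarrow> 0 \<le> D x \<omega>"
      then have "0 \<le> s * D t \<omega>" using assms by simp
      then show "norm (exp (- s * D t \<omega>)) \<le> 1" by simp
    qed
  qed measurable
  show ?thesis
    by (subst nn_integral_eq_integral[OF int]) (simp_all only: D_laplace[OF assms], simp)
qed

text \<open>On the event that D stays below K, exp(-D n) is at least exp(-K), while its expectation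
  exp(-n f(1)) tends to 0. Thereby the infimum defining the inverse is never taken over the empty
  set, almost surely.\<close>

lemma AE_D_unbounded: "AE \<omega> in M. \<forall>t. \<exists>r\<ge>0. t < D r \<omega>"
proof -
  have "AE \<omega> in M. \<exists>n. real K < D (real n) \<omega>" for K :: nat
  proof -
    note [measurable] = D_meas[of "real _"]
    define A where "A = {\<omega> \<in> space M. \<forall>n. D (real n) \<omega> \<le> real K}"
    have [measurable]: "A \<in> sets M" unfolding A_def by measurable
    have le: "ennreal (exp (- real K)) * emeasure M A \<le> ennreal (exp (- real n * f 1))" for n
    proof -
      have "ennreal (exp (- real K)) * emeasure M A = (\<integral>\<^sup>+ \<omega>. ennreal (exp (- real K)) * indicator A \<omega> \<partial>M)"
        by (rule nn_integral_cmult_indicator[symmetric]) measurable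
      also have "\<dots> \<le> (\<integral>\<^sup>+ \<omega>. ennreal (exp (- 1 * D (real n) \<omega>)) \<partial>M)"
        by (intro nn_integral_mono) (auto simp: A_def split: split_indicator intro!: ennreal_leI)
      also have "\<dots> = ennreal (exp (- real n * f 1))" by (rule nn_D_laplace) auto
      finally show ?thesis .
    qed
    have "(\<lambda>n. exp (- f 1) ^ n) \<longlonglongrightarrow> 0"
      using f_pos[of 1] by (intro LIMSEQ_power_zero) simp
    moreover have "exp (- f 1) ^ n = exp (- real n * f 1)" for n
      by (simp add: exp_of_nat_mult[symmetric])
    ultimately have "(\<lambda>n. ennreal (exp (- real n * f 1))) \<longlonglongrightarrow> ennreal 0"
      by (intro tendsto_ennrealI) simp
    then have "ennreal (exp (- real K)) * emeasure M A \<le> ennreal 0"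
      by (rule LIMSEQ_le_const) (use le in auto)
    then have "emeasure M A = 0" by simp
    then show ?thesis by (intro AE_I[of _ _ A]) (auto simp: A_def not_less)
  qed
  then have "AE \<omega> in M. \<forall>K. \<exists>n. real K < D (real n) \<omega>" by (simp add: AE_all_countable)
  then show ?thesis
  proof eventually_elim
    fix \<omega> assume K: "\<forall>K. \<exists>n. real K < D (real n) \<omega>"
    show "\<forall>t. \<exists>r\<ge>0. t < D r \<omega>"
    proof
      fix t :: real
      obtain K :: nat where "t \<le> real K" using real_arch_simple by blast
      moreover obtain n where "real K < D (real n) \<omega>" using K by blast
      ultimately show "\<exists>r\<ge>0. t < D r \<omega>" by (intro exI[of _ "real n"]) auto
    qed
  qed
qed

lemma E_gt_imp_D_le: "0 \<le> x \<Longrightarrow> x < E t \<omega> \<Longrightarrow> D x \<omega> \<le> t"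
proof (rule ccontr)
  assume x: "0 \<le> x" "x < E t \<omega>" and "\<not> D x \<omega> \<le> t"
  then have "E t \<omega> \<le> x"
    unfolding inverse_subordinator_def by (intro cInf_lower) (auto intro!: bdd_belowI[of _ 0])
  then show False using x by simp
qed

text \<open>Converse of \<open>E_gt_imp_D_le\<close> up to equality. The slack is removed later by
  letting y decrease to x, so no left limits of D are needed.\<close>

lemma AE_D_le_imp_E_ge: "AE \<omega> in M. \<forall>y t. 0 \<le> y \<longrightarrow> D y \<omega> \<le> t \<longrightarrow> y \<le> E t \<omega>"
  using AE_D_mono AE_D_unbounded
proof eventually_elim
  fix \<omega> assume m: "\<forall>x y. 0 \<le> x \<longrightarrow> x \<le> y \<longrightarrow> D x \<omega> \<le> D y \<omega>" and u: "\<forall>t. \<exists>r\<ge>0. t < D r \<omega>"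
  show "\<forall>y t. 0 \<le> y \<longrightarrow> D y \<omega> \<le> t \<longrightarrow> y \<le> E t \<omega>"
  proof (intro allI impI)
    fix y t assume y: "0 \<le> y" "D y \<omega> \<le> t"
    show "y \<le> E t \<omega>"
      unfolding inverse_subordinator_def
    proof (rule cInf_greatest)
      show "{r. 0 \<le> r \<and> t < D r \<omega>} \<noteq> {}" using u by auto
      fix r assume r: "r \<in> {r. 0 \<le> r \<and> t < D r \<omega>}"
      show "y \<le> r"
      proof (rule ccontr)
        assume "\<not> y \<le> r"
        then have "D r \<omega> \<le> D y \<omega>" using m r by auto
        then show False using r y by auto
      qed
    qed
  qed
qed

lemma AE_E_nonneg: "AE \<omega> in M. \<forall>t. 0 \<le> E t \<omega>"
  using AE_D_unbounded
proof eventually_elim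
  fix \<omega> assume u: "\<forall>t. \<exists>r\<ge>0. t < D r \<omega>"
  show "\<forall>t. 0 \<le> E t \<omega>"
  proof
    fix t
    have "{r. 0 \<le> r \<and> t < D r \<omega>} \<noteq> {}" using u by auto
    then show "0 \<le> E t \<omega>"
      unfolding inverse_subordinator_def by (intro cInf_greatest) auto
  qed
qed

lemma AE_E_mono: "AE \<omega> in M. \<forall>s t. s \<le> t \<longrightarrow> E s \<omega> \<le> E t \<omega>"
  using AE_D_unbounded
proof eventually_elim
  fix \<omega> assume u: "\<forall>t. \<exists>r\<ge>0. t < D r \<omega>"
  show "\<forall>s t. s \<le> t \<longrightarrow> E s \<omega> \<le> E t \<omega>"
  proof (intro allI impI)
    fix s t :: real assume st: "s \<le> t"
    have "{r. 0 \<le> r \<and> t < D r \<omega>} \<noteq> {}" using u by auto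
    then show "E s \<omega> \<le> E t \<omega>"
      unfolding inverse_subordinator_def
      by (intro cInf_superset_mono) (use st in \<open>auto intro!: bdd_belowI[of _ 0]\<close>)
  qed
qed

text \<open>An independent exponential time of rate s exceeds D x with conditional probability
  exp(-s D x). The truncation \<open>max 0 t\<close> affects only times where the exponential
  density vanishes.\<close>

lemma D_le_laplace:
  assumes x: "0 \<le> x" and s: "0 < s"
  shows "(\<integral>\<^sup>+ t. ennreal (exponential_density s t) * emeasure M {\<omega> \<in> space M. D x \<omega> \<le> max 0 t} \<partial>lborel) = ennreal (exp (- x * f s))"
proof -
  note [measurable] = D_meas[OF x]
  interpret P: pair_sigma_finite lborel M ..
  have "(\<integral>\<^sup>+ t. ennreal (exponential_density s t) * emeasure M {\<omega> \<in> space M. D x \<omega> \<le> max 0 t} \<partial>lborel)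
    = (\<integral>\<^sup>+ t. \<integral>\<^sup>+ \<omega>. ennreal (exponential_density s t) * (if D x \<omega> \<le> max 0 t then 1 else 0) \<partial>M \<partial>lborel)"
  proof (rule nn_integral_cong)
    fix t :: real
    have "emeasure M {\<omega> \<in> space M. D x \<omega> \<le> max 0 t} = (\<integral>\<^sup>+ \<omega>. indicator {\<omega> \<in> space M. D x \<omega> \<le> max 0 t} \<omega> \<partial>M)"
      by (rule nn_integral_indicator[symmetric]) measurable
    also have "\<dots> = (\<integral>\<^sup>+ \<omega>. (if D x \<omega> \<le> max 0 t then 1 else 0) \<partial>M)"
      by (intro nn_integral_cong) (auto split: split_indicator)
    finally show "ennreal (exponential_density s t) * emeasure M {\<omega> \<in> space M. D x \<omega> \<le> max 0 t}
      = (\<integral>\<^sup>+ \<omega>. ennreal (exponential_density s t) * (if D x \<omega> \<le> max 0 t then 1 else 0) \<partial>M)"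
      by (simp add: nn_integral_cmult)
  qed
  also have "\<dots> = (\<integral>\<^sup>+ \<omega>. \<integral>\<^sup>+ t. ennreal (exponential_density s t) * (if D x \<omega> \<le> max 0 t then 1 else 0) \<partial>lborel \<partial>M)"
    by (rule P.Fubini'[symmetric]) measurable
  also have "\<dots> = (\<integral>\<^sup>+ \<omega>. ennreal (exp (- s * D x \<omega>)) \<partial>M)"
  proof (rule nn_integral_cong_AE)
    show "AE \<omega> in M. (\<integral>\<^sup>+ t. ennreal (exponential_density s t) * (if D x \<omega> \<le> max 0 t then 1 else 0) \<partial>lborel) = ennreal (exp (- s * D x \<omega>))"
      using AE_D_nonneg
    proof eventually_elim
      fix \<omega> assume "\<forall>x. 0 \<le> x \<longrightarrow> 0 \<le> D x \<omega>"
      then have D0: "0 \<le> D x \<omega>" using x by blast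
      have "(\<integral>\<^sup>+ t. ennreal (exponential_density s t) * (if D x \<omega> \<le> max 0 t then 1 else 0) \<partial>lborel)
        = (\<integral>\<^sup>+ t. ennreal (exponential_density s t) * indicator {D x \<omega>..} t \<partial>lborel)"
        using D0 by (intro nn_integral_cong) (auto simp: exponential_density_def split: split_indicator)
      then show "(\<integral>\<^sup>+ t. ennreal (exponential_density s t) * (if D x \<omega> \<le> max 0 t then 1 else 0) \<partial>lborel) = ennreal (exp (- s * D x \<omega>))"
        using nn_integral_exponential_atLeast[OF s D0] by simp
    qed
  qed
  also have "\<dots> = ennreal (exp (- x * f s))" by (rule nn_D_laplace[OF x s])
  finally show ?thesis .
qed

text \<open>At an independent exponential time of rate \<open>s\<close>, the inverse subordinator is exponentially
  distributed with rate \<open>f s\<close>.\<close>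

lemma E_at_exponential_time:
  fixes \<phi> :: "real \<Rightarrow> ennreal"
  assumes s: "0 < s" and [measurable]: "\<phi> \<in> borel_measurable borel"
  shows "(\<integral>\<^sup>+ t. ennreal (exponential_density s t) * (\<integral>\<^sup>+ \<omega>. \<phi> (E (max 0 t) \<omega>) \<partial>M) \<partial>lborel)
    = (\<integral>\<^sup>+ x. ennreal (exponential_density (f s) x) * \<phi> x \<partial>lborel)" (is ?law)
    and "(\<lambda>t. \<integral>\<^sup>+ \<omega>. \<phi> (E (max 0 t) \<omega>) \<partial>M) \<in> borel_measurable borel" (is ?meas)
proof -
  have Em [measurable]: "E (max 0 t) \<in> borel_measurable M" for t by (rule E_meas) simp
  define \<kappa> where "\<kappa> = (\<lambda>t. distr M borel (E (max 0 t)))"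
  define Q where "Q = density lborel (\<lambda>t. ennreal (exponential_density s t))"
  have [simp, measurable_cong]: "sets Q = sets borel" by (simp add: Q_def)
  have e\<kappa>: "emeasure (\<kappa> t) {x<..} = emeasure M {\<omega> \<in> space M. x < E (max 0 t) \<omega>}" for t x
    unfolding \<kappa>_def by (subst emeasure_distr) (auto intro!: arg_cong[where f="emeasure M"])
  have mono: "emeasure (\<kappa> t) {x<..} \<le> emeasure (\<kappa> t') {x<..}" if "t \<le> t'" for t t' x
    unfolding e\<kappa>
  proof (rule emeasure_mono_AE)
    show "AE \<omega> in M. \<omega> \<in> {\<omega> \<in> space M. x < E (max 0 t) \<omega>} \<longrightarrow> \<omega> \<in> {\<omega> \<in> space M. x < E (max 0 t') \<omega>}"
      using AE_E_mono
    proof eventually_elim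
      fix \<omega> assume "\<forall>s t. s \<le> t \<longrightarrow> E s \<omega> \<le> E t \<omega>"
      then have "E (max 0 t) \<omega> \<le> E (max 0 t') \<omega>" using that by (simp add: max.coboundedI2)
      then show "\<omega> \<in> {\<omega> \<in> space M. x < E (max 0 t) \<omega>} \<longrightarrow> \<omega> \<in> {\<omega> \<in> space M. x < E (max 0 t') \<omega>}" by auto
    qed
  qed measurable
  have prob\<kappa>: "prob_space (\<kappa> t)" for t unfolding \<kappa>_def by (rule prob_space_distr) measurable
  \<comment> \<open>Joint measurability of E in time and \<omega> is not assumed. Since E increases
    in t, tail probabilities are monotone and hence Borel in t, and half-lines generate the Borel
    sets.\<close>
  have \<kappa>m [measurable]: "\<kappa> \<in> measurable borel (subprob_algebra borel)"
  proof (rule measurable_subprob_algebra_generated)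
    show "sets borel = sigma_sets UNIV (range greaterThan :: real set set)"
      by (subst borel_Ioi) simp
    show "Int_stable (range greaterThan :: real set set)"
      by (auto simp: Int_stable_def greaterThan_def simp flip: Collect_conj_eq max_less_iff_conj)
    show "subprob_space (\<kappa> a)" for a using prob\<kappa> by (rule prob_space_imp_subprob_space)
    show "sets (\<kappa> a) = sets borel" for a by (simp add: \<kappa>_def)
    show "(\<lambda>a. emeasure (\<kappa> a) UNIV) \<in> borel_measurable borel"
      using prob_space.emeasure_space_1[OF prob\<kappa>] by (simp add: \<kappa>_def)
    show "(\<lambda>a. emeasure (\<kappa> a) A) \<in> borel_measurable borel" if A: "A \<in> range greaterThan" for A
    proof -
      obtain x where x: "A = {x<..}" using A by auto
      have fin: "emeasure (\<kappa> a) A = ennreal (measure (\<kappa> a) A)" for a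
      proof -
        interpret K: prob_space "\<kappa> a" by (rule prob\<kappa>)
        show ?thesis by (rule K.emeasure_eq_measure)
      qed
      have "mono (\<lambda>a. measure (\<kappa> a) A)"
      proof (rule monoI)
        fix t t' :: real assume "t \<le> t'"
        then have "ennreal (measure (\<kappa> t) A) \<le> ennreal (measure (\<kappa> t') A)"
          unfolding fin[symmetric] unfolding x by (rule mono)
        then show "measure (\<kappa> t) A \<le> measure (\<kappa> t') A" by (simp add: ennreal_le_iff)
      qed
      then have "(\<lambda>a. measure (\<kappa> a) A) \<in> borel_measurable borel" by (rule borel_measurable_mono)
      then show ?thesis unfolding fin by measurable
    qed
  qed auto
  have \<kappa>Q: "\<kappa> \<in> measurable Q (subprob_algebra borel)" by measurable
  have spQ: "space Q \<noteq> {}" by (simp add: Q_def)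
  have eb: "emeasure (Q \<bind> \<kappa>) {x<..} = (\<integral>\<^sup>+ t. ennreal (exponential_density s t) * emeasure M {\<omega> \<in> space M. x < E (max 0 t) \<omega>} \<partial>lborel)" for x
  proof -
    have [measurable]: "(\<lambda>t. emeasure (\<kappa> t) {x<..}) \<in> borel_measurable borel"
      by (rule measurable_compose[OF \<kappa>m measurable_emeasure_subprob_algebra]) simp
    have "emeasure (Q \<bind> \<kappa>) {x<..} = (\<integral>\<^sup>+ t. emeasure (\<kappa> t) {x<..} \<partial>Q)"
      by (rule emeasure_bind[OF spQ \<kappa>Q]) simp
    also have "\<dots> = (\<integral>\<^sup>+ t. ennreal (exponential_density s t) * emeasure (\<kappa> t) {x<..} \<partial>lborel)"
      unfolding Q_def by (rule nn_integral_density) measurable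
    finally show ?thesis unfolding e\<kappa> .
  qed
  have upper: "emeasure (Q \<bind> \<kappa>) {x<..} \<le> ennreal (exp (- x * f s))" if x: "0 \<le> x" for x
  proof -
    note [measurable] = D_meas[OF x]
    have "emeasure M {\<omega> \<in> space M. x < E (max 0 t) \<omega>} \<le> emeasure M {\<omega> \<in> space M. D x \<omega> \<le> max 0 t}" for t
      by (rule emeasure_mono) (use E_gt_imp_D_le[OF x] in auto)
    then show ?thesis unfolding eb D_le_laplace[OF x s, symmetric]
      by (intro nn_integral_mono mult_left_mono) auto
  qed
  have lower: "ennreal (exp (- y * f s)) \<le> emeasure (Q \<bind> \<kappa>) {x<..}" if x: "0 \<le> x" and y: "x < y" for x y
  proof -
    have "emeasure M {\<omega> \<in> space M. D y \<omega> \<le> max 0 t} \<le> emeasure M {\<omega> \<in> space M. x < E (max 0 t) \<omega>}" for t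
    proof (rule emeasure_mono_AE)
      show "AE \<omega> in M. \<omega> \<in> {\<omega> \<in> space M. D y \<omega> \<le> max 0 t} \<longrightarrow> \<omega> \<in> {\<omega> \<in> space M. x < E (max 0 t) \<omega>}"
        using AE_D_le_imp_E_ge
      proof eventually_elim
        fix \<omega> assume *: "\<forall>y t. 0 \<le> y \<longrightarrow> D y \<omega> \<le> t \<longrightarrow> y \<le> E t \<omega>"
        show "\<omega> \<in> {\<omega> \<in> space M. D y \<omega> \<le> max 0 t} \<longrightarrow> \<omega> \<in> {\<omega> \<in> space M. x < E (max 0 t) \<omega>}"
          using *[rule_format, of y "max 0 t"] x y by auto
      qed
    qed measurable
    moreover have "0 \<le> y" using x y by simp
    ultimately show ?thesis unfolding eb using D_le_laplace[OF \<open>0 \<le> y\<close> s, symmetric]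
      by (auto intro!: nn_integral_mono mult_left_mono)
  qed
  have fs: "0 < f s" by (rule f_pos[OF s])
  \<comment> \<open>The events {D x \<le> t} and {D y \<le> t} for y > x enclose {E t > x}; y = x +
    1/(n + 1) closes the gap.\<close>
  have tail: "emeasure (Q \<bind> \<kappa>) {x<..} = ennreal (exp (- x * f s))" if x: "0 \<le> x" for x
  proof (rule antisym[OF upper[OF x]])
    have lim: "(\<lambda>n. ennreal (exp (- (x + 1 / real (Suc n)) * f s))) \<longlonglongrightarrow> ennreal (exp (- (x + 0) * f s))"
      by (intro tendsto_ennrealI tendsto_intros LIMSEQ_Suc[OF lim_1_over_n])
    have "ennreal (exp (- (x + 1 / real (Suc n)) * f s)) \<le> emeasure (Q \<bind> \<kappa>) {x<..}" for n
      by (rule lower[OF x]) simp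
    then have "ennreal (exp (- (x + 0) * f s)) \<le> emeasure (Q \<bind> \<kappa>) {x<..}"
      by (intro LIMSEQ_le_const2[OF lim]) auto
    then show "ennreal (exp (- x * f s)) \<le> emeasure (Q \<bind> \<kappa>) {x<..}" by simp
  qed
  have Q1: "(\<integral>\<^sup>+ t. ennreal (exponential_density s t) \<partial>lborel) = 1"
    using prob_space.emeasure_space_1[OF prob_space_exponential_density[OF s]]
    by (simp add: emeasure_density)
  have tail0: "emeasure (Q \<bind> \<kappa>) {x<..} = 1" if x: "x < 0" for x
  proof -
    have "emeasure M {\<omega> \<in> space M. x < E (max 0 t) \<omega>} = 1" for t
    proof (rule emeasure_eq_1_AE)
      show "AE \<omega> in M. \<omega> \<in> {\<omega> \<in> space M. x < E (max 0 t) \<omega>}"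
        using AE_E_nonneg AE_space by eventually_elim (use x in \<open>auto intro: less_le_trans\<close>)
    qed measurable
    then show ?thesis unfolding eb using Q1 by simp
  qed
  have "Q \<bind> \<kappa> = density lborel (\<lambda>x. ennreal (exponential_density (f s) x))"
  proof (rule measure_eqI_lessThan)
    show "sets (Q \<bind> \<kappa>) = sets borel" by (rule sets_bind[OF _ spQ]) (simp add: \<kappa>_def)
    show "emeasure (Q \<bind> \<kappa>) {x<..} < \<infinity>" for x
      by (cases "x < 0") (auto simp: tail0 tail)
    show "emeasure (Q \<bind> \<kappa>) {x<..} = emeasure (density lborel (\<lambda>x. ennreal (exponential_density (f s) x))) {x<..}" for x
    proof -
      have "emeasure (density lborel (\<lambda>x. ennreal (exponential_density (f s) x))) {x<..}
        = (\<integral>\<^sup>+ t. ennreal (exponential_density (f s) t) * indicator {max 0 x..} t \<partial>lborel)"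
      proof (subst emeasure_density, simp, simp, rule nn_integral_cong_AE)
        show "AE t in lborel. ennreal (exponential_density (f s) t) * indicator {x<..} t = ennreal (exponential_density (f s) t) * indicator {max 0 x..} t"
          using AE_lborel_singleton[of x]
          by eventually_elim (auto simp: exponential_density_def split: split_indicator)
      qed
      also have "\<dots> = ennreal (exp (- f s * max 0 x))"
        by (rule nn_integral_exponential_atLeast[OF fs]) simp
      finally show ?thesis by (cases "x < 0") (auto simp: tail tail0 mult.commute max_def)
    qed
  qed simp
  moreover have \<kappa>\<phi> [measurable]: "(\<lambda>t. \<integral>\<^sup>+ x. \<phi> x \<partial>\<kappa> t) \<in> borel_measurable borel"
    by (rule measurable_compose[OF \<kappa>m nn_integral_measurable_subprob_algebra]) measurable
  ultimately have "(\<integral>\<^sup>+ x. ennreal (exponential_density (f s) x) * \<phi> x \<partial>lborel) = (\<integral>\<^sup>+ x. \<phi> x \<partial>(Q \<bind> \<kappa>))"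
    by (simp add: nn_integral_density)
  also have "\<dots> = (\<integral>\<^sup>+ t. \<integral>\<^sup>+ x. \<phi> x \<partial>\<kappa> t \<partial>Q)"
    by (rule nn_integral_bind[OF _ \<kappa>Q]) measurable
  also have "\<dots> = (\<integral>\<^sup>+ t. ennreal (exponential_density s t) * (\<integral>\<^sup>+ x. \<phi> x \<partial>\<kappa> t) \<partial>lborel)"
    unfolding Q_def
    by (rule nn_integral_density) measurable
  also have "\<dots> = (\<integral>\<^sup>+ t. ennreal (exponential_density s t) * (\<integral>\<^sup>+ \<omega>. \<phi> (E (max 0 t) \<omega>) \<partial>M) \<partial>lborel)"
    unfolding \<kappa>_def by (simp add: nn_integral_distr)
  finally show ?law ..
  show ?meas using \<kappa>\<phi> unfolding \<kappa>_def by (simp add: nn_integral_distr)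
qed

end

section \<open>The time-changed compound Poisson process\<close>

locale compound_time_changed = subordinator M b \<nu> D
  for M :: "'a measure" and b :: real and \<nu> :: "real measure" and D :: "real \<Rightarrow> 'a \<Rightarrow> real" +
  fixes lam \<rho> :: real and k :: nat and N :: "real \<Rightarrow> 'a \<Rightarrow> nat" and X :: "nat \<Rightarrow> 'a \<Rightarrow> nat"
  assumes lam: "lam > 0" and N: "poisson_process M lam N"
    and k: "k \<ge> 1" and \<rho>: "0 \<le> \<rho>" "\<rho> < 1" and X: "iid_truncated_geometric M \<rho> k X"
    and indep_N_E: "indep_random_elements M
          (PiM {0..} (\<lambda>_. count_space UNIV)) (\<lambda>\<omega>. \<lambda>t\<in>{0..}. N t \<omega>)
          (PiM {0..} (\<lambda>_. borel)) (\<lambda>\<omega>. \<lambda>t\<in>{0..}. inverse_subordinator D t \<omega>)"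
    and indep_X_N_E: "indep_random_elements M
          (PiM {1..} (\<lambda>_. count_space UNIV)) (\<lambda>\<omega>. \<lambda>i\<in>{1..}. X i \<omega>)
          (PiM {0..} (\<lambda>_. count_space UNIV) \<Otimes>\<^sub>M PiM {0..} (\<lambda>_. borel))
          (\<lambda>\<omega>. (\<lambda>t\<in>{0..}. N t \<omega>, \<lambda>t\<in>{0..}. inverse_subordinator D t \<omega>))"
begin

text \<open>Poisson weight at operational time x. Averaging it over E t, as \<open>e\<close> does,
  is conditioning on the inverse subordinator.\<close>

definition \<phi> :: "nat \<Rightarrow> real \<Rightarrow> real" where
  "\<phi> l x = (lam * x) ^ l / fact l * exp (- (lam * x))"

definition e :: "nat \<Rightarrow> real \<Rightarrow> real" where
  "e l t = expectation (\<lambda>\<omega>. \<phi> l (E t \<omega>))"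

definition S :: "nat \<Rightarrow> 'a \<Rightarrow> nat" where "S l \<omega> = (\<Sum>i=1..l. X i \<omega>)"

definition c :: "nat \<Rightarrow> nat \<Rightarrow> real" where "c l n = prob {\<omega> \<in> space M. S l \<omega> = n}"

definition q :: "nat \<Rightarrow> real" where "q j = (1 - \<rho>) / (1 - \<rho> ^ k) * \<rho> ^ (j - 1)"

lemma N_meas: "0 \<le> t \<Longrightarrow> N t \<in> measurable M (count_space UNIV)"
  using N by (simp add: poisson_process_def)

lemma X_meas: "1 \<le> i \<Longrightarrow> X i \<in> measurable M (count_space UNIV)"
  using X by (simp add: iid_truncated_geometric_def indep_vars_def)

lemma S_meas [measurable]: "S l \<in> measurable M (count_space UNIV)"
proof -
  have "(\<lambda>\<omega>. real (S l \<omega>)) \<in> borel_measurable M"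
    unfolding S_def of_nat_sum
    by (rule borel_measurable_sum, rule measurable_compose[OF X_meas]) auto
  then have "(\<lambda>\<omega>. nat \<lfloor>real (S l \<omega>)\<rfloor>) \<in> measurable M (count_space UNIV)" by measurable
  then show ?thesis by simp
qed

lemma \<phi>_nonneg: "0 \<le> x \<Longrightarrow> 0 \<le> \<phi> l x"
  using lam by (simp add: \<phi>_def)

lemma \<phi>_le_1: "0 \<le> x \<Longrightarrow> \<phi> l x \<le> 1"
proof -
  assume x: "0 \<le> x"
  have "(lam * x) ^ l / fact l \<le> exp (lam * x)"
  proof -
    have "(\<lambda>n. (lam * x) ^ n /\<^sub>R fact n) sums exp (lam * x)" by (rule exp_converges)
    then have "summable (\<lambda>n. (lam * x) ^ n /\<^sub>R fact n)" "exp (lam * x) = (\<Sum>n. (lam * x) ^ n /\<^sub>R fact n)"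
      by (simp_all add: sums_iff)
    moreover from this(1) have "(\<Sum>n\<in>{l}. (lam * x) ^ n /\<^sub>R fact n) \<le> (\<Sum>n. (lam * x) ^ n /\<^sub>R fact n)"
      by (rule sum_le_suminf) (use x lam in auto)
    ultimately have "(lam * x) ^ l /\<^sub>R fact l \<le> exp (lam * x)" by simp
    then show ?thesis by (simp add: divide_inverse mult.commute)
  qed
  then show ?thesis by (simp add: \<phi>_def exp_minus field_simps)
qed

lemma \<phi>_meas [measurable]: "\<phi> l \<in> borel_measurable borel"
  unfolding \<phi>_def by measurable

lemma ennreal_e:
  assumes t: "0 \<le> t"
  shows "ennreal (e l t) = (\<integral>\<^sup>+ \<omega>. ennreal (\<phi> l (E t \<omega>)) \<partial>M)" "integrable M (\<lambda>\<omega>. \<phi> l (E t \<omega>))"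
proof -
  note [measurable] = E_meas[OF t]
  show int: "integrable M (\<lambda>\<omega>. \<phi> l (E t \<omega>))"
  proof (rule integrable_const_bound[where B=1])
    show "AE \<omega> in M. norm (\<phi> l (E t \<omega>)) \<le> 1"
      using AE_E_nonneg by eventually_elim (simp add: \<phi>_le_1 \<phi>_nonneg)
  qed measurable
  show "ennreal (e l t) = (\<integral>\<^sup>+ \<omega>. ennreal (\<phi> l (E t \<omega>)) \<partial>M)"
    unfolding e_def
  proof (rule nn_integral_eq_integral[OF int, symmetric])
    show "AE \<omega> in M. 0 \<le> \<phi> l (E t \<omega>)"
      using AE_E_nonneg by eventually_elim (simp add: \<phi>_nonneg)
  qed
qed

lemma e_meas [measurable]: "(\<lambda>t. ennreal (e l t) * indicator {0..} t) \<in> borel_measurable borel"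
proof -
  have [measurable]: "(\<lambda>t. \<integral>\<^sup>+ \<omega>. ennreal (\<phi> l (E (max 0 t) \<omega>)) \<partial>M) \<in> borel_measurable borel"
    by (rule E_at_exponential_time(2)[where s = 1]) simp_all
  have "(\<lambda>t. (\<integral>\<^sup>+ \<omega>. ennreal (\<phi> l (E (max 0 t) \<omega>)) \<partial>M) * indicator {0..} t) \<in> borel_measurable borel"
    by measurable
  also have "(\<lambda>t. (\<integral>\<^sup>+ \<omega>. ennreal (\<phi> l (E (max 0 t) \<omega>)) \<partial>M) * indicator {0..} t) = (\<lambda>t. ennreal (e l t) * indicator {0..} t)"
    by (auto simp: ennreal_e split: split_indicator)
  finally show ?thesis .
qed

text \<open>The exponential density of rate f(s) times the Poisson weight is a multiple of the
  Erlang density of rate \<open>lam\<close> + f(s), whose total mass is 1.\<close>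

lemma laplace_e:
  assumes s: "0 < s"
  shows "laplace (\<lambda>t. ennreal (e l t) * indicator {0..} t) s = ennreal (lam ^ l * (f s / (s * (lam + f s) ^ Suc l)))"
proof -
  have fs: "0 < f s" by (rule f_pos[OF s])
  have "ennreal s * laplace (\<lambda>t. ennreal (e l t) * indicator {0..} t) s
    = (\<integral>\<^sup>+ t. ennreal (exponential_density s t) * (\<integral>\<^sup>+ \<omega>. ennreal (\<phi> l (E (max 0 t) \<omega>)) \<partial>M) \<partial>lborel)"
  proof -
    have "ennreal s * (ennreal (e l t) * indicator {0..} t * ennreal (exp (- s * t)))
      = ennreal (exponential_density s t) * (\<integral>\<^sup>+ \<omega>. ennreal (\<phi> l (E (max 0 t) \<omega>)) \<partial>M)" for t
    proof (cases "0 \<le> t")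
      case True
      have "ennreal s * ennreal (exp (- s * t)) = ennreal (exponential_density s t)"
        using True s by (simp add: exponential_density_def ennreal_mult[symmetric] mult.commute)
      then show ?thesis using True ennreal_e(1)[OF True, of l]
        by (simp add: mult_ac max_def) (metis mult.commute mult.left_commute)
    qed (simp add: exponential_density_def)
    moreover have "ennreal s * laplace (\<lambda>t. ennreal (e l t) * indicator {0..} t) s
      = (\<integral>\<^sup>+ t. ennreal s * (ennreal (e l t) * indicator {0..} t * ennreal (exp (- s * t))) \<partial>lborel)"
      unfolding laplace_def by (rule nn_integral_cmult[symmetric]) measurable
    ultimately show ?thesis by simp
  qed
  also have "\<dots> = (\<integral>\<^sup>+ x. ennreal (exponential_density (f s) x) * ennreal (\<phi> l x) \<partial>lborel)"
    by (rule E_at_exponential_time(1)[OF s]) measurable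
  also have "\<dots> = (\<integral>\<^sup>+ x. ennreal (lam ^ l * (f s / (lam + f s) ^ Suc l)) * ennreal (erlang_density l (lam + f s) x) \<partial>lborel)"
  proof (rule nn_integral_cong)
    fix x :: real
    show "ennreal (exponential_density (f s) x) * ennreal (\<phi> l x) = ennreal (lam ^ l * (f s / (lam + f s) ^ Suc l)) * ennreal (erlang_density l (lam + f s) x)"
    proof (cases "0 \<le> x")
      case True
      have pos: "lam + f s > 0" using lam fs by simp
      have "exponential_density (f s) x * \<phi> l x = f s * (exp (- x * f s) * exp (- (lam * x))) * ((lam * x) ^ l / fact l)"
        using True by (simp add: exponential_density_def \<phi>_def)
      also have "exp (- x * f s) * exp (- (lam * x)) = exp (- (lam + f s) * x)"
        by (simp add: exp_add[symmetric] algebra_simps)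
      also have "f s * exp (- (lam + f s) * x) * ((lam * x) ^ l / fact l)
        = lam ^ l * (f s / (lam + f s) ^ Suc l) * erlang_density l (lam + f s) x"
        using True pos by (simp add: erlang_density_def power_mult_distrib)
      finally have "exponential_density (f s) x * \<phi> l x = lam ^ l * (f s / (lam + f s) ^ Suc l) * erlang_density l (lam + f s) x" .
      then show ?thesis using True lam fs
        by (subst (1 2) ennreal_mult[symmetric]) (auto simp: \<phi>_nonneg)
    qed (simp add: exponential_density_def erlang_density_def)
  qed
  also have "\<dots> = ennreal (lam ^ l * (f s / (lam + f s) ^ Suc l)) * (\<integral>\<^sup>+ x. ennreal (erlang_density l (lam + f s) x) \<partial>lborel)"
    by (rule nn_integral_cmult) measurable
  also have "(\<integral>\<^sup>+ x. ennreal (erlang_density l (lam + f s) x) \<partial>lborel) = 1"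
    using prob_space.emeasure_space_1[OF prob_space_erlang_density[of "lam + f s" l]] lam fs
    by (simp add: emeasure_density)
  finally have "ennreal s * laplace (\<lambda>t. ennreal (e l t) * indicator {0..} t) s = ennreal s * ennreal (lam ^ l * (f s / (s * (lam + f s) ^ Suc l)))"
    using s lam fs by (simp add: ennreal_mult[symmetric])
  then show ?thesis using s by (auto simp: ennreal_mult_cancel_left)
qed

section \<open>Law of the partial sums and factorisation of joint events\<close>

lemma PiM_sum_eq_sets:
  assumes "finite J" "J \<subseteq> I"
  shows "{x \<in> space (PiM I (\<lambda>_. count_space UNIV)). (\<Sum>i\<in>J. x i) = (n::nat)} \<in> sets (PiM I (\<lambda>_. count_space UNIV))"
proof -
  have "(\<lambda>x. real (\<Sum>i\<in>J. x i)) \<in> borel_measurable (PiM I (\<lambda>_. count_space (UNIV :: nat set)))"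
    unfolding of_nat_sum
    by (rule borel_measurable_sum, rule measurable_compose[OF measurable_component_singleton]) (use assms in auto)
  then have "{x \<in> space (PiM I (\<lambda>_. count_space UNIV)). real (\<Sum>i\<in>J. x i) = real n} \<in> sets (PiM I (\<lambda>_. count_space UNIV))"
    by measurable
  then show ?thesis by (simp only: of_nat_eq_iff)
qed

lemma prob_X: "1 \<le> i \<Longrightarrow> j \<in> {1..k} \<Longrightarrow> prob {\<omega> \<in> space M. X i \<omega> = j} = q j"
  using X by (auto simp: iid_truncated_geometric_def q_def)

lemma sum_q: "(\<Sum>j=1..k. q j) = 1"
proof -
  have "\<rho> ^ k \<le> \<rho> ^ 1" by (rule power_decreasing) (use k \<rho> in auto)
  then have \<rho>k: "1 - \<rho> ^ k \<noteq> 0" using \<rho> by auto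
  have "(\<Sum>j=1..k. q j) = (\<Sum>j<k. (1 - \<rho>) / (1 - \<rho> ^ k) * \<rho> ^ j)"
    by (rule sum.reindex_bij_witness[of _ Suc "\<lambda>j. j - 1"]) (auto simp: q_def)
  also have "\<dots> = (1 - \<rho>) / (1 - \<rho> ^ k) * (\<Sum>j<k. \<rho> ^ j)" by (simp add: sum_distrib_left)
  also have "(\<Sum>j<k. \<rho> ^ j) = (1 - \<rho> ^ k) / (1 - \<rho>)" using \<rho> by (simp add: sum_gp_strict)
  finally show ?thesis using \<rho> \<rho>k by simp
qed

text \<open>Only the probabilities of 1, ..., k are prescribed; they add up to 1 and leave nothing
  for other values.\<close>

lemma AE_X: "AE \<omega> in M. \<forall>i\<ge>1. X i \<omega> \<in> {1..k}"
proof -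
  have "AE \<omega> in M. 1 \<le> i \<longrightarrow> X i \<omega> \<in> {1..k}" for i
  proof (cases "1 \<le> i")
    case True
    note [measurable] = X_meas[OF True]
    have "prob (\<Union>j\<in>{1..k}. {\<omega> \<in> space M. X i \<omega> = j}) = (\<Sum>j\<in>{1..k}. prob {\<omega> \<in> space M. X i \<omega> = j})"
      by (rule finite_measure_finite_Union) (auto simp: disjoint_family_on_def)
    also have "\<dots> = (\<Sum>j=1..k. q j)" by (rule sum.cong[OF refl]) (use prob_X[OF True] in auto)
    also have "\<dots> = 1" by (rule sum_q)
    finally have "AE \<omega> in M. \<omega> \<in> (\<Union>j\<in>{1..k}. {\<omega> \<in> space M. X i \<omega> = j})"
      by (subst (asm) prob_eq_1) auto
    then show ?thesis by eventually_elim auto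
  qed simp
  then show ?thesis unfolding AE_all_countable by blast
qed

lemma c_0: "c 0 n = (if n = 0 then 1 else 0)"
  by (auto simp: c_def S_def prob_space)

lemma c_nonneg: "0 \<le> c l n"
  by (simp add: c_def)

lemma c_eq_0:
  assumes "n < l"
  shows "c l n = 0"
proof -
  have "AE \<omega> in M. \<not> (\<omega> \<in> {\<omega> \<in> space M. S l \<omega> = n})"
    using AE_X
  proof eventually_elim
    fix \<omega> assume X: "\<forall>i\<ge>1. X i \<omega> \<in> {1..k}"
    have "(\<Sum>i=1..l. 1) \<le> S l \<omega>" unfolding S_def by (rule sum_mono) (use X in auto)
    then show "\<not> (\<omega> \<in> {\<omega> \<in> space M. S l \<omega> = n})" using assms by simp
  qed
  then have "{\<omega> \<in> space M. S l \<omega> = n} \<in> null_sets M" by (subst AE_iff_null_sets) auto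
  then show ?thesis by (simp add: c_def measure_eq_0_null_sets)
qed

lemma prob_S_X: "prob {\<omega> \<in> space M. S l \<omega> = m \<and> X (Suc l) \<omega> = j} = c l m * prob {\<omega> \<in> space M. X (Suc l) \<omega> = j}"
proof -
  let ?C = "\<lambda>_::nat. count_space (UNIV :: nat set)"
  have "indep_vars ?C X {1..}" using X by (simp add: iid_truncated_geometric_def)
  then have ind: "indep_var (PiM {1..l} ?C) (\<lambda>\<omega>. restrict (\<lambda>i. X i \<omega>) {1..l}) (PiM {Suc l} ?C) (\<lambda>\<omega>. restrict (\<lambda>i. X i \<omega>) {Suc l})"
    by (rule indep_var_restrict) auto
  let ?A = "{x \<in> space (PiM {1..l} ?C). (\<Sum>i=1..l. x i) = m}"
  let ?B = "{x \<in> space (PiM {Suc l} ?C). (\<Sum>i\<in>{Suc l}. x i) = j}"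
  have "prob ((\<lambda>\<omega>. (restrict (\<lambda>i. X i \<omega>) {1..l}, restrict (\<lambda>i. X i \<omega>) {Suc l})) -` (?A \<times> ?B) \<inter> space M)
    = prob ((\<lambda>\<omega>. restrict (\<lambda>i. X i \<omega>) {1..l}) -` ?A \<inter> space M) * prob ((\<lambda>\<omega>. restrict (\<lambda>i. X i \<omega>) {Suc l}) -` ?B \<inter> space M)"
    by (rule indep_varD[OF ind]) (auto intro!: PiM_sum_eq_sets)
  moreover have "(\<lambda>\<omega>. (restrict (\<lambda>i. X i \<omega>) {1..l}, restrict (\<lambda>i. X i \<omega>) {Suc l})) -` (?A \<times> ?B) \<inter> space M
    = {\<omega> \<in> space M. S l \<omega> = m \<and> X (Suc l) \<omega> = j}"
    by (auto simp: space_PiM S_def)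
  moreover have "(\<lambda>\<omega>. restrict (\<lambda>i. X i \<omega>) {1..l}) -` ?A \<inter> space M = {\<omega> \<in> space M. S l \<omega> = m}"
    by (auto simp: space_PiM S_def)
  moreover have "(\<lambda>\<omega>. restrict (\<lambda>i. X i \<omega>) {Suc l}) -` ?B \<inter> space M = {\<omega> \<in> space M. X (Suc l) \<omega> = j}"
    by (auto simp: space_PiM)
  ultimately show ?thesis by (simp add: c_def)
qed

text \<open>Conditioning on the last jump. The bound \<open>min n k\<close> arises because this jump
  exceeds neither k nor the total n.\<close>

lemma c_Suc: "c (Suc l) n = (\<Sum>j=1..min n k. q j * c l (n - j))"
proof -
  note [measurable] = X_meas[of "Suc l", simplified]
  have "c (Suc l) n = prob (\<Union>j\<in>{1..min n k}. {\<omega> \<in> space M. S l \<omega> = n - j \<and> X (Suc l) \<omega> = j})"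
    unfolding c_def
  proof (rule measure_eq_AE)
    show "AE \<omega> in M. (\<omega> \<in> {\<omega> \<in> space M. S (Suc l) \<omega> = n}) = (\<omega> \<in> (\<Union>j\<in>{1..min n k}. {\<omega> \<in> space M. S l \<omega> = n - j \<and> X (Suc l) \<omega> = j}))"
      using AE_X AE_space
    proof eventually_elim
      fix \<omega> assume X: "\<forall>i\<ge>1. X i \<omega> \<in> {1..k}" and \<omega>: "\<omega> \<in> space M"
      have "S (Suc l) \<omega> = S l \<omega> + X (Suc l) \<omega>" by (simp add: S_def)
      moreover have "X (Suc l) \<omega> \<in> {1..k}" using X by simp
      ultimately show "(\<omega> \<in> {\<omega> \<in> space M. S (Suc l) \<omega> = n}) = (\<omega> \<in> (\<Union>j\<in>{1..min n k}. {\<omega> \<in> space M. S l \<omega> = n - j \<and> X (Suc l) \<omega> = j}))"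
        using \<omega> by auto
    qed
  qed measurable
  also have "\<dots> = (\<Sum>j\<in>{1..min n k}. prob {\<omega> \<in> space M. S l \<omega> = n - j \<and> X (Suc l) \<omega> = j})"
    by (rule finite_measure_finite_Union) (auto simp: disjoint_family_on_def)
  also have "\<dots> = (\<Sum>j=1..min n k. q j * c l (n - j))"
  proof (rule sum.cong[OF refl])
    fix j assume "j \<in> {1..min n k}"
    then have "prob {\<omega> \<in> space M. X (Suc l) \<omega> = j} = q j" by (intro prob_X) auto
    then show "prob {\<omega> \<in> space M. S l \<omega> = n - j \<and> X (Suc l) \<omega> = j} = q j * c l (n - j)"
      by (simp add: prob_S_X)
  qed
  finally show ?thesis .
qed

lemma prob_N: "0 < t \<Longrightarrow> prob {\<omega> \<in> space M. N t \<omega> = l} = \<phi> l t"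
proof -
  assume t: "0 < t"
  note [measurable] = N_meas[OF less_imp_le[OF t]] N_meas[OF order_refl]
  have "{\<omega> \<in> space M. N t \<omega> = N 0 \<omega> + l} = (\<Union>j. {\<omega> \<in> space M. N 0 \<omega> = j \<and> N t \<omega> = j + l})"
    by auto
  also have "\<dots> \<in> sets M" by measurable
  finally have [measurable]: "{\<omega> \<in> space M. N t \<omega> = N 0 \<omega> + l} \<in> sets M" .
  have N0: "AE \<omega> in M. N 0 \<omega> = 0" using N by (simp add: poisson_process_def)
  have "prob {\<omega> \<in> space M. N t \<omega> = l} = prob {\<omega> \<in> space M. N t \<omega> = N 0 \<omega> + l}"
  proof (rule measure_eq_AE)
    show "AE \<omega> in M. (\<omega> \<in> {\<omega> \<in> space M. N t \<omega> = l}) = (\<omega> \<in> {\<omega> \<in> space M. N t \<omega> = N 0 \<omega> + l})"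
      using N0 by eventually_elim simp
  qed measurable
  also have "\<dots> = pmf (poisson_pmf (lam * (t - 0))) l"
    using N t unfolding poisson_process_def by blast
  also have "\<dots> = \<phi> l t" using lam t by (simp add: \<phi>_def)
  finally show ?thesis .
qed

text \<open>Independence is used twice: the jumps are split off from the pair of N and E, and then N
  from E. Each event depends on finitely many coordinates at fixed indices, hence lies in the
  product sigma-algebra.\<close>

lemma prob_S_N_E:
  assumes t: "0 \<le> t" and r: "0 < r" and A: "A \<in> sets borel"
  shows "prob {\<omega> \<in> space M. S l \<omega> = n \<and> N r \<omega> = m \<and> E t \<omega> \<in> A} = c l n * (\<phi> m r * prob {\<omega> \<in> space M. E t \<omega> \<in> A})"
proof -
  let ?PX = "PiM {1..} (\<lambda>_::nat. count_space (UNIV :: nat set))"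
  let ?PN = "PiM {0::real..} (\<lambda>_. count_space (UNIV :: nat set))"
  let ?PE = "PiM {0::real..} (\<lambda>_. borel :: real measure)"
  let ?X = "\<lambda>\<omega>. \<lambda>i\<in>{1..}. X i \<omega>"
  let ?N = "\<lambda>\<omega>. \<lambda>t\<in>{0..}. N t \<omega>"
  let ?E = "\<lambda>\<omega>. \<lambda>t\<in>{0..}. E t \<omega>"
  let ?A1 = "{x \<in> space ?PX. (\<Sum>i=1..l. x i) = n}"
  let ?A2 = "{x \<in> space ?PN. (\<Sum>i\<in>{r}. x i) = m}"
  let ?A3 = "(\<lambda>x. x t) -` A \<inter> space ?PE"
  have s1: "?A1 \<in> sets ?PX" by (rule PiM_sum_eq_sets) auto
  have s2: "?A2 \<in> sets ?PN" by (rule PiM_sum_eq_sets) (use r in auto)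
  have s3: "?A3 \<in> sets ?PE"
  proof -
    have "(\<lambda>x. x t) \<in> measurable ?PE borel" by (rule measurable_component_singleton) (use t in simp)
    then show ?thesis using A by (rule measurable_sets)
  qed
  have e1: "?X -` ?A1 \<inter> space M = {\<omega> \<in> space M. S l \<omega> = n}"
    by (auto simp: space_PiM S_def)
  have e2: "?N -` ?A2 \<inter> space M = {\<omega> \<in> space M. N r \<omega> = m}"
    using r by (auto simp: space_PiM)
  have e3: "?E -` ?A3 \<inter> space M = {\<omega> \<in> space M. E t \<omega> \<in> A}"
    using t by (auto simp: space_PiM)
  have e4: "(\<lambda>\<omega>. (?N \<omega>, ?E \<omega>)) -` (?A2 \<times> ?A3) \<inter> space M = (?N -` ?A2 \<inter> space M) \<inter> (?E -` ?A3 \<inter> space M)"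
    by auto
  have i1: "prob ((?N -` ?A2 \<inter> space M) \<inter> (?E -` ?A3 \<inter> space M)) = prob (?N -` ?A2 \<inter> space M) * prob (?E -` ?A3 \<inter> space M)"
  proof (rule indep_setD)
    show "indep_set {?N -` A \<inter> space M |A. A \<in> sets ?PN} {?E -` A \<inter> space M |A. A \<in> sets ?PE}"
      using indep_N_E by (simp add: indep_random_elements_def)
    show "?N -` ?A2 \<inter> space M \<in> {?N -` A \<inter> space M |A. A \<in> sets ?PN}" using s2 by blast
    show "?E -` ?A3 \<inter> space M \<in> {?E -` A \<inter> space M |A. A \<in> sets ?PE}" using s3 by blast
  qed
  have i2: "prob ((?X -` ?A1 \<inter> space M) \<inter> ((\<lambda>\<omega>. (?N \<omega>, ?E \<omega>)) -` (?A2 \<times> ?A3) \<inter> space M))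
    = prob (?X -` ?A1 \<inter> space M) * prob ((\<lambda>\<omega>. (?N \<omega>, ?E \<omega>)) -` (?A2 \<times> ?A3) \<inter> space M)"
  proof (rule indep_setD)
    show "indep_set {?X -` A \<inter> space M |A. A \<in> sets ?PX} {(\<lambda>\<omega>. (?N \<omega>, ?E \<omega>)) -` A \<inter> space M |A. A \<in> sets (?PN \<Otimes>\<^sub>M ?PE)}"
      using indep_X_N_E by (simp add: indep_random_elements_def)
    show "?X -` ?A1 \<inter> space M \<in> {?X -` A \<inter> space M |A. A \<in> sets ?PX}" using s1 by blast
    have "?A2 \<times> ?A3 \<in> sets (?PN \<Otimes>\<^sub>M ?PE)" using s2 s3 by (rule pair_measureI)
    then show "(\<lambda>\<omega>. (?N \<omega>, ?E \<omega>)) -` (?A2 \<times> ?A3) \<inter> space M \<in> {(\<lambda>\<omega>. (?N \<omega>, ?E \<omega>)) -` A \<inter> space M |A. A \<in> sets (?PN \<Otimes>\<^sub>M ?PE)}"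
      by blast
  qed
  have "{\<omega> \<in> space M. S l \<omega> = n \<and> N r \<omega> = m \<and> E t \<omega> \<in> A} = {\<omega> \<in> space M. S l \<omega> = n} \<inter> ({\<omega> \<in> space M. N r \<omega> = m} \<inter> {\<omega> \<in> space M. E t \<omega> \<in> A})"
    by auto
  then show ?thesis
    using i1 i2 unfolding e4 unfolding e1 e2 e3 by (simp add: c_def prob_N[OF r])
qed

end

section \<open>Probability mass function of the compound process\<close>

lemma dyadic_above:
  assumes "0 \<le> (x::real)"
  shows "x < real (nat \<lfloor>2 ^ m * x\<rfloor> + 1) / 2 ^ m" "real (nat \<lfloor>2 ^ m * x\<rfloor> + 1) / 2 ^ m \<le> x + 1 / 2 ^ m"
proof -
  define y where "y = 2 ^ m * x"
  have y: "0 \<le> y" using assms by (simp add: y_def)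
  have "real (nat \<lfloor>y\<rfloor>) \<le> y" "y < real (nat \<lfloor>y\<rfloor>) + 1"
    using y by linarith+
  then show "x < real (nat \<lfloor>2 ^ m * x\<rfloor> + 1) / 2 ^ m" "real (nat \<lfloor>2 ^ m * x\<rfloor> + 1) / 2 ^ m \<le> x + 1 / 2 ^ m"
    unfolding y_def by (simp_all add: field_simps)
qed

context compound_time_changed
begin

text \<open>Independence factorises events about N at fixed times, but N is evaluated at the random
  time E t. Dyadic times strictly above E t take countably many values, and N, being
  right-continuous and integer valued, is eventually constant along them. The index l stops at n
  because every jump is at least 1.\<close>

lemma process_pmf_eq:
  assumes t: "0 \<le> t"
  shows "process_pmf M (compound_process X N E) n t = (\<Sum>l\<le>n. c l n * e l t)"
proof -
  note Em [measurable] = E_meas[OF t]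
  \<comment> \<open>Floor plus one rather than ceiling: the approximation stays strictly above E t,
    as right-continuity requires, and is positive even if E t = 0.\<close>
  define \<kappa> where "\<kappa> = (\<lambda>m \<omega>. nat \<lfloor>2 ^ m * E t \<omega>\<rfloor> + 1)"
  define \<tau> where "\<tau> = (\<lambda>m \<omega>. real (\<kappa> m \<omega>) / 2 ^ m)"
  define A where "A = (\<lambda>m. {\<omega> \<in> space M. S (N (\<tau> m \<omega>) \<omega>) \<omega> = n})"
  have \<tau>: "x = E t \<omega> \<Longrightarrow> 0 \<le> x \<Longrightarrow> x < \<tau> m \<omega> \<and> \<tau> m \<omega> \<le> x + 1 / 2 ^ m" for x m \<omega>
    unfolding \<tau>_def \<kappa>_def using dyadic_above by blast
  have \<tau>pos: "0 < \<tau> m \<omega>" for m \<omega> by (simp add: \<tau>_def \<kappa>_def)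
  have \<kappa>m [measurable]: "\<kappa> m \<in> measurable M (count_space UNIV)" for m
    unfolding \<kappa>_def by measurable
  have \<tau>m [measurable]: "\<tau> m \<in> borel_measurable M" for m
    unfolding \<tau>_def by measurable
  define B where "B = (\<lambda>m l j. {\<omega> \<in> space M. S l \<omega> = n \<and> N (real j / 2 ^ m) \<omega> = l \<and> \<kappa> m \<omega> = j})"
  have Bm [measurable]: "B m l j \<in> sets M" for m l j
  proof -
    have [measurable]: "N (real j / 2 ^ m) \<in> measurable M (count_space UNIV)" by (rule N_meas) simp
    show ?thesis unfolding B_def by measurable
  qed
  have AB: "A m = (\<Union>l. \<Union>j. B m l j)" for m
    unfolding A_def B_def \<tau>_def by auto
  have Am [measurable]: "A m \<in> sets M" for m unfolding AB by measurable
  have probB: "emeasure M (B m l j) = ennreal (c l n) * (ennreal (\<phi> l (real j / 2 ^ m)) * emeasure M {\<omega> \<in> space M. \<kappa> m \<omega> = j})" for m l j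
  proof (cases "j = 0")
    case True
    then have "B m l j = {}" "{\<omega> \<in> space M. \<kappa> m \<omega> = j} = {}" by (auto simp: B_def \<kappa>_def)
    then show ?thesis by (simp only: emeasure_empty mult_zero_right)
  next
    case False
    define Q where "Q = {x :: real. nat \<lfloor>2 ^ m * x\<rfloor> + 1 = j}"
    have "Q \<in> sets borel" unfolding Q_def by measurable
    then have "prob {\<omega> \<in> space M. S l \<omega> = n \<and> N (real j / 2 ^ m) \<omega> = l \<and> E t \<omega> \<in> Q} = c l n * (\<phi> l (real j / 2 ^ m) * prob {\<omega> \<in> space M. E t \<omega> \<in> Q})"
      using False by (intro prob_S_N_E t) auto
    then have "prob (B m l j) = c l n * (\<phi> l (real j / 2 ^ m) * prob {\<omega> \<in> space M. \<kappa> m \<omega> = j})"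
      by (simp add: B_def Q_def \<kappa>_def)
    moreover have "0 \<le> \<phi> l (real j / 2 ^ m)" by (rule \<phi>_nonneg) simp
    ultimately show ?thesis
      by (simp add: emeasure_eq_measure ennreal_mult c_nonneg)
  qed
  have \<phi>\<tau>_int: "integrable M (\<lambda>\<omega>. \<phi> l (\<tau> m \<omega>))" for l m
  proof (rule integrable_const_bound[where B=1])
    show "AE \<omega> in M. norm (\<phi> l (\<tau> m \<omega>)) \<le> 1"
      using \<tau>pos by (intro AE_I2) (simp add: \<phi>_nonneg \<phi>_le_1 less_imp_le)
  qed measurable
  have E\<phi>: "(\<Sum>j. ennreal (\<phi> l (real j / 2 ^ m)) * emeasure M {\<omega> \<in> space M. \<kappa> m \<omega> = j}) = ennreal (expectation (\<lambda>\<omega>. \<phi> l (\<tau> m \<omega>)))" for l m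
  proof -
    have "(\<Sum>j. ennreal (\<phi> l (real j / 2 ^ m)) * emeasure M {\<omega> \<in> space M. \<kappa> m \<omega> = j})
      = (\<Sum>j. \<integral>\<^sup>+ \<omega>. ennreal (\<phi> l (real j / 2 ^ m)) * indicator {\<omega> \<in> space M. \<kappa> m \<omega> = j} \<omega> \<partial>M)"
      by (intro suminf_cong nn_integral_cmult_indicator[symmetric]) measurable
    also have "\<dots> = (\<integral>\<^sup>+ \<omega>. (\<Sum>j. ennreal (\<phi> l (real j / 2 ^ m)) * indicator {\<omega> \<in> space M. \<kappa> m \<omega> = j} \<omega>) \<partial>M)"
      by (rule nn_integral_suminf[symmetric]) measurable
    also have "\<dots> = (\<integral>\<^sup>+ \<omega>. ennreal (\<phi> l (\<tau> m \<omega>)) \<partial>M)"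
    proof (rule nn_integral_cong)
      fix \<omega> assume \<omega>: "\<omega> \<in> space M"
      have "(\<Sum>j. ennreal (\<phi> l (real j / 2 ^ m)) * indicator {\<omega> \<in> space M. \<kappa> m \<omega> = j} \<omega>) = ennreal (\<phi> l (real (\<kappa> m \<omega>) / 2 ^ m))"
        by (rule suminf_cmult_indicator) (use \<omega> in \<open>auto simp: disjoint_family_on_def\<close>)
      then show "(\<Sum>j. ennreal (\<phi> l (real j / 2 ^ m)) * indicator {\<omega> \<in> space M. \<kappa> m \<omega> = j} \<omega>) = ennreal (\<phi> l (\<tau> m \<omega>))"
        by (simp add: \<tau>_def)
    qed
    also have "\<dots> = ennreal (expectation (\<lambda>\<omega>. \<phi> l (\<tau> m \<omega>)))"
      by (rule nn_integral_eq_integral[OF \<phi>\<tau>_int]) (use \<tau>pos in \<open>simp add: \<phi>_nonneg less_imp_le\<close>)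
    finally show ?thesis .
  qed
  have E\<phi>0: "0 \<le> expectation (\<lambda>\<omega>. \<phi> l (\<tau> m \<omega>))" for l m
    by (rule Bochner_Integration.integral_nonneg) (use \<tau>pos in \<open>simp add: \<phi>_nonneg less_imp_le\<close>)
  have probA: "prob (A m) = (\<Sum>l\<le>n. c l n * expectation (\<lambda>\<omega>. \<phi> l (\<tau> m \<omega>)))" for m
  proof -
    have "emeasure M (A m) = (\<Sum>l. emeasure M (\<Union>j. B m l j))"
      unfolding AB
    proof (rule suminf_emeasure[symmetric])
      show "range (\<lambda>l. \<Union>j. B m l j) \<subseteq> sets M" using Bm by auto
      show "disjoint_family (\<lambda>l. \<Union>j. B m l j)"
        by (auto simp: disjoint_family_on_def B_def)
    qed
    also have "\<dots> = (\<Sum>l. ennreal (c l n * expectation (\<lambda>\<omega>. \<phi> l (\<tau> m \<omega>))))"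
    proof (rule suminf_cong)
      fix l
      have "emeasure M (\<Union>j. B m l j) = (\<Sum>j. emeasure M (B m l j))"
      proof (rule suminf_emeasure[symmetric])
        show "range (B m l) \<subseteq> sets M" using Bm by auto
        show "disjoint_family (B m l)"
          by (auto simp: disjoint_family_on_def B_def)
      qed
      also have "\<dots> = ennreal (c l n) * ennreal (expectation (\<lambda>\<omega>. \<phi> l (\<tau> m \<omega>)))"
        unfolding probB E\<phi>[symmetric] by (rule ennreal_suminf_cmult)
      also have "\<dots> = ennreal (c l n * expectation (\<lambda>\<omega>. \<phi> l (\<tau> m \<omega>)))"
        by (rule ennreal_mult[symmetric]) (auto simp: c_nonneg E\<phi>0)
      finally show "emeasure M (\<Union>j. B m l j) = ennreal (c l n * expectation (\<lambda>\<omega>. \<phi> l (\<tau> m \<omega>)))" .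
    qed
    also have "\<dots> = (\<Sum>l\<le>n. ennreal (c l n * expectation (\<lambda>\<omega>. \<phi> l (\<tau> m \<omega>))))"
      by (rule suminf_finite) (auto simp: c_eq_0)
    also have "\<dots> = ennreal (\<Sum>l\<le>n. c l n * expectation (\<lambda>\<omega>. \<phi> l (\<tau> m \<omega>)))"
      by (rule sum_ennreal) (auto simp: c_nonneg E\<phi>0)
    finally have "ennreal (prob (A m)) = ennreal (\<Sum>l\<le>n. c l n * expectation (\<lambda>\<omega>. \<phi> l (\<tau> m \<omega>)))"
      by (simp add: emeasure_eq_measure)
    then show ?thesis
      by (subst (asm) ennreal_inj) (auto intro!: sum_nonneg mult_nonneg_nonneg simp: c_nonneg E\<phi>0)
  qed
  have \<tau>lim: "AE \<omega> in M. (\<lambda>m. \<tau> m \<omega>) \<longlonglongrightarrow> E t \<omega>"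
    using AE_E_nonneg
  proof eventually_elim
    fix \<omega> assume "\<forall>t. 0 \<le> E t \<omega>"
    then have E0: "0 \<le> E t \<omega>" by (rule spec)
    have *: "E t \<omega> \<le> \<tau> m \<omega>" "\<tau> m \<omega> \<le> E t \<omega> + (1 / 2) ^ m" for m
      using \<tau>[OF refl E0, of m] by (auto simp: power_one_over)
    have "(\<lambda>m. E t \<omega> + (1 / 2) ^ m) \<longlonglongrightarrow> E t \<omega> + 0"
      by (intro tendsto_intros LIMSEQ_power_zero) simp
    then have "(\<lambda>m. E t \<omega> + (1 / 2) ^ m) \<longlonglongrightarrow> E t \<omega>" by simp
    with _ _ tendsto_const show "(\<lambda>m. \<tau> m \<omega>) \<longlonglongrightarrow> E t \<omega>"
      by (rule tendsto_sandwich) (use * in \<open>simp_all add: always_eventually\<close>)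
  qed
  have lim1: "(\<lambda>m. expectation (\<lambda>\<omega>. \<phi> l (\<tau> m \<omega>))) \<longlonglongrightarrow> e l t" for l
    unfolding e_def
  proof (rule integral_dominated_convergence[where w="\<lambda>_. 1"])
    show "AE \<omega> in M. (\<lambda>m. \<phi> l (\<tau> m \<omega>)) \<longlonglongrightarrow> \<phi> l (E t \<omega>)"
      using \<tau>lim by eventually_elim (auto simp: \<phi>_def intro!: tendsto_intros)
    show "AE \<omega> in M. norm (\<phi> l (\<tau> m \<omega>)) \<le> 1" for m
      using \<tau>pos by (intro AE_I2) (simp add: \<phi>_nonneg \<phi>_le_1 less_imp_le)
  qed auto
  have limA: "(\<lambda>m. prob (A m)) \<longlonglongrightarrow> (\<Sum>l\<le>n. c l n * e l t)"
    unfolding probA by (intro tendsto_sum tendsto_mult tendsto_const lim1)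
  \<comment> \<open>A measurable substitute for the event \<open>Y\<close>, which is known to be
    measurable only in the completion of M.\<close>
  define A' where "A' = {\<omega> \<in> space M. \<exists>m0. \<forall>m\<ge>m0. \<omega> \<in> A m}"
  have [measurable]: "A' \<in> sets M" unfolding A'_def by measurable
  define Y where "Y = {\<omega> \<in> space M. compound_process X N E t \<omega> = n}"
  have AEY: "AE \<omega> in M. \<forall>\<^sub>F m in sequentially. \<omega> \<in> A m \<longleftrightarrow> \<omega> \<in> Y"
  proof -
    have "AE \<omega> in M. mono_on {0..} (\<lambda>t. N t \<omega>) \<and> (\<forall>t\<ge>0. continuous (at_right t) (\<lambda>r. N r \<omega>))"
      using N by (simp add: poisson_process_def)
    then show ?thesis using AE_E_nonneg \<tau>lim AE_space
    proof eventually_elim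
      fix \<omega> assume Nc: "mono_on {0..} (\<lambda>t. N t \<omega>) \<and> (\<forall>t\<ge>0. continuous (at_right t) (\<lambda>r. N r \<omega>))"
        and E0: "\<forall>t. 0 \<le> E t \<omega>" and lim: "(\<lambda>m. \<tau> m \<omega>) \<longlonglongrightarrow> E t \<omega>" and \<omega>: "\<omega> \<in> space M"
      have E0': "0 \<le> E t \<omega>" using E0 by (rule spec)
      have "((\<lambda>r. N r \<omega>) \<longlongrightarrow> N (E t \<omega>) \<omega>) (at_right (E t \<omega>))"
        using Nc E0' unfolding continuous_within by blast
      then have "\<forall>\<^sub>F r in at_right (E t \<omega>). N r \<omega> = N (E t \<omega>) \<omega>"
        by (simp add: tendsto_discrete)
      moreover have "filterlim (\<lambda>m. \<tau> m \<omega>) (at_right (E t \<omega>)) sequentially"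
        unfolding filterlim_at
      proof (intro conjI lim always_eventually allI)
        fix m
        show "\<tau> m \<omega> \<in> {E t \<omega><..}" "\<tau> m \<omega> \<noteq> E t \<omega>"
          using \<tau>[OF refl E0', of m] by auto
      qed
      ultimately have "\<forall>\<^sub>F m in sequentially. N (\<tau> m \<omega>) \<omega> = N (E t \<omega>) \<omega>"
        by (rule eventually_compose_filterlim)
      then show "\<forall>\<^sub>F m in sequentially. \<omega> \<in> A m \<longleftrightarrow> \<omega> \<in> Y"
        by eventually_elim (use \<omega> in \<open>auto simp: A_def Y_def S_def compound_process_def\<close>)
    qed
  qed
  have AEA': "AE \<omega> in M. \<omega> \<in> A' \<longleftrightarrow> \<omega> \<in> Y"
    using AEY AE_space
  proof eventually_elim
    fix \<omega> assume ev: "\<forall>\<^sub>F m in sequentially. \<omega> \<in> A m \<longleftrightarrow> \<omega> \<in> Y" and \<omega>: "\<omega> \<in> space M"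
    then obtain m0 where m0: "\<And>m. m \<ge> m0 \<Longrightarrow> \<omega> \<in> A m \<longleftrightarrow> \<omega> \<in> Y" by (auto simp: eventually_sequentially)
    show "\<omega> \<in> A' \<longleftrightarrow> \<omega> \<in> Y"
    proof
      assume "\<omega> \<in> A'"
      then obtain m1 where "\<And>m. m \<ge> m1 \<Longrightarrow> \<omega> \<in> A m" by (auto simp: A'_def)
      then show "\<omega> \<in> Y" using m0[of "max m0 m1"] by simp
    next
      assume "\<omega> \<in> Y"
      then show "\<omega> \<in> A'" using m0 \<omega> unfolding A'_def by blast
    qed
  qed
  have lim2: "(\<lambda>m. prob (A m)) \<longlonglongrightarrow> prob A'"
  proof -
    have "(\<lambda>m. expectation (indicator (A m) :: 'a \<Rightarrow> real)) \<longlonglongrightarrow> expectation (indicator A')"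
    proof (rule integral_dominated_convergence[where w="\<lambda>_. 1"])
      show "AE \<omega> in M. (\<lambda>m. indicator (A m) \<omega> :: real) \<longlonglongrightarrow> indicator A' \<omega>"
        using AEY AEA'
      proof eventually_elim
        fix \<omega> assume "\<forall>\<^sub>F m in sequentially. \<omega> \<in> A m \<longleftrightarrow> \<omega> \<in> Y" and *: "\<omega> \<in> A' \<longleftrightarrow> \<omega> \<in> Y"
        then have "\<forall>\<^sub>F m in sequentially. (indicator (A m) \<omega> :: real) = indicator A' \<omega>"
          by (elim eventually_mono) (simp add: indicator_def)
        then show "(\<lambda>m. indicator (A m) \<omega> :: real) \<longlonglongrightarrow> indicator A' \<omega>" by (rule tendsto_eventually)
      qed
    qed auto
    then show ?thesis by simp
  qed
  have "prob A' = (\<Sum>l\<le>n. c l n * e l t)" by (rule LIMSEQ_unique[OF lim2 limA])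
  moreover have "process_pmf M (compound_process X N E) n t = measure (completion M) A'"
  proof -
    have AEc: "AE \<omega> in completion M. \<omega> \<in> A' \<longleftrightarrow> \<omega> \<in> Y" using AEA' by (rule AE_completion)
    have A'c: "A' \<in> sets (completion M)" by (rule sets_completionI_sets) measurable
    have "Y \<in> sets (completion M)"
      by (rule completion.in_sets_AE[OF AEc A'c]) (auto simp: Y_def)
    then have "measure (completion M) A' = measure (completion M) Y"
      by (rule measure_eq_AE[OF AEc A'c])
    then show ?thesis by (simp add: process_pmf_def Y_def)
  qed
  ultimately show ?thesis by simp
qed

lemma e_0: "e 0 t = expectation (\<lambda>\<omega>. exp (- (lam * E t \<omega>)))"
  by (simp add: e_def \<phi>_def)

lemma e_0_antimono: "0 \<le> x \<Longrightarrow> x \<le> y \<Longrightarrow> e 0 y \<le> e 0 x"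
  unfolding e_def
proof (rule integral_mono_AE)
  assume xy: "0 \<le> x" "x \<le> y"
  show "integrable M (\<lambda>\<omega>. \<phi> 0 (E y \<omega>))" "integrable M (\<lambda>\<omega>. \<phi> 0 (E x \<omega>))"
    using xy by (auto intro: ennreal_e)
  show "AE \<omega> in M. \<phi> 0 (E y \<omega>) \<le> \<phi> 0 (E x \<omega>)"
    using AE_E_mono
  proof eventually_elim
    fix \<omega> assume "\<forall>s t. s \<le> t \<longrightarrow> E s \<omega> \<le> E t \<omega>"
    then have "E x \<omega> \<le> E y \<omega>" using xy by blast
    then show "\<phi> 0 (E y \<omega>) \<le> \<phi> 0 (E x \<omega>)" using lam by (simp add: \<phi>_def)
  qed
qed

lemma e_0_nonneg: "0 \<le> e 0 t"
  unfolding e_0 by (intro Bochner_Integration.integral_nonneg) simp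

lemma e_0_le_1: "0 \<le> t \<Longrightarrow> e 0 t \<le> 1"
proof -
  assume t: "0 \<le> t"
  have "e 0 t \<le> expectation (\<lambda>_. 1)"
    unfolding e_def
  proof (rule integral_mono_AE)
    show "integrable M (\<lambda>\<omega>. \<phi> 0 (E t \<omega>))" using t by (rule ennreal_e)
    show "AE \<omega> in M. \<phi> 0 (E t \<omega>) \<le> 1"
      using AE_E_nonneg by eventually_elim (simp add: \<phi>_le_1)
  qed simp
  then show ?thesis by (simp add: prob_space)
qed

text \<open>The Laplace transform of \<open>e 0\<close> is at most \<open>e 0 0 / s\<close> and equals \<open>f s / (s (lam + f s))\<close>,
  where \<open>f s\<close> is unbounded since \<open>\<nu>\<close> is infinite.\<close>

lemma e_0_at_0: "e 0 0 = 1"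
proof (rule antisym[OF e_0_le_1])
  have le: "f s / (lam + f s) \<le> e 0 0" if s: "0 < s" for s
  proof -
    have fs: "0 < f s" by (rule f_pos[OF s])
    have "ennreal (f s / (s * (lam + f s))) = laplace (\<lambda>t. ennreal (e 0 t) * indicator {0..} t) s"
      using laplace_e[OF s, of 0] by simp
    also have "\<dots> \<le> laplace (\<lambda>t. ennreal (e 0 0) * indicator {0..} t) s"
      unfolding laplace_def
      by (rule nn_integral_mono)
        (auto split: split_indicator intro!: mult_right_mono ennreal_leI e_0_antimono)
    also have "\<dots> = ennreal (e 0 0) * ennreal (1 / s)"
      by (subst laplace_cmult) (auto simp: laplace_indicator[OF s])
    also have "\<dots> = ennreal (e 0 0 * (1 / s))"
      using s by (intro ennreal_mult[symmetric]) (auto simp: e_0_nonneg)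
    finally have "f s / (s * (lam + f s)) \<le> e 0 0 * (1 / s)"
      using s by (subst (asm) ennreal_le_iff) (auto simp: e_0_nonneg)
    then have "f s / (lam + f s) * (1 / s) \<le> e 0 0 * (1 / s)" by (simp add: mult.commute)
    then show ?thesis using s by (simp only: mult_le_cancel_right_pos zero_less_divide_1_iff)
  qed
  show "1 \<le> e 0 0"
  proof (rule ccontr)
    assume "\<not> 1 \<le> e 0 0"
    then have r: "0 < 1 - e 0 0" by simp
    \<comment> \<open>Chosen so that f(s) (1 - e 0 0) exceeds \<open>lam\<close> (e 0 0), which
      contradicts the bound \<open>le\<close>; the summand 1 makes the inequality strict.\<close>
    obtain s where s: "s > 0" "lam * e 0 0 / (1 - e 0 0) + 1 \<le> f s"
      using bernstein_fun_unbounded[OF b \<nu> \<nu>_inf] by blast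
    have "lam * e 0 0 < f s * (1 - e 0 0)"
      using s(2) r by (simp add: pos_divide_le_eq[symmetric] less_le_trans field_simps)
    moreover have "f s \<le> e 0 0 * (lam + f s)"
      using le[OF s(1)] f_pos[OF s(1)] lam by (simp add: pos_divide_le_eq)
    ultimately show False by (simp add: algebra_simps)
  qed
qed simp

text \<open>The weights \<open>c l n\<close> do not depend on time, so everything reduces to the
  functions \<open>gr l\<close>. The shift from l to l - 1 in their equations becomes, by the
  recursion for \<open>c\<close>, a sum over the size of one jump.\<close>

lemma process_pmf_has_gen_CD_derivative:
  defines "P \<equiv> process_pmf M (compound_process X N E)"
  assumes ac: "\<And>n. abs_continuous_halfline (P n)"
  shows "0 < t \<Longrightarrow> has_gen_CD_derivative b \<nu> (P n) (- lam * (P n t - (\<Sum>j=1..min n k. q j * P (n - j) t))) t"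
    and "P n 0 = (if n = 0 then 1 else 0)"
proof -
  have P: "P n t = (\<Sum>l\<le>n. c l n * e l t)" if "0 \<le> t" for n t
    unfolding P_def by (rule process_pmf_eq[OF that])
  have P0: "P 0 t = e 0 t" if "0 \<le> t" for t using P[OF that, of 0] by (simp add: c_0)
  obtain v where v: "v \<in> borel_measurable borel" "\<And>t. t \<le> 0 \<Longrightarrow> v t = 0"
    "\<And>t. 0 \<le> t \<Longrightarrow> ennreal (P 0 t) + ennreal lam * conv v (indicator {0..}) t = 1"
    "\<And>t. 0 < t \<Longrightarrow> ennreal b * v t + conv v (levy_tail' \<nu>) t = ennreal (P 0 t)"
    "\<And>s. s > 0 \<Longrightarrow> laplace v s = ennreal (1 / (lam + f s))"
  proof (rule potential_density_exists[OF b \<nu> lam ac[of 0]])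
    show "P 0 y \<le> P 0 x" if "0 \<le> x" "x \<le> y" for x y
      using that e_0_antimono[OF that] by (simp add: P0)
    show "P 0 0 = 1" by (simp add: P0 e_0_at_0)
    show "0 \<le> P 0 x" if "0 \<le> x" for x using that by (simp add: P0 e_0_nonneg)
    show "laplace (\<lambda>t. ennreal (P 0 t) * indicator {0..} t) s = ennreal (f s / (s * (lam + f s)))" if s: "0 < s" for s
    proof -
      have "(\<lambda>t. ennreal (P 0 t) * indicator {0..} t) = (\<lambda>t. ennreal (e 0 t) * indicator {0..} t)"
        by (auto simp: P0 split: split_indicator)
      then show ?thesis using laplace_e[OF s, of 0] by simp
    qed
  qed (rule that)
  interpret pd: potential_density b lam \<nu> "e 0" v
  proof
    show "(\<lambda>t. ennreal (e 0 t) * indicator {0..} t) \<in> borel_measurable borel" by (rule e_meas)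
    show "laplace (\<lambda>t. ennreal (e 0 t) * indicator {0..} t) s = ennreal (f s / (s * (lam + f s)))" if "0 < s" for s
      using laplace_e[OF that, of 0] by simp
  qed (use b \<nu> lam v P0 in auto)
  \<comment> \<open>The whole combinations are compared rather than e l with \<open>gr l\<close>:
    continuity is at hand for P n and for \<open>gr l\<close>, and it upgrades the almost everywhere
    equality to all times.\<close>
  have Pg: "P n t = (\<Sum>l\<le>n. c l n * pd.gr l t)" if t: "0 \<le> t" for n t
  proof -
    define h where "h = (\<lambda>t. \<Sum>l\<le>n. c l n * pd.gr l t)"
    have AE: "AE t in lborel. (\<Sum>l\<le>n. ennreal (c l n) * (ennreal (e l t) * indicator {0..} t)) = (\<Sum>l\<le>n. ennreal (c l n) * pd.g l t)"
    proof (rule laplace_unique_AE)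
      fix s :: real assume s: "0 < s"
      have fs: "0 < f s" by (rule f_pos[OF s])
      have L: "laplace (\<lambda>t. \<Sum>l\<le>n. ennreal (c l n) * (ennreal (e l t) * indicator {0..} t)) s = (\<Sum>l\<le>n. ennreal (c l n) * ennreal (lam ^ l * (f s / (s * (lam + f s) ^ Suc l))))"
        by (subst laplace_sum) (auto simp: laplace_cmult laplace_e[OF s])
      have R: "laplace (\<lambda>t. \<Sum>l\<le>n. ennreal (c l n) * pd.g l t) s = (\<Sum>l\<le>n. ennreal (c l n) * ennreal (lam ^ l * (f s / (s * (lam + f s) ^ Suc l))))"
        by (subst laplace_sum) (auto simp: laplace_cmult pd.laplace_g[OF s])
      show "laplace (\<lambda>t. \<Sum>l\<le>n. ennreal (c l n) * (ennreal (e l t) * indicator {0..} t)) s = laplace (\<lambda>t. \<Sum>l\<le>n. ennreal (c l n) * pd.g l t) s"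
        unfolding L R ..
      show "laplace (\<lambda>t. \<Sum>l\<le>n. ennreal (c l n) * (ennreal (e l t) * indicator {0..} t)) s < \<infinity>"
        unfolding L by (simp add: ennreal_mult_less_top)
    qed (auto simp: pd.g_neg)
    have AE': "AE t in lborel. 0 < t \<longrightarrow> P n t = h t"
      using AE
    proof eventually_elim
      fix t assume eq: "(\<Sum>l\<le>n. ennreal (c l n) * (ennreal (e l t) * indicator {0..} t)) = (\<Sum>l\<le>n. ennreal (c l n) * pd.g l t)"
      show "0 < t \<longrightarrow> P n t = h t"
      proof
        assume t: "0 < t"
        have e0: "0 \<le> e l t" for l
          unfolding e_def by (rule integral_nonneg_AE) (use AE_E_nonneg in \<open>eventually_elim, simp add: \<phi>_nonneg\<close>)
        have g0: "0 \<le> pd.gr l t" for l by (simp add: pd.gr_def)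
        have "ennreal (\<Sum>l\<le>n. c l n * e l t) = ennreal (\<Sum>l\<le>n. c l n * pd.gr l t)"
          using eq t e0 g0 by (simp add: pd.g_eq_gr ennreal_mult[symmetric] c_nonneg)
        then have "(\<Sum>l\<le>n. c l n * e l t) = (\<Sum>l\<le>n. c l n * pd.gr l t)"
          using e0 g0 by (subst (asm) ennreal_inj) (auto intro!: sum_nonneg mult_nonneg_nonneg simp: c_nonneg)
        then show "P n t = h t" using t by (simp add: P h_def)
      qed
    qed
    have c1: "continuous_on {0..} (P n)" by (rule abs_continuous_halfline_imp_continuous_on[OF ac])
    have c2: "continuous_on {0..} h" unfolding h_def by (intro continuous_intros pd.gr_continuous)
    have "P n t \<le> h t"
      by (rule AE_lborel_le_imp_le[OF c1 c2 _ t]) (use AE' in \<open>eventually_elim, simp\<close>)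
    moreover have "h t \<le> P n t"
      by (rule AE_lborel_le_imp_le[OF c2 c1 _ t]) (use AE' in \<open>eventually_elim, simp\<close>)
    ultimately show ?thesis by (simp add: h_def)
  qed
  show "P n 0 = (if n = 0 then 1 else 0)"
  proof -
    have gr0: "pd.gr l 0 = (if l = 0 then 1 else 0)" for l
      using pd.gr_eq_integral[of 0 l] by (simp add: set_integral_lborel_singleton)
    have "P n 0 = (\<Sum>l\<le>n. if l = 0 then c l n else 0)"
      unfolding Pg[OF order_refl] gr0 by (rule sum.cong) auto
    also have "\<dots> = c 0 n" by (simp add: sum.delta)
    finally show ?thesis by (simp add: c_0)
  qed
  assume t: "0 < t"
  have "(\<Sum>l\<le>n. c l n * pd.prev pd.gr l t) = (\<Sum>j=1..min n k. q j * P (n - j) t)"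
  proof -
    \<comment> \<open>A common range l < n for all m = n - j, so that the two sums can be
      interchanged; the added terms vanish because \<open>c l m\<close> = 0 for l > m.\<close>
    have Pg': "P m t = (\<Sum>l<n. c l m * pd.gr l t)" if "m < n" for m
    proof -
      have "P m t = (\<Sum>l\<le>m. c l m * pd.gr l t)" using Pg t by simp
      also have "\<dots> = (\<Sum>l<n. c l m * pd.gr l t)"
        by (rule sum.mono_neutral_left) (use that in \<open>auto simp: c_eq_0\<close>)
      finally show ?thesis .
    qed
    have "(\<Sum>l\<le>n. c l n * pd.prev pd.gr l t) = (\<Sum>l<n. c (Suc l) n * pd.gr l t)"
      by (cases n) (simp_all add: sum.atMost_Suc_shift lessThan_Suc_atMost del: sum.atMost_Suc)
    also have "\<dots> = (\<Sum>l<n. \<Sum>j=1..min n k. q j * c l (n - j) * pd.gr l t)"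
      by (simp add: c_Suc sum_distrib_right)
    also have "\<dots> = (\<Sum>j=1..min n k. \<Sum>l<n. q j * c l (n - j) * pd.gr l t)"
      by (rule sum.swap)
    also have "\<dots> = (\<Sum>j=1..min n k. q j * P (n - j) t)"
      by (rule sum.cong[OF refl]) (auto simp: Pg' sum_distrib_left mult.assoc)
    finally show ?thesis .
  qed
  moreover have "(\<Sum>l\<le>n. c l n * pd.gr l t) = P n t" using Pg t by simp
  ultimately have eq: "lam * (\<Sum>l\<le>n. c l n * (pd.prev pd.gr l t - pd.gr l t)) = - lam * (P n t - (\<Sum>j=1..min n k. q j * P (n - j) t))"
    by (simp add: right_diff_distrib sum_subtractf algebra_simps)
  show "has_gen_CD_derivative b \<nu> (P n) (- lam * (P n t - (\<Sum>j=1..min n k. q j * P (n - j) t))) t"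
    unfolding eq[symmetric] by (rule pd.has_gen_CD_derivative_sum[OF Pg ac t])
qed

end

lemma backward_shift_funpow: "(backward_shift ^^ j) P n t = P (n - j) t"
  by (induction j arbitrary: n) (simp_all add: backward_shift_def)

theorem theorem4p5:
  fixes M :: "'a measure" and \<nu> :: "real measure" and b lam \<rho> :: real and k :: nat
    and D :: "real \<Rightarrow> 'a \<Rightarrow> real" and E :: "real \<Rightarrow> 'a \<Rightarrow> real"
    and N :: "real \<Rightarrow> 'a \<Rightarrow> nat" and X :: "nat \<Rightarrow> 'a \<Rightarrow> nat"
    and P :: "nat \<Rightarrow> real \<Rightarrow> real"
  defines "E \<equiv> inverse_subordinator D"
    and "P \<equiv> process_pmf M (compound_process X N E)"
  assumes "prob_space M"
    and "b \<ge> 0" and "levy_measure \<nu>" and "emeasure \<nu> {0<..} = \<infinity>"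
    and "levy_subordinator M (bernstein_fun b \<nu>) D"
    and "lam > 0" and "poisson_process M lam N"
    and "k \<ge> 1" and "0 \<le> \<rho>" and "\<rho> < 1" and "iid_truncated_geometric M \<rho> k X"
    and indep_N_E: "indep_random_elements M
          (PiM {0..} (\<lambda>_. count_space UNIV)) (\<lambda>\<omega>. \<lambda>t\<in>{0..}. N t \<omega>)
          (PiM {0..} (\<lambda>_. borel)) (\<lambda>\<omega>. \<lambda>t\<in>{0..}. E t \<omega>)"
    and indep_X_N_E: "indep_random_elements M
          (PiM {1..} (\<lambda>_. count_space UNIV)) (\<lambda>\<omega>. \<lambda>i\<in>{1..}. X i \<omega>)
          (PiM {0..} (\<lambda>_. count_space UNIV) \<Otimes>\<^sub>M PiM {0..} (\<lambda>_. borel))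
          (\<lambda>\<omega>. (\<lambda>t\<in>{0..}. N t \<omega>, \<lambda>t\<in>{0..}. E t \<omega>))"
    and domain: "\<And>n. abs_continuous_halfline (P n)"
  shows "(\<forall>n\<ge>1. \<forall>t>0. has_gen_CD_derivative b \<nu> (P n)
            (- lam * (P n t - (1 - \<rho>) / (1 - \<rho> ^ k) *
               (\<Sum>j=1..min n k. \<rho> ^ (j - 1) * (backward_shift ^^ j) P n t))) t)
       \<and> (\<forall>t>0. has_gen_CD_derivative b \<nu> (P 0) (- lam * P 0 t) t)
       \<and> (\<forall>n. P n 0 = (if n = 0 then 1 else 0))"
proof -
  \<comment> \<open>Measurability of the path map into the product space is part of the independence
    hypothesis, and evaluation at t is a measurable coordinate.\<close>
  have E_meas: "inverse_subordinator D t \<in> borel_measurable M" if t: "0 \<le> t" for t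
  proof -
    have "(\<lambda>\<omega>. \<lambda>t\<in>{0..}. E t \<omega>) \<in> measurable M (PiM {0..} (\<lambda>_. borel))"
      using indep_N_E by (simp add: indep_random_elements_def)
    then have "(\<lambda>\<omega>. (\<lambda>t\<in>{0..}. E t \<omega>) t) \<in> borel_measurable M"
      by (rule measurable_compose[OF _ measurable_component_singleton]) (use t in simp)
    then show ?thesis using t by (simp add: E_def)
  qed
  interpret prob_space M by fact
  interpret compound_time_changed M b \<nu> D lam \<rho> k N X
    by unfold_locales (use assms(4-13) E_meas indep_N_E indep_X_N_E in \<open>simp_all add: E_def\<close>)
  have q: "(1 - \<rho>) / (1 - \<rho> ^ k) * (\<Sum>j=1..min n k. \<rho> ^ (j - 1) * (backward_shift ^^ j) P n t)
    = (\<Sum>j=1..min n k. q j * P (n - j) t)" for n t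
    by (simp add: q_def sum_distrib_left backward_shift_funpow mult.assoc)
  note CD = process_pmf_has_gen_CD_derivative[folded E_def, folded P_def, OF domain]
  show ?thesis
    \<comment> \<open>For n = 0 the jump sum is empty, so the instance at 0 gives the second
      equation.\<close>
    unfolding q using CD(1)[of _ 0] CD by auto
qed

end
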